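(* Let $\mathcal{H},A,Q,\overline{s},F$ be as in the context, and for $h\in(0,1)$ let $(u_n)_{n\ge0},(\overline u_n)_{n\ge0}$ be defined by $$u_{n+1}=J_1\Big(u_n+hF\big(u_n+\tfrac12\sqrt hJ_2\xi_n^Q\big)+\tfrac{\sqrt2-1}{2}\sqrt hJ_2\xi_n^Q\Big)+\tfrac{3-\sqrt2}{2}\sqrt hJ_2\xi_n^Q,\qquad \overline u_n=u_n+\tfrac12\sqrt hJ_3\xi_n^Q ,$$ with deterministic initial value $u_0\in\mathcal{H}$ and arbitrary $\overline u_{-1}\in\mathcal{H}$. For any $h\in(0,1)$, the $\mathcal{H}\times\mathcal{H}$-valued Markov chain $(u_n,\overline u_{n-1})_{n\in\mathbb{N}}$ admits a unique invariant distribution $\mathrm{M}_\infty^h$ on $\mathcal{H}\times\mathcal{H}$, with marginals in $\mathcal{H}$ denoted by $\mu_\infty^h$ (first) and $\overline\mu_\infty^h$ (second). Moreover, the convergence to equilibrium is exponentially fast: for every Lipschitz test function $\varphi:\mathcal{H}\to\mathbb{R}$ there is a constant $C(\varphi,|u_0|)$, depending only on $\varphi$ and $|u_0|$ (and on $A,Q,F$), such that for all $n\in\mathbb{N}$, with $t_n=nh$, $$\Big|\mathbb{E}\varphi(u_n)-\int_{\mathcal{H}}\varphi\,d\mu_\infty^h\Big|+\Big|\mathbb{E}\varphi(\overline u_n)-\int_{\mathcal{H}}\varphi\,d\overline\mu_\infty^h\Big|\le C(\varphi,|u_0|)\exp\Big(-\frac{\lambda_1-L}{1+\lambda_1h}t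_n\Big).$$
   Context: $\mathcal{H}$ is a separable infinite-dimensional Hilbert space with norm $|\cdot|$. $-A$ is an unbounded self-adjoint operator on $\mathcal{H}$ with eigenvalues $0<\lambda_1\le\lambda_2\le\cdots$, $\lambda_p\to+\infty$, and complete orthonormal eigenvectors $(e_p)_{p\ge1}$, $Ae_p=-\lambda_pe_p$. $Q$ is a bounded non-negative self-adjoint operator with $Qe_p=q_pe_p$, $(q_p)$ a bounded sequence of non-negative reals. The standing trace condition is $\overline{s}=\sup\{s\in(0,1):\mathrm{Trace}((-A)^{-1+s}Q)<+\infty\}>0$. $F:\mathcal{H}\to\mathcal{H}$ is Lipschitz continuous with constant $L=\sup_{u^1\ne u^2}\frac{|F(u^1)-F(u^2)|}{|u^1-u^2|}<\lambda_1$ (no gradient structure of $F$ is required). $W^Q(t)=\sum_{p\ge1}\sqrt{q_p}\,\beta_p(t)e_p$ with $(\beta_p)$ independent standard scalar Wiener processes. For a timestep $h>0$: $\xi_n^Q=h^{-1/2}(W^Q((n+1)h)-W^Q(nh))$, $J_1=(I-hA)^{-1}$, $J_2=(I-\frac{3-\sqrt2}{2}hA)^{-1}$, and $J_3$ satisfies $J_3QJ_3^T=(I-\frac h2A)^{-1}Q$ (e.g. $J_3=(I-\frac h2A)^{-1/2}$). The value $\overline u_{-1}$ plays no role in the dynamics, since $(u_{n+1},\overline u_n)$ depends only on $u_n$ and $\xi_n^Q$. *)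

theory Defs
  imports "HOL-Probability.Probability"
begin

section \<open>Operators on the Hilbert space\<close>

text \<open>
  Linear operator \<open>T\<close> with domain \<open>D\<close> (values of \<open>T\<close> outside \<open>D\<close> are irrelevant). The last clause
  says that the graph of the adjoint of \<open>T\<close>, that is the set of all pairs \<open>(y, z)\<close> with
  \<open>\<langle>T x, y\<rangle> = \<langle>x, z\<rangle>\<close> for every \<open>x\<close> in \<open>D\<close>, is the graph of \<open>T\<close> on \<open>D\<close>.
\<close>
definition self_adjoint_on :: "'a::real_inner set \<Rightarrow> ('a \<Rightarrow> 'a) \<Rightarrow> bool" where
  "self_adjoint_on D T \<longleftrightarrow>
     subspace D \<and> closure D = UNIV \<and>
     (\<forall>x\<in>D. \<forall>y\<in>D. T (x + y) = T x + T y) \<and>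
     (\<forall>x\<in>D. \<forall>c. T (c *\<^sub>R x) = c *\<^sub>R T x) \<and>
     (\<forall>y z. (\<forall>x\<in>D. inner (T x) y = inner x z) \<longleftrightarrow> (y \<in> D \<and> T y = z))"

definition complete_orthonormal :: "(nat \<Rightarrow> 'a::real_inner) \<Rightarrow> bool" where
  "complete_orthonormal e \<longleftrightarrow>
     (\<forall>i j. inner (e i) (e j) = (if i = j then 1 else 0)) \<and> closure (span (range e)) = UNIV"

text \<open>\<open>(I - c A)\<^sup>-\<^sup>1\<close>, for an operator \<open>A\<close> with domain \<open>D\<close>.\<close>
definition resolvent :: "'a::real_vector set \<Rightarrow> ('a \<Rightarrow> 'a) \<Rightarrow> real \<Rightarrow> 'a \<Rightarrow> 'a" where
  "resolvent D A c = inv_into D (\<lambda>x. x - c *\<^sub>R A x)"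

text \<open>
  \<open>(-A)\<^sup>r\<close> by functional calculus, where \<open>-A\<close> has eigenvalues \<open>lam\<close> and eigenbasis \<open>e\<close>. Only negative
  exponents are used, for which this is a bounded operator.
\<close>
definition frac_power :: "(nat \<Rightarrow> 'a::real_inner) \<Rightarrow> (nat \<Rightarrow> real) \<Rightarrow> real \<Rightarrow> 'a \<Rightarrow> 'a" where
  "frac_power e lam r x = (\<Sum>p. (lam p powr r * inner x (e p)) *\<^sub>R e p)"

text \<open>
  Trace, in \<open>[0, \<infinity>]\<close>, of a non-negative operator \<open>T\<close> with respect to the orthonormal basis \<open>e\<close>.
\<close>
definition op_trace :: "(nat \<Rightarrow> 'a::real_inner) \<Rightarrow> ('a \<Rightarrow> 'a) \<Rightarrow> ennreal" where
  "op_trace e T = (\<Sum>p. ennreal (inner (T (e p)) (e p)))"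

text \<open>
  The exponent \<open>sup {s \<in> (0,1). Trace ((-A)\<^sup>-\<^sup>1\<^sup>+\<^sup>s Q) < \<infinity>}\<close>. It is taken in the extended reals, so that it
  is \<open>-\<infinity>\<close> (and not an unspecified real number) if the set is empty.
\<close>
definition s_bar :: "(nat \<Rightarrow> 'a::real_inner) \<Rightarrow> (nat \<Rightarrow> real) \<Rightarrow> ('a \<Rightarrow> 'a) \<Rightarrow> ereal" where
  "s_bar e lam Q =
     Sup (ereal ` {s \<in> {0<..<1}. op_trace e (frac_power e lam (- 1 + s) \<circ> Q) < \<infinity>})"

text \<open>Meaningful for Lipschitz continuous functions only (otherwise the set is unbounded).\<close>
definition lip_const :: "('a::real_normed_vector \<Rightarrow> 'a) \<Rightarrow> real" where
  "lip_const F = Sup {norm (F u - F v) / norm (u - v) |u v. u \<noteq> v}"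

section \<open>Wiener processes and noise\<close>

definition std_wiener :: "'w measure \<Rightarrow> (real \<Rightarrow> 'w \<Rightarrow> real) \<Rightarrow> bool" where
  "std_wiener \<Omega> B \<longleftrightarrow>
     (\<forall>t\<ge>0. B t \<in> borel_measurable \<Omega>) \<and>
     (AE \<omega> in \<Omega>. B 0 \<omega> = 0) \<and>
     (AE \<omega> in \<Omega>. continuous_on {0..} (\<lambda>t. B t \<omega>)) \<and>
     (\<forall>s\<ge>0. \<forall>t>s. distributed \<Omega> lborel (\<lambda>\<omega>. B t \<omega> - B s \<omega>) (normal_density 0 (sqrt (t - s)))) \<and>
     (\<forall>(n::nat) (\<tau>::nat \<Rightarrow> real). 0 \<le> \<tau> 0 \<and> mono \<tau> \<longrightarrow>
        prob_space.indep_vars \<Omega> (\<lambda>_. borel) (\<lambda>i \<omega>. B (\<tau> (Suc i)) \<omega> - B (\<tau> i) \<omega>) {..<n})"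

text \<open>
  Sequence of standard Wiener processes that are independent as processes, that is as random
  elements of the product space of all real functions on \<open>[0, \<infinity>)\<close>.
\<close>
definition indep_wiener :: "'w measure \<Rightarrow> (nat \<Rightarrow> real \<Rightarrow> 'w \<Rightarrow> real) \<Rightarrow> bool" where
  "indep_wiener \<Omega> \<beta> \<longleftrightarrow>
     (\<forall>p. std_wiener \<Omega> (\<beta> p)) \<and>
     prob_space.indep_vars \<Omega> (\<lambda>_. PiM {0..} (\<lambda>_. borel)) (\<lambda>p \<omega>. \<lambda>t\<in>{0..}. \<beta> p t \<omega>) UNIV"

text \<open>
  The random variable \<open>J \<xi>\<^sub>n\<^sup>Q\<close> for a bounded operator \<open>J\<close>, where
  \<open>\<xi>\<^sub>n\<^sup>Q = h\<^sup>-\<^sup>1\<^sup>/\<^sup>2 (W\<^sup>Q((n+1)h) - W\<^sup>Q(nh)) = (\<Sum>p. sqrt (q p) \<gamma>\<^sub>n\<^sub>,\<^sub>p e\<^sub>p)\<close>. The series for \<open>\<xi>\<^sub>n\<^sup>Q\<close> itself does not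
  converge in the Hilbert space unless \<open>Q\<close> is trace class, so \<open>J\<close> is applied termwise. If
  \<open>J Q J\<^sup>T\<close> is trace class, the series of independent Gaussian vectors below converges almost surely
  and in mean square.
\<close>
definition noise ::
  "(nat \<Rightarrow> 'a::real_normed_vector) \<Rightarrow> (nat \<Rightarrow> real) \<Rightarrow> (nat \<Rightarrow> real \<Rightarrow> 'w \<Rightarrow> real) \<Rightarrow> real \<Rightarrow>
    ('a \<Rightarrow> 'a) \<Rightarrow> nat \<Rightarrow> 'w \<Rightarrow> 'a" where
  "noise e q \<beta> h J n \<omega> =
     (\<Sum>p. (sqrt (q p) * ((\<beta> p (real (Suc n) * h) \<omega> - \<beta> p (real n * h) \<omega>) / sqrt h)) *\<^sub>R J (e p))"

section \<open>The postprocessed scheme\<close>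

definition J1 :: "'a::real_vector set \<Rightarrow> ('a \<Rightarrow> 'a) \<Rightarrow> real \<Rightarrow> 'a \<Rightarrow> 'a" where
  "J1 D A h = resolvent D A h"

definition J2 :: "'a::real_vector set \<Rightarrow> ('a \<Rightarrow> 'a) \<Rightarrow> real \<Rightarrow> 'a \<Rightarrow> 'a" where
  "J2 D A h = resolvent D A ((3 - sqrt 2) / 2 * h)"

definition is_J3 ::
  "'a::real_inner set \<Rightarrow> ('a \<Rightarrow> 'a) \<Rightarrow> ('a \<Rightarrow> 'a) \<Rightarrow> real \<Rightarrow> ('a \<Rightarrow> 'a) \<Rightarrow> bool" where
  "is_J3 D A Q h J \<longleftrightarrow> bounded_linear J \<and> J \<circ> Q \<circ> adjoint J = resolvent D A (h / 2) \<circ> Q"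

primrec post_u ::
  "'a::real_normed_vector set \<Rightarrow> ('a \<Rightarrow> 'a) \<Rightarrow> ('a \<Rightarrow> 'a) \<Rightarrow> (nat \<Rightarrow> 'a) \<Rightarrow> (nat \<Rightarrow> real) \<Rightarrow>
    (nat \<Rightarrow> real \<Rightarrow> 'w \<Rightarrow> real) \<Rightarrow> real \<Rightarrow> 'a \<Rightarrow> nat \<Rightarrow> 'w \<Rightarrow> 'a" where
  "post_u D A F e q \<beta> h u0 0 = (\<lambda>\<omega>. u0)"
| "post_u D A F e q \<beta> h u0 (Suc n) = (\<lambda>\<omega>.
     let u = post_u D A F e q \<beta> h u0 n \<omega>;
         w = noise e q \<beta> h (J2 D A h) n \<omega>
     in J1 D A h (u + h *\<^sub>R F (u + (1 / 2 * sqrt h) *\<^sub>R w) + ((sqrt 2 - 1) / 2 * sqrt h) *\<^sub>R w)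
          + ((3 - sqrt 2) / 2 * sqrt h) *\<^sub>R w)"

definition post_ubar ::
  "'a::real_normed_vector set \<Rightarrow> ('a \<Rightarrow> 'a) \<Rightarrow> ('a \<Rightarrow> 'a) \<Rightarrow> (nat \<Rightarrow> 'a) \<Rightarrow> (nat \<Rightarrow> real) \<Rightarrow>
    (nat \<Rightarrow> real \<Rightarrow> 'w \<Rightarrow> real) \<Rightarrow> real \<Rightarrow> ('a \<Rightarrow> 'a) \<Rightarrow> 'a \<Rightarrow> nat \<Rightarrow> 'w \<Rightarrow> 'a" where
  "post_ubar D A F e q \<beta> h J3 u0 n \<omega> =
     post_u D A F e q \<beta> h u0 n \<omega> + (1 / 2 * sqrt h) *\<^sub>R noise e q \<beta> h J3 n \<omega>"

text \<open>The chain \<open>(u\<^sub>n, ubar\<^sub>n\<^sub>-\<^sub>1)\<close>, started at \<open>z = (u\<^sub>0, ubar\<^sub>-\<^sub>1)\<close>.\<close>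
definition post_chain ::
  "'a::real_normed_vector set \<Rightarrow> ('a \<Rightarrow> 'a) \<Rightarrow> ('a \<Rightarrow> 'a) \<Rightarrow> (nat \<Rightarrow> 'a) \<Rightarrow> (nat \<Rightarrow> real) \<Rightarrow>
    (nat \<Rightarrow> real \<Rightarrow> 'w \<Rightarrow> real) \<Rightarrow> real \<Rightarrow> ('a \<Rightarrow> 'a) \<Rightarrow> 'a \<times> 'a \<Rightarrow> nat \<Rightarrow> 'w \<Rightarrow> 'a \<times> 'a" where
  "post_chain D A F e q \<beta> h J3 z n \<omega> =
     (post_u D A F e q \<beta> h (fst z) n \<omega>,
      case n of 0 \<Rightarrow> snd z | Suc m \<Rightarrow> post_ubar D A F e q \<beta> h J3 (fst z) m \<omega>)"

text \<open>
  Transition kernel: the law of the chain after one step from \<open>z\<close>. As the increments of the Wiener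
  processes over \<open>[nh, (n+1)h]\<close> are independent and identically distributed in \<open>n\<close>, this is the
  transition kernel of every step.
\<close>
definition post_kernel ::
  "'w measure \<Rightarrow> 'a::real_normed_vector set \<Rightarrow> ('a \<Rightarrow> 'a) \<Rightarrow> ('a \<Rightarrow> 'a) \<Rightarrow> (nat \<Rightarrow> 'a) \<Rightarrow> (nat \<Rightarrow> real) \<Rightarrow>
    (nat \<Rightarrow> real \<Rightarrow> 'w \<Rightarrow> real) \<Rightarrow> real \<Rightarrow> ('a \<Rightarrow> 'a) \<Rightarrow> 'a \<times> 'a \<Rightarrow> ('a \<times> 'a) measure" where
  "post_kernel \<Omega> D A F e q \<beta> h J3 z = distr \<Omega> borel (post_chain D A F e q \<beta> h J3 z 1)"

definition invariant_distribution ::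
  "('b::topological_space \<Rightarrow> 'b measure) \<Rightarrow> 'b measure \<Rightarrow> bool" where
  "invariant_distribution K M \<longleftrightarrow> prob_space M \<and> sets M = sets borel \<and> M \<bind> K = M"

end

theory Submission
  imports Defs
begin

text \<open>
  One step of the scheme maps \<open>u\<close> to \<open>f(g, u)\<close>, where \<open>g\<close> is the sequence of standard Gaussian
  increments of the scalar Wiener processes over the time step. For two states driven by the same
  noise the additive terms cancel. With \<open>\<lambda>\<^sub>0\<close> the lowest eigenvalue of \<open>-A\<close>, \<open>J1\<close> divides the
  norm by at least \<open>1 + \<lambda>\<^sub>0 h\<close>, and \<open>F\<close> has Lipschitz constant \<open>L\<close>; hence \<open>f(g, \<cdot>)\<close> is a
  contraction with the deterministic factor
  \<open>\<rho> = (1 + h L) / (1 + \<lambda>\<^sub>0 h)\<close>, and \<open>\<rho> = 1 - (\<lambda>\<^sub>0 - L) h / (1 + \<lambda>\<^sub>0 h)\<close> is at most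
  \<open>exp (- (\<lambda>\<^sub>0 - L) h / (1 + \<lambda>\<^sub>0 h))\<close>, which is the claimed rate.

  For i.i.d. random contractions of a Polish space the rest is soft. Composing the random maps in
  reversed order (\<open>backward\<close>) gives an almost surely convergent sequence whose limit has an invariant
  law (\<open>limit_law_invariant\<close>). The averaging operator \<open>P \<phi> x = E \<phi>(f(g, x))\<close> multiplies Lipschitz
  constants by \<open>\<rho>\<close> (\<open>markov_op_lipschitz\<close>), so \<open>P\<^sup>n \<phi>\<close> is nearly constant. Integrating it against an
  invariant law gives both uniqueness (\<open>invariant_law_unique\<close>) and the exponential rate
  (\<open>markov_op_power_converges\<close>). The postprocessed value is the image of the state \<open>u\<^sub>n\<close> and of the
  fresh noise under a map which is nonexpansive in \<open>u\<^sub>n\<close>; it only replaces \<open>\<phi>\<close> by the average \<open>obs_op \<phi>\<close>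
  with the same Lipschitz constant.

  Two points are specific to the scheme. First, the Gaussian sequences of different time
  steps are independent with a common law. This combines the independence of the increments of one
  Wiener process in time with the independence of the processes (\<open>indep_white_noise\<close>). Second, the
  constant must not depend on \<open>h\<close>, so the first moment of the invariant law has to be bounded
  uniformly in \<open>h\<close>. The contraction estimate alone gives a bound that blows up as \<open>h\<close> tends
  to \<open>0\<close>. Instead, \<open>u\<^sub>n\<close> is
  written as a discrete stochastic convolution plus a remainder. The coordinates of the convolution
  have variance at most \<open>q\<^sub>p / \<lambda>\<^sub>p\<close> (\<open>stoch_conv_coord_bound\<close>), which is summable by the trace condition, and
  the remainder satisfies a recursion with forcing of order \<open>h\<close> against dissipation
  \<open>(\<lambda>\<^sub>0 - L) h\<close> (\<open>remainder_moment\<close>).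
\<close>

section \<open>Random contractions of a Polish space\<close>

lemma Cauchy_if_summable_dist:
  fixes X :: "nat \<Rightarrow> 'a::metric_space"
  assumes "summable (\<lambda>n. dist (X (Suc n)) (X n))"
  shows "Cauchy X"
proof (rule metric_CauchyI)
  fix e :: real assume e: "e > 0"
  have le: "dist (X (m + k)) (X m) \<le> (\<Sum>i=m..<m+k. dist (X (Suc i)) (X i))" for m k
  proof (induction k)
    case (Suc k)
    have "dist (X (m + Suc k)) (X m) \<le> dist (X (Suc (m + k))) (X (m + k)) + dist (X (m + k)) (X m)"
      by (simp add: dist_triangle)
    with Suc show ?case by simp
  qed simp
  obtain N where N: "\<And>m n. m \<ge> N \<Longrightarrow> norm (\<Sum>i=m..<n. dist (X (Suc i)) (X i)) < e"
    using assms[unfolded summable_Cauchy] e by blast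
  have *: "dist (X n) (X m) < e" if "m \<ge> N" "n \<ge> m" for m n
    using le[of m "n - m"] N[of m n] that by simp
  show "\<exists>M. \<forall>m\<ge>M. \<forall>n\<ge>M. dist (X m) (X n) < e"
    by (intro exI[of _ N] allI impI) (metis * dist_commute nle_le)
qed

text \<open>
  The total length of the steps controls the distance of the limit from the starting point; this is
  what transfers a moment bound from the steps to the limit.
\<close>
lemma dist_le_suminf_steps:
  fixes X :: "nat \<Rightarrow> 'a::metric_space"
  assumes "X \<longlonglongrightarrow> l"
  shows "ennreal (dist l (X 0)) \<le> (\<Sum>n. ennreal (dist (X (Suc n)) (X n)))"
proof -
  have le: "ennreal (dist (X k) (X 0)) \<le> (\<Sum>i<k. ennreal (dist (X (Suc i)) (X i)))" for k
  proof (induction k)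
    case (Suc k)
    have "ennreal (dist (X (Suc k)) (X 0)) \<le> ennreal (dist (X (Suc k)) (X k) + dist (X k) (X 0))"
      by (intro ennreal_leI dist_triangle)
    also have "\<dots> = ennreal (dist (X (Suc k)) (X k)) + ennreal (dist (X k) (X 0))" by simp
    also have "\<dots> \<le> ennreal (dist (X (Suc k)) (X k)) + (\<Sum>i<k. ennreal (dist (X (Suc i)) (X i)))"
      by (intro add_left_mono Suc)
    finally show ?case by (simp add: add.commute)
  qed simp
  have "(\<lambda>k. ennreal (dist (X k) (X 0))) \<longlonglongrightarrow> ennreal (dist l (X 0))"
    using assms by (intro tendsto_intros)
  then show ?thesis
  proof (rule LIMSEQ_le_const2)
    show "\<exists>N. \<forall>n\<ge>N. ennreal (dist (X n) (X 0)) \<le> (\<Sum>n. ennreal (dist (X (Suc n)) (X n)))"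
      by (intro exI allI impI order_trans[OF le] sum_le_suminf) auto
  qed
qed

lemma lipschitz_real_measurable:
  fixes \<phi> :: "'a::metric_space \<Rightarrow> real"
  shows "C-lipschitz_on UNIV \<phi> \<Longrightarrow> \<phi> \<in> borel_measurable borel"
  by (intro borel_measurable_continuous_onI lipschitz_on_continuous_on)

lemma (in finite_measure) integrable_lipschitz_comp:
  fixes \<phi> :: "'b::{second_countable_topology, metric_space} \<Rightarrow> real"
  assumes \<phi>: "C-lipschitz_on UNIV \<phi>" and X[measurable]: "X \<in> borel_measurable M"
    and int: "integrable M (\<lambda>s. dist (X s) c)"
  shows "integrable M (\<lambda>s. \<phi> (X s))"
proof (rule Bochner_Integration.integrable_bound)
  show "integrable M (\<lambda>s. \<bar>\<phi> c\<bar> + C * dist (X s) c)" using int by simp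
  show "(\<lambda>s. \<phi> (X s)) \<in> borel_measurable M"
    using lipschitz_real_measurable[OF \<phi>] by measurable
  have "\<bar>\<phi> (X s) - \<phi> c\<bar> \<le> C * dist (X s) c" for s
    using lipschitz_onD[OF \<phi>, of "X s" c] by (simp add: dist_real_def)
  then show "AE s in M. norm (\<phi> (X s)) \<le> norm (\<bar>\<phi> c\<bar> + C * dist (X s) c)"
    by (intro always_eventually allI) (smt (verit) real_norm_def)
qed

text \<open>
  The indicator of a closed set \<open>C\<close> is the decreasing limit of the Lipschitz functions
  \<open>max 0 (1 - n d(\<cdot>, C))\<close>, and the closed sets form an intersection-stable generator of the Borel sets.
\<close>
lemma measure_eqI_bounded_lipschitz:
  fixes M N :: "'a::metric_space measure"
  assumes "prob_space M" "prob_space N" and sM: "sets M = sets borel" and sN: "sets N = sets borel"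
    and eq: "\<And>\<phi> :: 'a \<Rightarrow> real. \<exists>C. C-lipschitz_on UNIV \<phi> \<Longrightarrow> (\<And>x. 0 \<le> \<phi> x) \<Longrightarrow> (\<And>x. \<phi> x \<le> 1) \<Longrightarrow>
      (\<integral>x. \<phi> x \<partial>M) = (\<integral>x. \<phi> x \<partial>N)"
  shows "M = N"
proof -
  interpret M: prob_space M by fact
  interpret N: prob_space N by fact
  define \<psi> where "\<psi> C n x = max 0 (1 - real n * infdist x C)" for C :: "'a set" and n x
  have lip: "(real n)-lipschitz_on UNIV (\<psi> C n)" for C n
  proof (rule lipschitz_onI)
    fix x y :: 'a
    have "\<bar>infdist x C - infdist y C\<bar> \<le> dist x y"
      using infdist_triangle_abs by blast
    then have "real n * \<bar>infdist x C - infdist y C\<bar> \<le> real n * dist x y" by (simp add: mult_left_mono)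
    moreover have "real n * \<bar>infdist x C - infdist y C\<bar> = \<bar>real n * infdist x C - real n * infdist y C\<bar>"
      by (simp add: abs_mult flip: right_diff_distrib)
    ultimately show "dist (\<psi> C n x) (\<psi> C n y) \<le> real n * dist x y"
      unfolding \<psi>_def dist_real_def by linarith
  qed simp
  have lim: "(\<lambda>n. \<psi> C n x) \<longlonglongrightarrow> indicator C x" if "closed C" "C \<noteq> {}" for C x
  proof (cases "x \<in> C")
    case False
    then have pos: "infdist x C > 0"
      using in_closed_iff_infdist_zero[OF that, of x] infdist_nonneg[of x C] by linarith
    obtain n0 :: nat where n0: "1 / infdist x C < n0" using reals_Archimedean2 by blast
    have "\<psi> C n x = 0" if "n \<ge> n0" for n
    proof -
      have "1 < real n0 * infdist x C" using n0 pos by (simp add: field_simps)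
      also have "\<dots> \<le> real n * infdist x C" using that pos by (intro mult_right_mono) auto
      finally show ?thesis by (simp add: \<psi>_def)
    qed
    then have "eventually (\<lambda>n. \<psi> C n x = 0) sequentially" unfolding eventually_sequentially by blast
    then show ?thesis using False by (auto intro: tendsto_eventually)
  qed (simp add: \<psi>_def)
  have conv: "(\<lambda>n. \<integral>x. \<psi> C n x \<partial>P) \<longlonglongrightarrow> measure P C"
    if P: "prob_space P" "sets P = sets borel" and C: "closed C" "C \<noteq> {}" for P C
  proof -
    interpret prob_space P by fact
    have m: "\<psi> C n \<in> borel_measurable P" for n
      using lipschitz_real_measurable[OF lip] P(2) by (simp cong: measurable_cong_sets)
    have Cs: "C \<in> sets P" using C P by simp
    have "(\<lambda>n. \<integral>x. \<psi> C n x \<partial>P) \<longlonglongrightarrow> (\<integral>x. indicator C x \<partial>P)"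
    proof (rule integral_dominated_convergence[where w="\<lambda>_. 1"])
      show "AE x in P. (\<lambda>n. \<psi> C n x) \<longlonglongrightarrow> indicator C x" using lim[OF C] by simp
      show "AE x in P. norm (\<psi> C n x) \<le> 1" for n
        by (intro always_eventually allI) (simp add: \<psi>_def infdist_nonneg)
    qed (use m Cs in auto)
    then show ?thesis using Cs by simp
  qed
  have closed_eq: "emeasure M C = emeasure N C" if "closed C" for C
  proof (cases "C = {}")
    case False
    have "(\<integral>x. \<psi> C n x \<partial>M) = (\<integral>x. \<psi> C n x \<partial>N)" for n
      by (rule eq) (use lip in \<open>auto simp: \<psi>_def infdist_nonneg\<close>)
    then have "measure M C = measure N C"
      using conv[OF _ sM that False] conv[OF _ sN that False] assms(1,2) LIMSEQ_unique by force
    then show ?thesis by (simp add: M.emeasure_eq_measure N.emeasure_eq_measure)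
  qed simp
  show ?thesis
  proof (rule measure_eqI_generator_eq[where E="Collect closed" and \<Omega>=UNIV and A="\<lambda>_. UNIV"])
    show "sets M = sigma_sets UNIV (Collect closed)" "sets N = sigma_sets UNIV (Collect closed)"
      unfolding sM sN by (simp_all add: borel_eq_closed)
    show "Int_stable (Collect closed)" by (auto simp: Int_stable_def)
  qed (auto simp: closed_eq)
qed

text \<open>
  Coupling two starting points by the same randomness: the mean of \<open>\<phi>\<close> inherits the product of the
  Lipschitz constants.
\<close>
lemma (in prob_space) lipschitz_expectation:
  fixes \<phi> :: "'b::{second_countable_topology, metric_space} \<Rightarrow> real"
  assumes \<phi>: "C-lipschitz_on UNIV \<phi>" and L: "0 \<le> L"
    and g[measurable]: "\<And>x. g x \<in> borel_measurable M"
    and int: "\<And>x. integrable M (\<lambda>s. dist (g x s) d)"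
    and lip: "\<And>s x y. s \<in> space M \<Longrightarrow> dist (g x s) (g y s) \<le> L * dist x y"
  shows "(L * C)-lipschitz_on UNIV (\<lambda>x. expectation (\<lambda>s. \<phi> (g x s)))"
proof (rule lipschitz_onI)
  fix x y
  have C: "0 \<le> C" using \<phi> lipschitz_on_nonneg by blast
  have i: "integrable M (\<lambda>s. \<phi> (g x s))" for x
    by (rule integrable_lipschitz_comp[OF \<phi> g int])
  have "\<bar>expectation (\<lambda>s. \<phi> (g x s)) - expectation (\<lambda>s. \<phi> (g y s))\<bar>
      = \<bar>expectation (\<lambda>s. \<phi> (g x s) - \<phi> (g y s))\<bar>" using i by simp
  also have "\<dots> \<le> expectation (\<lambda>s. \<bar>\<phi> (g x s) - \<phi> (g y s)\<bar>)" by (rule integral_abs_bound)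
  also have "\<dots> \<le> expectation (\<lambda>s. L * C * dist x y)"
  proof (rule integral_mono)
    fix s assume "s \<in> space M"
    have "\<bar>\<phi> (g x s) - \<phi> (g y s)\<bar> \<le> C * dist (g x s) (g y s)"
      using lipschitz_onD[OF \<phi>, of "g x s" "g y s"] by (simp add: dist_real_def)
    also have "\<dots> \<le> C * (L * dist x y)"
      using lip[OF \<open>s \<in> space M\<close>] C by (intro mult_left_mono)
    finally show "\<bar>\<phi> (g x s) - \<phi> (g y s)\<bar> \<le> L * C * dist x y" by (simp add: ac_simps)
  qed (use i in auto)
  finally show "dist (expectation (\<lambda>s. \<phi> (g x s))) (expectation (\<lambda>s. \<phi> (g y s))) \<le> L * C * dist x y"
    by (simp add: dist_real_def prob_space)
next
  show "0 \<le> L * C" using lipschitz_on_nonneg[OF \<phi>] L by simp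
qed

text \<open>
  Random maps of a Polish space that contract with a deterministic factor. The base point \<open>c\<close>
  expresses that first moments are finite and starts the backward iteration below.
\<close>
locale random_contraction = prob_space N for N :: "'b measure" +
  fixes f :: "'b \<Rightarrow> 'a::polish_space \<Rightarrow> 'a" and \<rho> :: real and c :: 'a
  assumes f_meas: "(\<lambda>(s, x). f s x) \<in> borel_measurable (N \<Otimes>\<^sub>M borel)"
    and contraction: "\<And>s x y. s \<in> space N \<Longrightarrow> dist (f s x) (f s y) \<le> \<rho> * dist x y"
    and rate: "0 \<le> \<rho>" "\<rho> < 1"
    and moment: "integrable N (\<lambda>s. dist (f s c) c)"
begin

lemma f_measurable [measurable (raw)]:
  "g \<in> M \<rightarrow>\<^sub>M N \<Longrightarrow> k \<in> M \<rightarrow>\<^sub>M borel \<Longrightarrow> (\<lambda>w. f (g w) (k w)) \<in> borel_measurable M"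
  using measurable_compose[OF measurable_Pair f_meas] by simp

lemma integrable_dist_f: "integrable N (\<lambda>s. dist (f s x) c)"
proof (rule Bochner_Integration.integrable_bound)
  show "integrable N (\<lambda>s. \<rho> * dist x c + dist (f s c) c)" using moment by simp
  show "AE s in N. norm (dist (f s x) c) \<le> norm (\<rho> * dist x c + dist (f s c) c)"
  proof (rule AE_I2)
    fix s assume "s \<in> space N"
    then have "dist (f s x) c \<le> \<rho> * dist x c + dist (f s c) c"
      using contraction[of s x c] dist_triangle[of "f s x" c "f s c"] by linarith
    then show "norm (dist (f s x) c) \<le> norm (\<rho> * dist x c + dist (f s c) c)" by simp
  qed
qed measurable

definition markov_op :: "('a \<Rightarrow> real) \<Rightarrow> 'a \<Rightarrow> real" where
  "markov_op \<phi> x = (\<integral>s. \<phi> (f s x) \<partial>N)"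

lemma markov_op_lipschitz:
  "C-lipschitz_on UNIV \<phi> \<Longrightarrow> (\<rho> * C)-lipschitz_on UNIV (markov_op \<phi>)"
  unfolding markov_op_def[abs_def]
  by (rule lipschitz_expectation[OF _ rate(1) _ integrable_dist_f]) (auto intro: contraction)

lemma markov_op_power_lipschitz:
  "C-lipschitz_on UNIV \<phi> \<Longrightarrow> (\<rho> ^ n * C)-lipschitz_on UNIV ((markov_op ^^ n) \<phi>)"
  by (induction n) (auto dest!: markov_op_lipschitz simp: mult.assoc)

definition invariant_law :: "'a measure \<Rightarrow> bool" where
  "invariant_law \<mu> \<longleftrightarrow> prob_space \<mu> \<and> sets \<mu> = sets borel \<and> distr (N \<Otimes>\<^sub>M \<mu>) borel (\<lambda>(s, x). f s x) = \<mu>"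

lemma invariant_law_integral:
  assumes \<mu>: "invariant_law \<mu>" and int: "integrable \<mu> \<phi>"
  shows "(\<integral>x. markov_op \<phi> x \<partial>\<mu>) = (\<integral>x. \<phi> x \<partial>\<mu>)"
proof -
  from \<mu> have P: "prob_space \<mu>" and s[measurable_cong]: "sets \<mu> = sets borel"
    and inv: "distr (N \<Otimes>\<^sub>M \<mu>) borel (\<lambda>(s, x). f s x) = \<mu>" by (auto simp: invariant_law_def)
  interpret \<mu>: prob_space \<mu> by fact
  interpret pair_prob_space N \<mu> ..
  have [measurable]: "\<phi> \<in> borel_measurable borel"
    using borel_measurable_integrable[OF int] by (simp cong: measurable_cong_sets add: s)
  have fm: "(\<lambda>(s, x). f s x) \<in> borel_measurable (N \<Otimes>\<^sub>M \<mu>)" by measurable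
  have "integrable (distr (N \<Otimes>\<^sub>M \<mu>) borel (\<lambda>(s, x). f s x)) \<phi>" using int inv by simp
  then have i2: "integrable (N \<Otimes>\<^sub>M \<mu>) (\<lambda>(s, x). \<phi> (f s x))"
    using fm by (subst (asm) integrable_distr_eq) (auto simp: case_prod_beta')
  have "(\<integral>x. \<phi> x \<partial>\<mu>) = (\<integral>x. \<phi> x \<partial>distr (N \<Otimes>\<^sub>M \<mu>) borel (\<lambda>(s, x). f s x))" using inv by simp
  also have "\<dots> = (\<integral>z. (\<lambda>(s, x). \<phi> (f s x)) z \<partial>(N \<Otimes>\<^sub>M \<mu>))"
    using fm by (subst integral_distr) (auto simp: case_prod_beta')
  also have "\<dots> = (\<integral>x. markov_op \<phi> x \<partial>\<mu>)"
    unfolding markov_op_def using integral_snd[OF i2] by simp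
  finally show ?thesis by simp
qed

lemma invariant_law_integrable_lipschitz:
  fixes \<phi> :: "'a \<Rightarrow> real"
  assumes \<mu>: "invariant_law \<mu>" and int: "integrable \<mu> (\<lambda>x. dist x c)" and \<phi>: "C-lipschitz_on UNIV \<phi>"
  shows "integrable \<mu> \<phi>"
proof -
  from \<mu> have "prob_space \<mu>" and [measurable_cong]: "sets \<mu> = sets borel" by (auto simp: invariant_law_def)
  then interpret \<mu>: prob_space \<mu> by simp
  show ?thesis using \<mu>.integrable_lipschitz_comp[OF \<phi>, of "\<lambda>x. x" c] int by simp
qed

lemma invariant_law_integral_power:
  assumes \<mu>: "invariant_law \<mu>" and int: "integrable \<mu> (\<lambda>x. dist x c)" and \<phi>: "C-lipschitz_on UNIV \<phi>"
  shows "(\<integral>x. (markov_op ^^ n) \<phi> x \<partial>\<mu>) = (\<integral>x. \<phi> x \<partial>\<mu>)"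
proof (induction n)
  case (Suc n)
  then show ?case
    using invariant_law_integral[OF \<mu> invariant_law_integrable_lipschitz[OF \<mu> int markov_op_power_lipschitz[OF \<phi>, of n]]]
    by simp
qed simp

text \<open>
  By invariance \<open>\<integral>\<phi> d\<mu> = \<integral>P\<^sup>n \<phi> d\<mu>\<close>, and the oscillation of \<open>P\<^sup>n \<phi>\<close> between \<open>x\<close> and \<open>y\<close> is at most
  \<open>C \<rho>\<^sup>n d(x, y)\<close>.
\<close>
lemma markov_op_power_converges:
  assumes \<mu>: "invariant_law \<mu>" and int: "integrable \<mu> (\<lambda>x. dist x c)" and \<phi>: "C-lipschitz_on UNIV \<phi>"
  shows "\<bar>(markov_op ^^ n) \<phi> x - (\<integral>y. \<phi> y \<partial>\<mu>)\<bar> \<le> C * \<rho> ^ n * (dist x c + (\<integral>y. dist y c \<partial>\<mu>))"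
proof -
  from \<mu> interpret \<mu>: prob_space \<mu> by (simp add: invariant_law_def)
  let ?P = "(markov_op ^^ n) \<phi>"
  have C: "0 \<le> C" using \<phi> lipschitz_on_nonneg by blast
  note L = markov_op_power_lipschitz[OF \<phi>, of n]
  have iP: "integrable \<mu> ?P" by (rule invariant_law_integrable_lipschitz[OF \<mu> int L])
  have "\<bar>?P x - (\<integral>y. \<phi> y \<partial>\<mu>)\<bar> = \<bar>\<integral>y. ?P x - ?P y \<partial>\<mu>\<bar>"
    using invariant_law_integral_power[OF assms, of n] iP by (simp add: \<mu>.prob_space)
  also have "\<dots> \<le> (\<integral>y. \<bar>?P x - ?P y\<bar> \<partial>\<mu>)" by (rule integral_abs_bound)
  also have "\<dots> \<le> (\<integral>y. C * \<rho> ^ n * (dist x c + dist y c) \<partial>\<mu>)"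
  proof (rule integral_mono)
    fix y
    have "\<bar>?P x - ?P y\<bar> \<le> C * \<rho> ^ n * dist x y"
      using lipschitz_onD[OF L, of x y] by (simp add: dist_real_def ac_simps)
    also have "\<dots> \<le> C * \<rho> ^ n * (dist x c + dist y c)"
      using C rate by (intro mult_left_mono dist_triangle2) auto
    finally show "\<bar>?P x - ?P y\<bar> \<le> C * \<rho> ^ n * (dist x c + dist y c)" .
  qed (use iP int in auto)
  also have "\<dots> = C * \<rho> ^ n * (dist x c + (\<integral>y. dist y c \<partial>\<mu>))"
    using int by (simp add: \<mu>.prob_space)
  finally show ?thesis .
qed

text \<open>
  The first moment of an arbitrary invariant law is known to be finite only after uniqueness. Bounded
  test functions and dominated convergence take the place of moments in the proof of uniqueness.
\<close>
lemma markov_op_power_bounded_converges: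
  assumes \<mu>: "invariant_law \<mu>" and \<phi>: "C-lipschitz_on UNIV \<phi>" and bd: "\<And>x. 0 \<le> \<phi> x" "\<And>x. \<phi> x \<le> 1"
  shows "(\<lambda>n. (markov_op ^^ n) \<phi> c) \<longlonglongrightarrow> (\<integral>y. \<phi> y \<partial>\<mu>)"
proof -
  from \<mu> have "prob_space \<mu>" and s[measurable_cong]: "sets \<mu> = sets borel" by (auto simp: invariant_law_def)
  then interpret \<mu>: prob_space \<mu> by simp
  let ?P = "\<lambda>n. (markov_op ^^ n) \<phi>"
  note L = markov_op_power_lipschitz[OF \<phi>]
  have P01: "0 \<le> ?P n x \<and> ?P n x \<le> 1" for n x
  proof (induction n arbitrary: x)
    case (Suc n)
    have "integrable N (\<lambda>s. ?P n (f s x))"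
      by (rule integrable_lipschitz_comp[OF L _ integrable_dist_f]) measurable
    then have "(\<integral>s. ?P n (f s x) \<partial>N) \<le> (\<integral>s. 1 \<partial>N)" using Suc by (intro integral_mono) auto
    then show ?case using Suc by (simp add: markov_op_def[of "?P n"] prob_space)
  qed (use bd in auto)
  have m[measurable]: "?P n \<in> borel_measurable borel" for n by (rule lipschitz_real_measurable[OF L])
  have iP: "integrable \<mu> (?P n)" for n
    using P01 by (intro \<mu>.integrable_const_bound[where B=1]) (auto cong: measurable_cong_sets simp: s)
  have inv: "(\<integral>y. ?P n y \<partial>\<mu>) = (\<integral>y. \<phi> y \<partial>\<mu>)" for n
  proof (induction n)
    case (Suc n) then show ?case using invariant_law_integral[OF \<mu> iP[of n]] by simp
  qed simp
  have "(\<lambda>n. \<integral>y. ?P n c - ?P n y \<partial>\<mu>) \<longlonglongrightarrow> (\<integral>y. 0 \<partial>\<mu>)"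
  proof (rule integral_dominated_convergence[where w="\<lambda>_. 1"])
    show "AE y in \<mu>. norm (?P n c - ?P n y) \<le> 1" for n
      using P01[of n c] P01[of n] by (intro always_eventually allI) (smt (verit) real_norm_def)
    show "AE y in \<mu>. (\<lambda>n. ?P n c - ?P n y) \<longlonglongrightarrow> 0"
    proof (intro always_eventually allI)
      fix y
      have "(\<lambda>n. \<rho> ^ n * C * dist c y) \<longlonglongrightarrow> 0 * C * dist c y"
        using rate by (intro tendsto_intros LIMSEQ_realpow_zero)
      then have lim: "(\<lambda>n. \<rho> ^ n * C * dist c y) \<longlonglongrightarrow> 0" by simp
      show "(\<lambda>n. ?P n c - ?P n y) \<longlonglongrightarrow> 0"
        by (rule Lim_null_comparison[OF _ lim], rule always_eventually)
           (use lipschitz_onD[OF L] in \<open>auto simp: dist_real_def\<close>)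
    qed
  qed auto
  then have "(\<lambda>n. ?P n c - (\<integral>y. \<phi> y \<partial>\<mu>)) \<longlonglongrightarrow> 0"
    using iP inv by (simp add: \<mu>.prob_space)
  then show ?thesis by (simp add: LIM_zero_iff)
qed

lemma invariant_law_unique:
  assumes "invariant_law \<mu>" "invariant_law \<nu>"
  shows "\<mu> = \<nu>"
proof (rule measure_eqI_bounded_lipschitz)
  fix \<phi> :: "'a \<Rightarrow> real" assume "\<exists>C. C-lipschitz_on UNIV \<phi>" and bd: "\<And>x. 0 \<le> \<phi> x" "\<And>x. \<phi> x \<le> 1"
  then obtain C where \<phi>: "C-lipschitz_on UNIV \<phi>" by blast
  show "(\<integral>x. \<phi> x \<partial>\<mu>) = (\<integral>x. \<phi> x \<partial>\<nu>)"
    by (rule LIMSEQ_unique[OF markov_op_power_bounded_converges[OF assms(1) \<phi> bd]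
          markov_op_power_bounded_converges[OF assms(2) \<phi> bd]])
qed (use assms in \<open>auto simp: invariant_law_def\<close>)

sublocale seq: sequence_space N
  by unfold_locales

text \<open>
  The random maps are composed with the newest one innermost: \<open>backward n s = f(s\<^sub>0, f(s\<^sub>1, \<dots> f(s\<^sub>n\<^sub>-\<^sub>1, c)))\<close>.
  For each \<open>n\<close> this has the law of the chain after \<open>n\<close> steps, but unlike the chain it converges
  pointwise, because passing from \<open>n\<close> to \<open>n + 1\<close> changes only the innermost argument.
\<close>
primrec backward :: "nat \<Rightarrow> (nat \<Rightarrow> 'b) \<Rightarrow> 'a" where
  "backward 0 s = c"
| "backward (Suc n) s = f (s 0) (backward n (\<lambda>i. s (Suc i)))"

lemma shift_measurable: "(\<lambda>s i. s (Suc i)) \<in> seq.S \<rightarrow>\<^sub>M seq.S"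
  by (rule measurable_PiM_single') (auto simp: space_PiM)

lemma backward_measurable [measurable]: "backward n \<in> borel_measurable seq.S"
proof (induction n)
  case (Suc n)
  note [measurable] = Suc shift_measurable
  show ?case by simp
qed simp

text \<open>
  Prepending an independent element to an i.i.d. sequence gives an i.i.d. sequence of the same law.
\<close>
lemma nn_integral_seq:
  assumes [measurable]: "g \<in> borel_measurable seq.S"
  shows "(\<integral>\<^sup>+s. g s \<partial>seq.S) = (\<integral>\<^sup>+a. \<integral>\<^sup>+s. g (case_nat a s) \<partial>seq.S \<partial>N)"
proof -
  have "(\<integral>\<^sup>+s. g s \<partial>seq.S) = (\<integral>\<^sup>+s. g s \<partial>distr (N \<Otimes>\<^sub>M seq.S) seq.S (\<lambda>(s, \<omega>). case_nat s \<omega>))"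
    by (simp add: seq.PiM_iter)
  also have "\<dots> = (\<integral>\<^sup>+z. g (case_prod case_nat z) \<partial>(N \<Otimes>\<^sub>M seq.S))"
    by (rule nn_integral_distr) measurable
  also have "\<dots> = (\<integral>\<^sup>+a. \<integral>\<^sup>+s. g (case_nat a s) \<partial>seq.S \<partial>N)"
    by (subst seq.P.nn_integral_fst[symmetric]) auto
  finally show ?thesis .
qed

lemma backward_step_le:
  "(\<integral>\<^sup>+s. dist (backward (Suc n) s) (backward n s) \<partial>seq.S) \<le> ennreal (\<rho> ^ n) * (\<integral>\<^sup>+a. dist (f a c) c \<partial>N)"
proof (induction n)
  case 0
  show ?case by (subst nn_integral_seq) (auto simp: seq.P.emeasure_space_1)
next
  case (Suc n)
  have "(\<integral>\<^sup>+s. dist (backward (Suc (Suc n)) s) (backward (Suc n) s) \<partial>seq.S)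
      = (\<integral>\<^sup>+a. \<integral>\<^sup>+s. dist (f a (backward (Suc n) s)) (f a (backward n s)) \<partial>seq.S \<partial>N)"
    by (subst nn_integral_seq) (auto simp del: backward.simps(2) simp: backward.simps(2)[of _ "case_nat _ _"])
  also have "\<dots> \<le> (\<integral>\<^sup>+a. \<integral>\<^sup>+s. ennreal \<rho> * dist (backward (Suc n) s) (backward n s) \<partial>seq.S \<partial>N)"
    using contraction rate by (intro nn_integral_mono) (auto simp flip: ennreal_mult)
  also have "\<dots> = ennreal \<rho> * (\<integral>\<^sup>+s. dist (backward (Suc n) s) (backward n s) \<partial>seq.S)"
    by (subst nn_integral_cmult) (auto simp: emeasure_space_1 simp del: backward.simps)
  also have "\<dots> \<le> ennreal \<rho> * (ennreal (\<rho> ^ n) * (\<integral>\<^sup>+a. dist (f a c) c \<partial>N))"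
    by (intro mult_left_mono Suc) simp
  finally show ?case using rate by (simp add: ennreal_mult ac_simps)
qed

definition backward_limit :: "(nat \<Rightarrow> 'b) \<Rightarrow> 'a" where
  "backward_limit s = (if Cauchy (\<lambda>n. backward n s) then lim (\<lambda>n. backward n s) else c)"

lemma backward_limit_measurable [measurable]: "backward_limit \<in> borel_measurable seq.S"
proof (rule borel_measurable_LIMSEQ_metric)
  show "(\<lambda>s. if Cauchy (\<lambda>n. backward n s) then backward n s else c) \<in> borel_measurable seq.S" for n
    by measurable
  show "(\<lambda>n. if Cauchy (\<lambda>n. backward n s) then backward n s else c) \<longlonglongrightarrow> backward_limit s" for s
    unfolding backward_limit_def
    by (auto simp: Cauchy_convergent_iff convergent_LIMSEQ_iff)
qed

text \<open>
  The expected step lengths are dominated by a geometric series with ratio \<open>\<rho>\<close>.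
\<close>
lemma backward_summable:
  "(\<integral>\<^sup>+s. (\<Sum>n. ennreal (dist (backward (Suc n) s) (backward n s))) \<partial>seq.S) < \<infinity>"
proof -
  have "(\<integral>\<^sup>+s. (\<Sum>n. ennreal (dist (backward (Suc n) s) (backward n s))) \<partial>seq.S)
      = (\<Sum>n. \<integral>\<^sup>+s. ennreal (dist (backward (Suc n) s) (backward n s)) \<partial>seq.S)"
    by (rule nn_integral_suminf) (simp del: backward.simps)
  also have "\<dots> \<le> (\<Sum>n. ennreal (\<rho> ^ n) * (\<integral>\<^sup>+a. dist (f a c) c \<partial>N))"
    by (intro suminf_le backward_step_le) auto
  also have "\<dots> = (\<Sum>n. ennreal (\<rho> ^ n)) * (\<integral>\<^sup>+a. dist (f a c) c \<partial>N)"
    by (rule ennreal_suminf_multc)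
  also have "\<dots> < \<infinity>"
    using rate moment
    by (subst suminf_ennreal2) (auto simp: ennreal_mult_less_top nn_integral_eq_integral)
  finally show ?thesis .
qed

lemma AE_backward_Cauchy: "AE s in seq.S. Cauchy (\<lambda>n. backward n s)"
proof -
  have "AE s in seq.S. (\<Sum>n. ennreal (dist (backward (Suc n) s) (backward n s))) \<noteq> \<infinity>"
    using backward_summable by (intro nn_integral_PInf_AE) (auto simp del: backward.simps)
  then show ?thesis
    by eventually_elim (intro Cauchy_if_summable_dist summable_suminf_not_top, auto)
qed

lemma backward_limit:
  "Cauchy (\<lambda>n. backward n s) \<Longrightarrow> (\<lambda>n. backward n s) \<longlonglongrightarrow> backward_limit s"
  by (simp add: backward_limit_def Cauchy_convergent_iff convergent_LIMSEQ_iff)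

definition limit_law :: "'a measure" where
  "limit_law = distr seq.S borel backward_limit"

text \<open>
  Since \<open>backward (n + 1) (a, s) = f(a, backward n s)\<close> and \<open>f(a, \<cdot>)\<close> is continuous, the limit satisfies
  \<open>backward_limit (a, s) = f(a, backward_limit s)\<close> almost surely. The law of \<open>(a, s)\<close> is that of \<open>s\<close>,
  which turns this identity into invariance.
\<close>
lemma limit_law_invariant: "invariant_law limit_law"
  unfolding invariant_law_def
proof (intro conjI)
  show "prob_space limit_law" unfolding limit_law_def by (rule seq.P.prob_space_distr) measurable
  show "sets limit_law = sets borel" by (simp add: limit_law_def)
  interpret pair_prob_space N seq.S ..
  have AE2: "AE z in N \<Otimes>\<^sub>M seq.S. f (fst z) (backward_limit (snd z)) = backward_limit (case_prod case_nat z)"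
  proof -
    have "AE z in N \<Otimes>\<^sub>M seq.S. Cauchy (\<lambda>n. backward n (snd z))"
      using AE_backward_Cauchy by (intro AE_pair_measure) (simp, simp)
    with AE_space show ?thesis
    proof eventually_elim
      case (elim z)
      have cont: "continuous_on UNIV (f (fst z))"
        using elim(1) contraction rate
        by (intro lipschitz_on_continuous_on lipschitz_onI) (auto simp: space_pair_measure)
      have "(\<lambda>n. f (fst z) (backward n (snd z))) \<longlonglongrightarrow> f (fst z) (backward_limit (snd z))"
        using backward_limit[OF elim(2)] by (rule continuous_on_tendsto_compose[OF cont]) auto
      then have "(\<lambda>n. backward (Suc n) (case_prod case_nat z)) \<longlonglongrightarrow> f (fst z) (backward_limit (snd z))"
        by (simp add: case_prod_beta)
      then have l: "(\<lambda>n. backward n (case_prod case_nat z)) \<longlonglongrightarrow> f (fst z) (backward_limit (snd z))"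
        by (rule LIMSEQ_imp_Suc)
      then show ?case
        using LIMSEQ_imp_Cauchy[OF l] limI[OF l] by (simp add: backward_limit_def)
    qed
  qed
  have "distr (N \<Otimes>\<^sub>M limit_law) borel (\<lambda>(s, x). f s x)
      = distr (distr N N (\<lambda>x. x) \<Otimes>\<^sub>M distr seq.S borel backward_limit) borel (\<lambda>(s, x). f s x)"
    by (simp add: limit_law_def)
  also have "\<dots> = distr (distr (N \<Otimes>\<^sub>M seq.S) (N \<Otimes>\<^sub>M borel) (\<lambda>(a, s). (a, backward_limit s))) borel (\<lambda>(s, x). f s x)"
    by (subst pair_measure_distr)
       (auto intro!: prob_space_imp_sigma_finite seq.P.prob_space_distr)
  also have "\<dots> = distr (N \<Otimes>\<^sub>M seq.S) borel (\<lambda>z. f (fst z) (backward_limit (snd z)))"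
    by (subst distr_distr) (auto simp: comp_def case_prod_beta)
  also have "\<dots> = distr (N \<Otimes>\<^sub>M seq.S) borel (\<lambda>z. backward_limit (case_prod case_nat z))"
    using AE2 by (intro distr_cong_AE) auto
  also have "\<dots> = distr (distr (N \<Otimes>\<^sub>M seq.S) seq.S (\<lambda>(s, \<omega>). case_nat s \<omega>)) borel backward_limit"
    by (subst distr_distr) (auto simp: comp_def)
  also have "\<dots> = limit_law" by (simp add: seq.PiM_iter limit_law_def)
  finally show "distr (N \<Otimes>\<^sub>M limit_law) borel (\<lambda>(s, x). f s x) = limit_law" .
qed

lemma limit_law_moment: "integrable limit_law (\<lambda>x. dist x c)"
proof (rule integrableI_nonneg)
  show "(\<lambda>x. dist x c) \<in> borel_measurable limit_law" by (simp add: limit_law_def)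
  have "(\<integral>\<^sup>+x. dist x c \<partial>limit_law) = (\<integral>\<^sup>+s. dist (backward_limit s) c \<partial>seq.S)"
    unfolding limit_law_def by (subst nn_integral_distr) auto
  also have "\<dots> \<le> (\<integral>\<^sup>+s. (\<Sum>n. ennreal (dist (backward (Suc n) s) (backward n s))) \<partial>seq.S)"
    using AE_backward_Cauchy dist_le_suminf_steps[OF backward_limit]
    by (intro nn_integral_mono_AE) (auto elim!: eventually_mono simp del: backward.simps(2))
  also have "\<dots> < \<infinity>" by (rule backward_summable)
  finally show "(\<integral>\<^sup>+x. dist x c \<partial>limit_law) < \<infinity>" .
qed simp

end

context random_contraction begin

text \<open>
  The state after \<open>n\<close> steps is a measurable function of the first \<open>n\<close> inputs, hence independent of the
  input \<open>\<zeta> n\<close>.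
\<close>
lemma driven_chain_independent:
  assumes \<Omega>: "prob_space \<Omega>" and ind: "prob_space.indep_vars \<Omega> (\<lambda>_::nat. N) \<zeta> UNIV"
    and law: "\<And>n. distr \<Omega> N (\<zeta> n) = N"
    and U: "\<And>\<omega>. U 0 \<omega> = x" "\<And>n \<omega>. U (Suc n) \<omega> = f (\<zeta> n \<omega>) (U n \<omega>)"
  shows "U n \<in> borel_measurable \<Omega>"
    and "distr \<Omega> (N \<Otimes>\<^sub>M borel) (\<lambda>\<omega>. (\<zeta> n \<omega>, U n \<omega>)) = N \<Otimes>\<^sub>M distr \<Omega> borel (U n)"
proof -
  interpret \<Omega>: prob_space \<Omega> by fact
  have \<zeta>[measurable]: "\<zeta> n \<in> \<Omega> \<rightarrow>\<^sub>M N" for n using ind unfolding \<Omega>.indep_vars_def2 by blast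
  have "\<exists>G \<in> borel_measurable (PiM {..<n} (\<lambda>_. N)). \<forall>\<omega>. U n \<omega> = G (\<lambda>i\<in>{..<n}. \<zeta> i \<omega>)" for n
  proof (induction n)
    case 0 show ?case by (rule bexI[of _ "\<lambda>_. x"]) (auto simp: U)
  next
    case (Suc n)
    then obtain G where G[measurable]: "G \<in> borel_measurable (PiM {..<n} (\<lambda>_. N))"
      and UG: "\<And>\<omega>. U n \<omega> = G (\<lambda>i\<in>{..<n}. \<zeta> i \<omega>)" by blast
    have [measurable]: "(\<lambda>s. restrict s {..<n}) \<in> PiM {..<Suc n} (\<lambda>_. N) \<rightarrow>\<^sub>M PiM {..<n} (\<lambda>_. N)"
      by (rule measurable_restrict_subset) auto
    show ?case
    proof (rule bexI[of _ "\<lambda>s. f (s n) (G (restrict s {..<n}))"])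
      have "restrict (\<lambda>i\<in>{..<Suc n}. \<zeta> i \<omega>) {..<n} = (\<lambda>i\<in>{..<n}. \<zeta> i \<omega>)" for \<omega>
        by (auto simp: restrict_def)
      then show "\<forall>\<omega>. U (Suc n) \<omega> = f ((\<lambda>i\<in>{..<Suc n}. \<zeta> i \<omega>) n) (G (restrict (\<lambda>i\<in>{..<Suc n}. \<zeta> i \<omega>) {..<n}))"
        by (simp add: U UG)
      have "(\<lambda>s. s n) \<in> PiM {..<Suc n} (\<lambda>_. N) \<rightarrow>\<^sub>M N"
        by (rule measurable_component_singleton) simp
      then show "(\<lambda>s. f (s n) (G (restrict s {..<n}))) \<in> borel_measurable (PiM {..<Suc n} (\<lambda>_. N))"
        by measurable
    qed
  qed
  then obtain G where G: "G \<in> borel_measurable (PiM {..<n} (\<lambda>_. N))"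
    and UG: "\<And>\<omega>. U n \<omega> = G (\<lambda>i\<in>{..<n}. \<zeta> i \<omega>)" by blast
  have comp: "(\<lambda>s. s n) \<in> PiM {n} (\<lambda>_. N) \<rightarrow>\<^sub>M N"
    by (rule measurable_component_singleton) simp
  let ?P = "PiM {n} (\<lambda>_. N)" and ?X = "\<lambda>\<omega>. \<lambda>i\<in>{n}. \<zeta> i \<omega>"
    and ?Q = "PiM {..<n} (\<lambda>_. N)" and ?Y = "\<lambda>\<omega>. \<lambda>i\<in>{..<n}. \<zeta> i \<omega>"
  have "\<Omega>.indep_var ?P ?X ?Q ?Y"
    by (rule \<Omega>.indep_var_restrict[OF ind]) auto
  then have X: "?X \<in> \<Omega> \<rightarrow>\<^sub>M ?P" and Y: "?Y \<in> \<Omega> \<rightarrow>\<^sub>M ?Q"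
    and prod: "distr \<Omega> ?P ?X \<Otimes>\<^sub>M distr \<Omega> ?Q ?Y = distr \<Omega> (?P \<Otimes>\<^sub>M ?Q) (\<lambda>\<omega>. (?X \<omega>, ?Y \<omega>))"
    unfolding \<Omega>.indep_var_distribution_eq by blast+
  have UG': "U n = (\<lambda>\<omega>. G (?Y \<omega>))" by (simp add: UG fun_eq_iff)
  show Um: "U n \<in> borel_measurable \<Omega>"
    unfolding UG' by (rule measurable_compose[OF Y G])
  interpret D: prob_space "distr (distr \<Omega> ?Q ?Y) borel G"
    by (intro prob_space.prob_space_distr[OF \<Omega>.prob_space_distr[OF Y]]) (simp add: G)
  have "N \<Otimes>\<^sub>M distr \<Omega> borel (U n) = distr (distr \<Omega> ?P ?X) N (\<lambda>s. s n) \<Otimes>\<^sub>M distr (distr \<Omega> ?Q ?Y) borel G"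
    using law[of n] by (simp add: distr_distr[OF comp X] distr_distr[OF G Y] comp_def UG')
  also have "\<dots> = distr (distr \<Omega> ?P ?X \<Otimes>\<^sub>M distr \<Omega> ?Q ?Y) (N \<Otimes>\<^sub>M borel) (\<lambda>(s, t). (s n, G t))"
    by (rule pair_measure_distr) (use comp G D.sigma_finite_measure_axioms in simp_all)
  also have "\<dots> = distr \<Omega> (N \<Otimes>\<^sub>M borel) (\<lambda>\<omega>. (\<zeta> n \<omega>, U n \<omega>))"
    unfolding prod
  proof (subst distr_distr)
    show "(\<lambda>(s, t). (s n, G t)) \<in> ?P \<Otimes>\<^sub>M ?Q \<rightarrow>\<^sub>M N \<Otimes>\<^sub>M borel"
      unfolding case_prod_beta'
      by (rule measurable_Pair[OF measurable_compose[OF measurable_fst comp] measurable_compose[OF measurable_snd G]])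
    show "(\<lambda>\<omega>. (?X \<omega>, ?Y \<omega>)) \<in> \<Omega> \<rightarrow>\<^sub>M ?P \<Otimes>\<^sub>M ?Q" by (rule measurable_Pair[OF X Y])
  qed (simp add: comp_def UG')
  finally show "distr \<Omega> (N \<Otimes>\<^sub>M borel) (\<lambda>\<omega>. (\<zeta> n \<omega>, U n \<omega>)) = N \<Otimes>\<^sub>M distr \<Omega> borel (U n)" by simp
qed

text \<open>
  The input \<open>\<zeta> n\<close> is integrated out first, conditionally on the state.
\<close>
lemma driven_chain_expectation:
  fixes \<phi> :: "'c::{second_countable_topology, metric_space} \<Rightarrow> real"
  assumes \<Omega>: "prob_space \<Omega>" and ind: "prob_space.indep_vars \<Omega> (\<lambda>_::nat. N) \<zeta> UNIV"
    and law: "\<And>n. distr \<Omega> N (\<zeta> n) = N"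
    and U: "\<And>\<omega>. U 0 \<omega> = x" "\<And>n \<omega>. U (Suc n) \<omega> = f (\<zeta> n \<omega>) (U n \<omega>)"
    and g: "(\<lambda>(s, x). g s x) \<in> borel_measurable (N \<Otimes>\<^sub>M borel)"
    and \<phi>: "\<phi> \<in> borel_measurable borel"
    and int: "integrable \<Omega> (\<lambda>\<omega>. \<phi> (g (\<zeta> n \<omega>) (U n \<omega>)))"
  shows "(\<integral>\<omega>. \<phi> (g (\<zeta> n \<omega>) (U n \<omega>)) \<partial>\<Omega>) = (\<integral>\<omega>. (\<integral>s. \<phi> (g s (U n \<omega>)) \<partial>N) \<partial>\<Omega>)"
proof -
  interpret \<Omega>: prob_space \<Omega> by fact
  note U_meas = driven_chain_independent(1)[where U=U, OF \<Omega> ind law U, of n]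
  have \<zeta>[measurable]: "\<zeta> n \<in> \<Omega> \<rightarrow>\<^sub>M N" for n using ind unfolding \<Omega>.indep_vars_def2 by blast
  note joint = driven_chain_independent(2)[where U=U, OF \<Omega> ind law U, of n]
  have gm: "(\<lambda>z. \<phi> (g (fst z) (snd z))) \<in> borel_measurable (N \<Otimes>\<^sub>M borel)"
    using measurable_compose[OF g \<phi>] by (simp add: case_prod_beta')
  have m2: "(\<lambda>x. \<integral>s. \<phi> (g s x) \<partial>N) \<in> borel_measurable borel"
    using measurable_compose[OF measurable_pair_swap' gm]
    by (intro borel_measurable_lebesgue_integral) (simp add: case_prod_beta')
  interpret D: prob_space "distr \<Omega> borel (U n)" by (rule \<Omega>.prob_space_distr[OF U_meas])
  interpret pair_prob_space N "distr \<Omega> borel (U n)" ..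
  have pm: "(\<lambda>\<omega>. (\<zeta> n \<omega>, U n \<omega>)) \<in> \<Omega> \<rightarrow>\<^sub>M N \<Otimes>\<^sub>M borel"
    by (rule measurable_Pair[OF \<zeta> U_meas])
  have i: "integrable (N \<Otimes>\<^sub>M distr \<Omega> borel (U n)) (\<lambda>(s, x). \<phi> (g s x))"
    using int by (subst joint[symmetric], subst integrable_distr_eq[OF pm]) (simp_all add: gm case_prod_beta')
  have "(\<integral>\<omega>. \<phi> (g (\<zeta> n \<omega>) (U n \<omega>)) \<partial>\<Omega>)
      = (\<integral>z. (\<lambda>(s, x). \<phi> (g s x)) z \<partial>distr \<Omega> (N \<Otimes>\<^sub>M borel) (\<lambda>\<omega>. (\<zeta> n \<omega>, U n \<omega>)))"
    using gm pm by (subst integral_distr) (auto simp: case_prod_beta')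
  also have "\<dots> = (\<integral>x. (\<integral>s. \<phi> (g s x) \<partial>N) \<partial>distr \<Omega> borel (U n))"
    unfolding joint using integral_snd[OF i] by simp
  also have "\<dots> = (\<integral>\<omega>. (\<integral>s. \<phi> (g s (U n \<omega>)) \<partial>N) \<partial>\<Omega>)"
    using m2 by (subst integral_distr[OF U_meas]) simp_all
  finally show ?thesis .
qed

lemma driven_chain_moment:
  assumes \<Omega>: "prob_space \<Omega>" and ind: "prob_space.indep_vars \<Omega> (\<lambda>_::nat. N) \<zeta> UNIV"
    and law: "\<And>n. distr \<Omega> N (\<zeta> n) = N"
    and U: "\<And>\<omega>. U 0 \<omega> = x" "\<And>n \<omega>. U (Suc n) \<omega> = f (\<zeta> n \<omega>) (U n \<omega>)"
  shows "integrable \<Omega> (\<lambda>\<omega>. dist (U n \<omega>) c)"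
proof (induction n)
  interpret \<Omega>: prob_space \<Omega> by fact
  {
    case 0 show ?case by (simp add: U)
  next
    case (Suc n)
    note [measurable] = driven_chain_independent(1)[where U=U, OF \<Omega> ind law U]
    have \<zeta>[measurable]: "\<zeta> n \<in> \<Omega> \<rightarrow>\<^sub>M N" for n using ind unfolding \<Omega>.indep_vars_def2 by blast
    have "integrable (distr \<Omega> N (\<zeta> n)) (\<lambda>s. dist (f s c) c)" using moment law by simp
    then have i: "integrable \<Omega> (\<lambda>\<omega>. dist (f (\<zeta> n \<omega>) c) c)"
      by (rule integrable_distr[OF \<zeta>])
    show ?case
    proof (rule Bochner_Integration.integrable_bound)
      show "integrable \<Omega> (\<lambda>\<omega>. \<rho> * dist (U n \<omega>) c + dist (f (\<zeta> n \<omega>) c) c)" using i Suc by simp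
      show "AE \<omega> in \<Omega>. norm (dist (U (Suc n) \<omega>) c) \<le> norm (\<rho> * dist (U n \<omega>) c + dist (f (\<zeta> n \<omega>) c) c)"
      proof (rule AE_I2)
        fix \<omega> assume "\<omega> \<in> space \<Omega>"
        then have "\<zeta> n \<omega> \<in> space N" by (rule measurable_space[OF \<zeta>])
        then have "dist (U (Suc n) \<omega>) c \<le> \<rho> * dist (U n \<omega>) c + dist (f (\<zeta> n \<omega>) c) c"
          using contraction[of "\<zeta> n \<omega>" "U n \<omega>" c] dist_triangle[of "U (Suc n) \<omega>" c "f (\<zeta> n \<omega>) c"]
          unfolding U(2) by linarith
        then show "norm (dist (U (Suc n) \<omega>) c) \<le> norm (\<rho> * dist (U n \<omega>) c + dist (f (\<zeta> n \<omega>) c) c)" by simp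
      qed
    qed measurable
  }
qed

lemma driven_chain_markov_op:
  assumes \<Omega>: "prob_space \<Omega>" and ind: "prob_space.indep_vars \<Omega> (\<lambda>_::nat. N) \<zeta> UNIV"
    and law: "\<And>n. distr \<Omega> N (\<zeta> n) = N"
    and U: "\<And>\<omega>. U 0 \<omega> = x" "\<And>n \<omega>. U (Suc n) \<omega> = f (\<zeta> n \<omega>) (U n \<omega>)"
    and \<phi>: "C-lipschitz_on UNIV \<phi>"
  shows "integrable \<Omega> (\<lambda>\<omega>. \<phi> (U n \<omega>))" "(\<integral>\<omega>. \<phi> (U n \<omega>) \<partial>\<Omega>) = (markov_op ^^ n) \<phi> x"
proof -
  interpret \<Omega>: prob_space \<Omega> by fact
  have i: "integrable \<Omega> (\<lambda>\<omega>. \<phi> (U n \<omega>))" if "C-lipschitz_on UNIV \<phi>" for n C and \<phi> :: "'a \<Rightarrow> real"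
    by (rule \<Omega>.integrable_lipschitz_comp[OF that driven_chain_independent(1)[where U=U, OF \<Omega> ind law U]
          driven_chain_moment[where U=U, OF \<Omega> ind law U]])
  then show "integrable \<Omega> (\<lambda>\<omega>. \<phi> (U n \<omega>))" using \<phi> by blast
  show "(\<integral>\<omega>. \<phi> (U n \<omega>) \<partial>\<Omega>) = (markov_op ^^ n) \<phi> x" using \<phi>
  proof (induction n arbitrary: \<phi> C)
    case 0 then show ?case by (simp add: U \<Omega>.prob_space)
  next
    case (Suc n)
    have "(\<integral>\<omega>. \<phi> (U (Suc n) \<omega>) \<partial>\<Omega>) = (\<integral>\<omega>. markov_op \<phi> (U n \<omega>) \<partial>\<Omega>)"
      unfolding U(2) markov_op_def
      by (rule driven_chain_expectation[where U=U, OF \<Omega> ind law U f_meas lipschitz_real_measurable[OF Suc.prems]])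
         (use i[OF Suc.prems, of "Suc n"] in \<open>simp add: U(2)\<close>)
    also have "\<dots> = (markov_op ^^ n) (markov_op \<phi>) x"
      by (rule Suc.IH[OF markov_op_lipschitz[OF Suc.prems]])
    finally show ?case by (simp add: funpow_swap1)
  qed
qed

end

text \<open>
  The chain together with an observable \<open>g s x\<close> of the old state and of the same input. It models the
  pair \<open>(u\<^sub>n\<^sub>+\<^sub>1, ubar\<^sub>n)\<close>, a function of \<open>u\<^sub>n\<close> and of one noise.
\<close>
locale observed_contraction = random_contraction N f \<rho> c
  for N :: "'b measure" and f :: "'b \<Rightarrow> 'a::polish_space \<Rightarrow> 'a" and \<rho> c +
  fixes g :: "'b \<Rightarrow> 'a \<Rightarrow> 'c::polish_space" and d :: 'c
  assumes g_meas: "(\<lambda>(s, x). g s x) \<in> borel_measurable (N \<Otimes>\<^sub>M borel)"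
    and g_nonexpansive: "\<And>s x y. s \<in> space N \<Longrightarrow> dist (g s x) (g s y) \<le> dist x y"
    and g_moment: "integrable N (\<lambda>s. dist (g s c) d)"
begin

lemma g_measurable [measurable (raw)]:
  "h \<in> M \<rightarrow>\<^sub>M N \<Longrightarrow> k \<in> M \<rightarrow>\<^sub>M borel \<Longrightarrow> (\<lambda>w. g (h w) (k w)) \<in> borel_measurable M"
  using measurable_compose[OF measurable_Pair g_meas] by simp

definition obs_op :: "('c \<Rightarrow> real) \<Rightarrow> 'a \<Rightarrow> real" where
  "obs_op \<phi> x = (\<integral>s. \<phi> (g s x) \<partial>N)"

lemma dist_g_le: "s \<in> space N \<Longrightarrow> dist (g s x) d \<le> dist x c + dist (g s c) d"
  using g_nonexpansive[of s x c] dist_triangle[of "g s x" d "g s c"] by linarith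

lemma integrable_dist_g: "integrable N (\<lambda>s. dist (g s x) d)"
proof (rule Bochner_Integration.integrable_bound)
  show "integrable N (\<lambda>s. dist x c + dist (g s c) d)" using g_moment by simp
  show "AE s in N. norm (dist (g s x) d) \<le> norm (dist x c + dist (g s c) d)"
    using dist_g_le by (intro AE_I2) simp
qed measurable

lemma obs_op_lipschitz: "C-lipschitz_on UNIV \<phi> \<Longrightarrow> C-lipschitz_on UNIV (obs_op \<phi>)"
  using lipschitz_expectation[of C \<phi> 1 "\<lambda>x s. g s x" d] integrable_dist_g g_nonexpansive
  unfolding obs_op_def[abs_def] by simp

definition stationary_pair_law :: "('a \<times> 'c) measure" where
  "stationary_pair_law = distr (N \<Otimes>\<^sub>M limit_law) borel (\<lambda>(s, x). (f s x, g s x))"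

definition pair_kernel :: "'a \<times> 'c \<Rightarrow> ('a \<times> 'c) measure" where
  "pair_kernel z = distr N borel (\<lambda>s. (f s (fst z), g s (fst z)))"

lemma fst_snd_borel [measurable]:
  "fst \<in> borel_measurable (borel :: ('a \<times> 'c) measure)" "snd \<in> borel_measurable (borel :: ('a \<times> 'c) measure)"
  by (auto intro!: borel_measurable_continuous_onI continuous_intros)

lemma pair_step_measurable [measurable]:
  "sets \<mu> = sets borel \<Longrightarrow> (\<lambda>(s, x). (f s x, g s x)) \<in> borel_measurable (N \<Otimes>\<^sub>M \<mu>)"
  by (subst measurable_cong_sets[OF sets_pair_measure_cong[OF refl] refl], assumption) measurable

text \<open>
  The kernel depends on the pair through its first component only, so one step from \<open>M\<close> sees nothing
  of \<open>M\<close> but the first marginal.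
\<close>
lemma bind_pair_kernel:
  assumes M: "prob_space M" "sets M = sets borel"
  shows "M \<bind> pair_kernel = distr (N \<Otimes>\<^sub>M distr M borel fst) borel (\<lambda>(s, x). (f s x, g s x))"
    (is "_ = ?R")
proof (rule measure_eqI)
  interpret M: prob_space M by fact
  note [measurable_cong] = M(2)
  have K[measurable]: "pair_kernel \<in> M \<rightarrow>\<^sub>M subprob_algebra borel"
    unfolding pair_kernel_def[abs_def]
  proof (rule measurable_distr2)
    show "(\<lambda>(z, s). (f s (fst z), g s (fst z))) \<in> borel_measurable (M \<Otimes>\<^sub>M N)" by measurable
    show "(\<lambda>z. N) \<in> M \<rightarrow>\<^sub>M subprob_algebra N"
      using prob_space_imp_subprob_space[OF prob_space_axioms] by (simp add: space_subprob_algebra)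
  qed
  show sets_eq: "sets (M \<bind> pair_kernel) = sets ?R"
    by (subst sets_bind[where N=borel]) (auto simp: pair_kernel_def M.not_empty)
  fix A assume "A \<in> sets (M \<bind> pair_kernel)"
  then have A: "A \<in> sets borel" using sets_eq by simp
  let ?\<mu> = "distr M borel fst"
  interpret \<mu>: prob_space ?\<mu> by (rule M.prob_space_distr) simp
  interpret pair_prob_space N ?\<mu> ..
  let ?F = "\<lambda>(s, x). (f s x, g s x)"
  have F: "?F \<in> borel_measurable (N \<Otimes>\<^sub>M ?\<mu>)" by measurable
  have kA: "(\<lambda>x. emeasure N ((\<lambda>s. (s, x)) -` (?F -` A \<inter> space (N \<Otimes>\<^sub>M ?\<mu>)))) \<in> borel_measurable ?\<mu>"
    using measurable_sets[OF F A] by (rule measurable_emeasure_Pair2)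
  have "emeasure (M \<bind> pair_kernel) A = (\<integral>\<^sup>+z. emeasure (pair_kernel z) A \<partial>M)"
    by (rule emeasure_bind[OF M.not_empty K A])
  also have "\<dots> = (\<integral>\<^sup>+z. emeasure N ((\<lambda>s. (s, fst z)) -` (?F -` A \<inter> space (N \<Otimes>\<^sub>M ?\<mu>))) \<partial>M)"
  proof (rule nn_integral_cong)
    fix z
    have "emeasure (pair_kernel z) A = emeasure N ((\<lambda>s. (f s (fst z), g s (fst z))) -` A \<inter> space N)"
      unfolding pair_kernel_def using A by (intro emeasure_distr) auto
    also have "(\<lambda>s. (f s (fst z), g s (fst z))) -` A \<inter> space N
        = (\<lambda>s. (s, fst z)) -` (?F -` A \<inter> space (N \<Otimes>\<^sub>M ?\<mu>))" by (auto simp: space_pair_measure)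
    finally show "emeasure (pair_kernel z) A = emeasure N ((\<lambda>s. (s, fst z)) -` (?F -` A \<inter> space (N \<Otimes>\<^sub>M ?\<mu>)))" .
  qed
  also have "\<dots> = (\<integral>\<^sup>+x. emeasure N ((\<lambda>s. (s, x)) -` (?F -` A \<inter> space (N \<Otimes>\<^sub>M ?\<mu>))) \<partial>?\<mu>)"
    using kA by (subst nn_integral_distr) auto
  also have "\<dots> = emeasure (N \<Otimes>\<^sub>M ?\<mu>) (?F -` A \<inter> space (N \<Otimes>\<^sub>M ?\<mu>))"
    using emeasure_pair_measure_alt2[OF measurable_sets[OF F A]] by simp
  also have "\<dots> = emeasure ?R A" using F A by (intro emeasure_distr[symmetric])
  finally show "emeasure (M \<bind> pair_kernel) A = emeasure ?R A" .
qed

lemma limit_law_sets [simp, measurable_cong]: "sets limit_law = sets borel"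
  by (simp add: limit_law_def)

lemma stationary_pair_law_fst: "distr stationary_pair_law borel fst = limit_law"
  using limit_law_invariant unfolding stationary_pair_law_def invariant_law_def
  by (subst distr_distr) (auto simp: comp_def case_prod_beta')

lemma prob_space_stationary_pair_law: "prob_space stationary_pair_law"
proof -
  interpret \<mu>: prob_space limit_law using limit_law_invariant by (simp add: invariant_law_def)
  interpret pair_prob_space N limit_law ..
  show ?thesis unfolding stationary_pair_law_def by (rule P.prob_space_distr) measurable
qed

text \<open>
  The first marginal of an invariant pair law is invariant for the state chain, hence equal to
  \<open>limit_law\<close>; by \<open>bind_pair_kernel\<close> it determines the pair law.
\<close>
lemma invariant_pair_iff:
  "invariant_distribution pair_kernel M \<longleftrightarrow> M = stationary_pair_law"
proof
  assume "M = stationary_pair_law"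
  moreover have "sets stationary_pair_law = sets borel" by (simp add: stationary_pair_law_def)
  ultimately show "invariant_distribution pair_kernel M"
    unfolding invariant_distribution_def
    using bind_pair_kernel[of stationary_pair_law] prob_space_stationary_pair_law
    by (simp add: stationary_pair_law_fst) (simp add: stationary_pair_law_def)
next
  assume "invariant_distribution pair_kernel M"
  then have M: "prob_space M" "sets M = sets borel" and inv: "M \<bind> pair_kernel = M"
    by (auto simp: invariant_distribution_def)
  note [measurable_cong] = M(2)
  let ?\<mu> = "distr M borel fst"
  have eq: "M = distr (N \<Otimes>\<^sub>M ?\<mu>) borel (\<lambda>(s, x). (f s x, g s x))"
    using bind_pair_kernel[OF M] inv by simp
  have "?\<mu> = distr (distr (N \<Otimes>\<^sub>M ?\<mu>) borel (\<lambda>(s, x). (f s x, g s x))) borel fst"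
    using eq by simp
  also have "\<dots> = distr (N \<Otimes>\<^sub>M ?\<mu>) borel (\<lambda>(s, x). f s x)"
    by (subst distr_distr) (auto simp: comp_def case_prod_beta')
  finally have "invariant_law ?\<mu>"
    unfolding invariant_law_def using prob_space.prob_space_distr[OF M(1), of fst borel] by simp
  then have "?\<mu> = limit_law" using limit_law_invariant by (rule invariant_law_unique)
  then show "M = stationary_pair_law" using eq by (simp add: stationary_pair_law_def)
qed

lemma stationary_pair_law_snd:
  assumes \<phi>: "C-lipschitz_on UNIV \<phi>"
  shows "integrable (distr stationary_pair_law borel snd) \<phi>"
    and "(\<integral>y. \<phi> y \<partial>distr stationary_pair_law borel snd) = (\<integral>x. obs_op \<phi> x \<partial>limit_law)"
proof -
  note N_1 = emeasure_space_1
  interpret \<mu>: prob_space limit_law using limit_law_invariant by (simp add: invariant_law_def)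
  interpret pair_prob_space N limit_law ..
  have eq: "distr stationary_pair_law borel snd = distr (N \<Otimes>\<^sub>M limit_law) borel (\<lambda>(s, x). g s x)"
    unfolding stationary_pair_law_def by (subst distr_distr) (auto simp: comp_def case_prod_beta')
  have \<phi>m[measurable]: "\<phi> \<in> borel_measurable borel" by (rule lipschitz_real_measurable[OF \<phi>])
  have gm: "(\<lambda>(s, x). g s x) \<in> borel_measurable (N \<Otimes>\<^sub>M limit_law)" by measurable
  have distr_snd: "distr (N \<Otimes>\<^sub>M limit_law) limit_law snd = limit_law"
  proof (rule measure_eqI)
    fix A assume "A \<in> sets (distr (N \<Otimes>\<^sub>M limit_law) limit_law snd)"
    then have A: "A \<in> sets limit_law" by simp
    have "emeasure (distr (N \<Otimes>\<^sub>M limit_law) limit_law snd) A = emeasure (N \<Otimes>\<^sub>M limit_law) (space N \<times> A)"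
      using A sets.sets_into_space[OF A]
      by (subst emeasure_distr) (auto simp: space_pair_measure intro!: arg_cong2[where f=emeasure])
    then show "emeasure (distr (N \<Otimes>\<^sub>M limit_law) limit_law snd) A = emeasure limit_law A"
      using A by (simp add: \<mu>.emeasure_pair_measure_Times N_1)
  qed simp
  have "integrable (N \<Otimes>\<^sub>M limit_law) (\<lambda>z. dist (g (fst z) (snd z)) d)"
  proof (rule Bochner_Integration.integrable_bound)
    have "integrable (N \<Otimes>\<^sub>M limit_law) (\<lambda>z. dist (snd z) c)"
      using limit_law_moment integrable_distr[OF measurable_snd, of N limit_law "\<lambda>x. dist x c"]
      by (simp add: distr_snd)
    moreover have "integrable (N \<Otimes>\<^sub>M limit_law) (\<lambda>z. dist (g (fst z) c) d)"
      using g_moment integrable_distr[OF measurable_fst, of N limit_law "\<lambda>s. dist (g s c) d"]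
      by (simp add: \<mu>.distr_pair_fst)
    ultimately show "integrable (N \<Otimes>\<^sub>M limit_law) (\<lambda>z. dist (snd z) c + dist (g (fst z) c) d)" by simp
    show "AE z in N \<Otimes>\<^sub>M limit_law. norm (dist (g (fst z) (snd z)) d) \<le> norm (dist (snd z) c + dist (g (fst z) c) d)"
      using dist_g_le by (intro AE_I2) (auto simp: space_pair_measure)
  qed measurable
  then have i: "integrable (N \<Otimes>\<^sub>M limit_law) (\<lambda>z. \<phi> (g (fst z) (snd z)))"
    by (intro P.integrable_lipschitz_comp[OF \<phi>]) measurable
  then show "integrable (distr stationary_pair_law borel snd) \<phi>"
    unfolding eq using gm by (subst integrable_distr_eq) (auto simp: case_prod_beta')
  show "(\<integral>y. \<phi> y \<partial>distr stationary_pair_law borel snd) = (\<integral>x. obs_op \<phi> x \<partial>limit_law)"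
    unfolding eq obs_op_def using gm integral_snd[of "\<lambda>s x. \<phi> (g s x)"] i
    by (subst integral_distr) (auto simp: case_prod_beta')
qed

lemma driven_chain_observed:
  assumes \<Omega>: "prob_space \<Omega>" and ind: "prob_space.indep_vars \<Omega> (\<lambda>_::nat. N) \<zeta> UNIV"
    and law: "\<And>n. distr \<Omega> N (\<zeta> n) = N"
    and U: "\<And>\<omega>. U 0 \<omega> = x" "\<And>n \<omega>. U (Suc n) \<omega> = f (\<zeta> n \<omega>) (U n \<omega>)"
    and \<phi>: "C-lipschitz_on UNIV \<phi>"
  shows "integrable \<Omega> (\<lambda>\<omega>. \<phi> (g (\<zeta> n \<omega>) (U n \<omega>)))" (is ?int)
    and "(\<integral>\<omega>. \<phi> (g (\<zeta> n \<omega>) (U n \<omega>)) \<partial>\<Omega>) = (markov_op ^^ n) (obs_op \<phi>) x"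
proof -
  interpret \<Omega>: prob_space \<Omega> by fact
  note [measurable] = driven_chain_independent(1)[where U=U, OF \<Omega> ind law U, of n]
  have \<zeta>[measurable]: "\<zeta> n \<in> \<Omega> \<rightarrow>\<^sub>M N" for n using ind unfolding \<Omega>.indep_vars_def2 by blast
  have "integrable (distr \<Omega> N (\<zeta> n)) (\<lambda>s. dist (g s c) d)" using g_moment law by simp
  then have i: "integrable \<Omega> (\<lambda>\<omega>. dist (g (\<zeta> n \<omega>) c) d)"
    by (rule integrable_distr[OF \<zeta>])
  have "integrable \<Omega> (\<lambda>\<omega>. dist (g (\<zeta> n \<omega>) (U n \<omega>)) d)"
  proof (rule Bochner_Integration.integrable_bound)
    show "integrable \<Omega> (\<lambda>\<omega>. dist (U n \<omega>) c + dist (g (\<zeta> n \<omega>) c) d)"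
      using i driven_chain_moment[where U=U, OF \<Omega> ind law U] by simp
    show "AE \<omega> in \<Omega>. norm (dist (g (\<zeta> n \<omega>) (U n \<omega>)) d) \<le> norm (dist (U n \<omega>) c + dist (g (\<zeta> n \<omega>) c) d)"
      using dist_g_le measurable_space[OF \<zeta>] by (intro AE_I2) simp
  qed measurable
  then show int: ?int
    by (intro \<Omega>.integrable_lipschitz_comp[OF \<phi>]) measurable
  \<comment> \<open>The observable enters through its average over the fresh input, a Lipschitz function of the state.\<close>
  have "(\<integral>\<omega>. \<phi> (g (\<zeta> n \<omega>) (U n \<omega>)) \<partial>\<Omega>) = (\<integral>\<omega>. obs_op \<phi> (U n \<omega>) \<partial>\<Omega>)"
    unfolding obs_op_def
    by (rule driven_chain_expectation[where U=U, OF \<Omega> ind law U g_meas lipschitz_real_measurable[OF \<phi>] int])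
  then show "(\<integral>\<omega>. \<phi> (g (\<zeta> n \<omega>) (U n \<omega>)) \<partial>\<Omega>) = (markov_op ^^ n) (obs_op \<phi>) x"
    using driven_chain_markov_op(2)[where U=U, OF \<Omega> ind law U obs_op_lipschitz[OF \<phi>]] by simp
qed

end

section \<open>Orthonormal bases and diagonal operators\<close>

lemma suminf_delta:
  fixes f :: "nat \<Rightarrow> 'a::real_normed_vector"
  assumes "\<And>k. k \<noteq> p \<Longrightarrow> f k = 0"
  shows "(\<Sum>k. f k) = f p"
  using suminf_finite[of "{p}" f] assms by auto

locale orthonormal_basis =
  fixes e :: "nat \<Rightarrow> 'a::{real_inner, complete_space}"
  assumes complete: "complete_orthonormal e"
begin

lemma inner_e [simp]: "inner (e i) (e j) = (if i = j then 1 else 0)"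
  using complete by (simp add: complete_orthonormal_def)

lemma norm_e [simp]: "norm (e i) = 1"
  by (simp add: norm_eq_sqrt_inner)

lemma norm_sum_e: "finite I \<Longrightarrow> (norm (\<Sum>p\<in>I. c p *\<^sub>R e p))\<^sup>2 = (\<Sum>p\<in>I. (c p)\<^sup>2)"
  unfolding power2_norm_eq_inner inner_sum_left inner_sum_right
  by (simp add: if_distrib[of "\<lambda>x. _ * x"] sum.delta power2_eq_square cong: if_cong)

lemma summable_e:
  assumes "summable (\<lambda>p. (c p)\<^sup>2)"
  shows "summable (\<lambda>p. c p *\<^sub>R e p)"
proof -
  let ?S = "\<lambda>n. \<Sum>p<n. c p *\<^sub>R e p"
  have "Cauchy ?S"
  proof (rule metric_CauchyI)
    fix \<epsilon> :: real assume "\<epsilon> > 0"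
    then obtain N where N: "\<And>m n. m \<ge> N \<Longrightarrow> norm (\<Sum>p=m..<n. (c p)\<^sup>2) < \<epsilon>\<^sup>2"
      using assms[unfolded summable_Cauchy] by (meson zero_less_power)
    have *: "dist (?S m) (?S n) < \<epsilon>" if "m \<ge> N" "m \<le> n" for m n
    proof -
      have "?S n - ?S m = (\<Sum>p=m..<n. c p *\<^sub>R e p)"
        using sum_diff_nat_ivl[of 0 m n "\<lambda>p. c p *\<^sub>R e p"] that by (simp add: atLeast0LessThan)
      then have "(dist (?S m) (?S n))\<^sup>2 < \<epsilon>\<^sup>2"
        using N[OF that(1), of n] by (simp add: norm_sum_e dist_norm norm_minus_commute[of "?S m"])
      then show ?thesis by (rule power2_less_imp_less) (use \<open>\<epsilon> > 0\<close> in simp)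
    qed
    show "\<exists>M. \<forall>m\<ge>M. \<forall>n\<ge>M. dist (?S m) (?S n) < \<epsilon>"
      by (intro exI[of _ N] allI impI) (metis * dist_commute nle_le)
  qed
  then show ?thesis by (simp add: summable_iff_convergent Cauchy_convergent_iff)
qed

lemma inner_suminf_e:
  assumes "summable (\<lambda>p. c p *\<^sub>R e p)"
  shows "inner (\<Sum>p. c p *\<^sub>R e p) (e k) = c k"
proof -
  have "inner (\<Sum>p. c p *\<^sub>R e p) (e k) = (\<Sum>p. inner (c p *\<^sub>R e p) (e k))"
    by (rule sums_unique[OF bounded_linear.sums[OF bounded_linear_inner_left summable_sums[OF assms]]])
  also have "\<dots> = c k" by (subst suminf_delta[where p=k]) auto
  finally show ?thesis .
qed

lemma Bessel: "(\<Sum>p<n. (inner x (e p))\<^sup>2) \<le> (norm x)\<^sup>2"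
proof -
  let ?s = "\<Sum>p<n. inner x (e p) *\<^sub>R e p"
  have "inner x ?s = (\<Sum>p<n. (inner x (e p))\<^sup>2)"
    by (simp add: inner_sum_right power2_eq_square)
  moreover have "inner ?s ?s = (\<Sum>p<n. (inner x (e p))\<^sup>2)"
    using norm_sum_e[of "{..<n}" "\<lambda>p. inner x (e p)"] by (simp add: power2_norm_eq_inner)
  moreover have "0 \<le> inner (x - ?s) (x - ?s)" by simp
  ultimately show ?thesis
    by (simp add: inner_diff inner_commute power2_norm_eq_inner)
qed

lemma summable_coord: "summable (\<lambda>p. (inner x (e p))\<^sup>2)"
  by (rule summableI_nonneg_bounded[OF _ Bessel]) simp

text \<open>
  A vector with vanishing coordinates is orthogonal to the closed span of the basis, thus to itself.
\<close>
lemma eqI_coord: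
  assumes "\<And>p. inner x (e p) = inner y (e p)"
  shows "x = y"
proof -
  let ?O = "{z. inner (x - y) z = 0}"
  have "span (range e) \<subseteq> ?O"
    by (rule span_minimal) (auto simp: assms inner_diff_left subspace_def inner_add_right)
  then have "closure (span (range e)) \<subseteq> ?O"
    by (rule closure_minimal) (intro closed_Collect_eq continuous_intros)
  then have "x - y \<in> ?O" using complete unfolding complete_orthonormal_def by blast
  then have "inner (x - y) (x - y) = 0" by simp
  then show ?thesis by simp
qed

lemma expansion: "(\<Sum>p. inner x (e p) *\<^sub>R e p) = x"
  by (rule eqI_coord) (rule inner_suminf_e[OF summable_e[OF summable_coord]])

lemma expansion_sums: "(\<lambda>p. inner x (e p) *\<^sub>R e p) sums x"
  using summable_sums[OF summable_e[OF summable_coord]] by (simp add: expansion)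

lemma Parseval: "(\<lambda>p. inner x (e p) * inner y (e p)) sums inner x y"
  using bounded_linear.sums[OF bounded_linear_inner_left[of y] expansion_sums[of x]]
  by (simp add: inner_commute)

lemma Parseval_norm: "(\<lambda>p. (inner x (e p))\<^sup>2) sums (norm x)\<^sup>2"
  using Parseval[of x x] by (simp add: power2_eq_square power2_norm_eq_inner[unfolded power2_eq_square])

lemma norm_le_coord:
  assumes "\<And>p. \<bar>inner x (e p)\<bar> \<le> a * \<bar>inner y (e p)\<bar>" "0 \<le> a"
  shows "norm x \<le> a * norm y"
proof (rule power2_le_imp_le)
  have "(inner x (e p))\<^sup>2 \<le> a\<^sup>2 * (inner y (e p))\<^sup>2" for p
    using power_mono[OF assms(1)[of p], of 2] by (simp add: power_mult_distrib)
  then show "(norm x)\<^sup>2 \<le> (a * norm y)\<^sup>2"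
    unfolding power_mult_distrib
    using Parseval_norm[of x] sums_mult[OF Parseval_norm[of y], of "a\<^sup>2"] by (rule sums_le)
qed (use assms in simp)

text \<open>
  \<open>adjoint J\<close> is a choice among all adjoints of \<open>J\<close>, so one has to be exhibited: it is
  \<open>y \<mapsto> (\<Sum>p. \<langle>J e\<^sub>p, y\<rangle> e\<^sub>p)\<close>. Square summability of its coefficients \<open>c\<^sub>p\<close> follows by testing the
  boundedness of \<open>J\<close> on the vector \<open>v = (\<Sum>p<n. c\<^sub>p e\<^sub>p)\<close> itself, which gives
  \<open>|v|\<^sup>2 = \<langle>J v, y\<rangle> \<le> \<parallel>J\<parallel> |v| |y|\<close>.
\<close>
lemma adjoint_works_bounded:
  fixes J :: "'a \<Rightarrow> 'a"
  assumes J: "bounded_linear J"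
  shows "inner (J x) y = inner x (adjoint J y)"
proof -
  interpret J: bounded_linear J by fact
  define g where "g y = (\<Sum>p. inner (J (e p)) y *\<^sub>R e p)" for y
  have s: "summable (\<lambda>p. (inner (J (e p)) y)\<^sup>2)" for y
  proof (rule summableI_nonneg_bounded)
    fix n
    let ?c = "\<lambda>p. inner (J (e p)) y"
    let ?S = "\<Sum>p<n. (?c p)\<^sup>2" and ?v = "\<Sum>p<n. ?c p *\<^sub>R e p"
    have v: "(norm ?v)\<^sup>2 = ?S" by (simp add: norm_sum_e)
    have "?S = inner (J ?v) y"
      by (simp add: J.sum J.scaleR inner_sum_left power2_eq_square)
    also have "\<dots> \<le> norm (J ?v) * norm y" by (rule norm_cauchy_schwarz)
    also have "\<dots> \<le> norm ?v * onorm J * norm y"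
      using mult_right_mono[OF onorm[OF J, of ?v] norm_ge_zero[of y]] by (simp add: ac_simps)
    finally have "(norm ?v)\<^sup>2 \<le> norm ?v * (onorm J * norm y)" using v by (simp add: ac_simps)
    then have "norm ?v \<le> onorm J * norm y"
      using onorm_pos_le[OF J] by (cases "norm ?v = 0") (auto simp: power2_eq_square)
    then show "?S \<le> (onorm J * norm y)\<^sup>2" using v power_mono[of "norm ?v" "onorm J * norm y" 2] by simp
  qed simp
  have "inner (J x) y = inner x (g y)" for x y
  proof -
    have "(\<lambda>p. inner (J (inner x (e p) *\<^sub>R e p)) y) sums inner (J x) y"
      by (intro bounded_linear.sums[OF bounded_linear_inner_left] bounded_linear.sums[OF J] expansion_sums)
    then have "(\<lambda>p. inner x (e p) * inner (J (e p)) y) sums inner (J x) y" by (simp add: J.scaleR)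
    moreover have "(\<lambda>p. inner x (e p) * inner (g y) (e p)) sums inner x (g y)" by (rule Parseval)
    moreover have "inner (g y) (e p) = inner (J (e p)) y" for p
      unfolding g_def by (rule inner_suminf_e[OF summable_e[OF s]])
    ultimately show ?thesis by (simp add: sums_unique2)
  qed
  then have "adjoint J = g" and "inner (J x) y = inner x (g y)" by (auto intro: adjoint_unique)
  then show ?thesis by simp
qed

end

locale diagonal_generator = orthonormal_basis e
  for e :: "nat \<Rightarrow> 'a::{real_inner, complete_space}" +
  fixes D :: "'a set" and A :: "'a \<Rightarrow> 'a" and lam :: "nat \<Rightarrow> real"
  assumes self_adjoint: "self_adjoint_on D (\<lambda>x. - A x)"
    and eigen: "\<And>p. e p \<in> D" "\<And>p. A (e p) = - lam p *\<^sub>R e p"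
    and lam0: "0 < lam 0" and mono_lam: "mono lam"
begin

lemma lam_ge: "lam 0 \<le> lam p" using mono_lam by (simp add: monoD)
lemma lam_pos: "0 < lam p" using lam0 lam_ge[of p] by linarith

lemma A_coord: "x \<in> D \<Longrightarrow> inner (A x) (e p) = - lam p * inner x (e p)"
proof -
  assume "x \<in> D"
  moreover have "\<forall>y z. (\<forall>x\<in>D. inner (- A x) y = inner x z) \<longleftrightarrow> (y \<in> D \<and> - A y = z)"
    using self_adjoint by (simp add: self_adjoint_on_def)
  ultimately have "inner (- A x) (e p) = inner x (- A (e p))" using eigen(1) by blast
  then show ?thesis by (simp add: eigen(2) inner_minus_left)
qed

text \<open>
  Maximality of self-adjoint operators: every vector on which \<open>A\<close> makes sense coordinatewise lies in
  the domain.
\<close>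
lemma in_domain:
  assumes "\<And>p. inner z (e p) = - lam p * inner x (e p)"
  shows "x \<in> D" "A x = z"
proof -
  have "inner (- A w) x = inner w (- z)" if "w \<in> D" for w
  proof -
    have "inner (- A w) (e p) * inner x (e p) = inner w (e p) * inner (- z) (e p)" for p
      using assms[of p] by (simp add: A_coord[OF that])
    then have "(\<lambda>p. inner w (e p) * inner (- z) (e p)) sums inner (- A w) x"
      using Parseval[of "- A w" x] by simp
    then show ?thesis using Parseval[of w "- z"] by (rule sums_unique2)
  qed
  then have "x \<in> D \<and> - A x = - z" using self_adjoint unfolding self_adjoint_on_def by blast
  then show "x \<in> D" "A x = z" by auto
qed

text \<open>
  Solving \<open>x - c A x = y\<close> coordinatewise gives an element of the domain by \<open>in_domain\<close>, and
  the solution is unique because \<open>1 + c \<lambda>\<^sub>p > 0\<close>.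
\<close>
lemma resolvent_coord:
  assumes c: "0 < c"
  shows "inner (resolvent D A c y) (e p) = inner y (e p) / (1 + c * lam p)"
proof -
  have pos: "0 < 1 + c * lam p" for p using c lam_pos[of p] by (simp add: add_pos_pos)
  have le: "(inner y (e p) / (1 + c * lam p))\<^sup>2 \<le> (inner y (e p))\<^sup>2" for p
  proof -
    have "\<bar>inner y (e p) / (1 + c * lam p)\<bar> \<le> \<bar>inner y (e p)\<bar>"
      using pos[of p] c lam_pos[of p]
      by (simp add: abs_divide divide_le_eq) (simp add: distrib_left mult_nonneg_nonneg)
    then show ?thesis by (simp only: abs_le_square_iff)
  qed
  define x where "x = (\<Sum>p. (inner y (e p) / (1 + c * lam p)) *\<^sub>R e p)"
  have x: "inner x (e p) = inner y (e p) / (1 + c * lam p)" for p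
    unfolding x_def
    by (rule inner_suminf_e[OF summable_e[OF summable_comparison_test[OF _ summable_coord[of y]]]])
       (use le in auto)
  define z where "z = (1 / c) *\<^sub>R (x - y)"
  have "inner z (e p) = - lam p * inner x (e p)" for p
  proof -
    have "inner y (e p) = (1 + c * lam p) * inner x (e p)" using pos[of p] by (simp add: x)
    then show ?thesis using c by (simp add: z_def inner_diff_left field_simps)
  qed
  from in_domain[OF this] have xD: "x \<in> D" and Ax: "A x = z" by auto
  have inj: "inj_on (\<lambda>x. x - c *\<^sub>R A x) D"
  proof (rule inj_onI)
    fix v w assume D: "v \<in> D" "w \<in> D" and eq: "v - c *\<^sub>R A v = w - c *\<^sub>R A w"
    show "v = w"
    proof (rule eqI_coord)
      fix p
      have "inner (v - c *\<^sub>R A v) (e p) = inner (w - c *\<^sub>R A w) (e p)" using eq by simp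
      then have "(1 + c * lam p) * inner v (e p) = (1 + c * lam p) * inner w (e p)"
        by (simp add: inner_diff_left A_coord D algebra_simps)
      then show "inner v (e p) = inner w (e p)" using pos[of p] by simp
    qed
  qed
  have "y = x - c *\<^sub>R A x" using c by (simp add: Ax z_def)
  then have "resolvent D A c y = x"
    unfolding resolvent_def using inv_into_f_f[OF inj xD] by simp
  then show ?thesis by (simp add: x)
qed

lemma resolvent_e: "0 < c \<Longrightarrow> resolvent D A c (e p) = (1 / (1 + c * lam p)) *\<^sub>R e p"
  by (rule eqI_coord) (auto simp: resolvent_coord)

lemma norm_resolvent_le:
  assumes "0 < c"
  shows "norm (resolvent D A c x) \<le> norm x / (1 + c * lam 0)"
proof -
  have pos: "0 < 1 + c * lam p" for p using assms lam_pos[of p] by (simp add: add_pos_pos)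
  have "norm (resolvent D A c x) \<le> (1 / (1 + c * lam 0)) * norm x"
  proof (rule norm_le_coord)
    fix p
    have "\<bar>inner x (e p)\<bar> / (1 + c * lam p) \<le> \<bar>inner x (e p)\<bar> / (1 + c * lam 0)"
      using assms lam_ge[of p] pos[of 0] pos[of p] by (intro divide_left_mono mult_pos_pos) auto
    then show "\<bar>inner (resolvent D A c x) (e p)\<bar> \<le> 1 / (1 + c * lam 0) * \<bar>inner x (e p)\<bar>"
      using pos[of p] assms by (simp add: resolvent_coord abs_divide)
  qed (use pos[of 0] in simp)
  then show ?thesis by simp
qed

lemma bounded_linear_resolvent:
  assumes "0 < c"
  shows "bounded_linear (resolvent D A c)"
proof (rule bounded_linear_intro[where K="1 / (1 + c * lam 0)"])
  show "resolvent D A c (x + y) = resolvent D A c x + resolvent D A c y" for x y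
    by (rule eqI_coord) (simp add: resolvent_coord[OF assms] inner_add_left add_divide_distrib)
  show "resolvent D A c (r *\<^sub>R x) = r *\<^sub>R resolvent D A c x" for r x
    by (rule eqI_coord) (simp add: resolvent_coord[OF assms])
  show "norm (resolvent D A c x) \<le> norm x * (1 / (1 + c * lam 0))" for x
    using norm_resolvent_le[OF assms, of x] by simp
qed

end

locale diagonal_covariance = diagonal_generator e D A lam
  for e :: "nat \<Rightarrow> 'a::{real_inner, complete_space}" and D A lam +
  fixes Q :: "'a \<Rightarrow> 'a" and q :: "nat \<Rightarrow> real"
  assumes Q_bl: "bounded_linear Q" and Q_eigen: "\<And>p. Q (e p) = q p *\<^sub>R e p"
    and q_nonneg: "\<And>p. 0 \<le> q p"
    and trace: "0 < s_bar e lam Q"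
begin

text \<open>
  Some exponent \<open>s > 0\<close> has finite trace \<open>(\<Sum>p. q\<^sub>p \<lambda>\<^sub>p\<^sup>-\<^sup>1\<^sup>+\<^sup>s)\<close>, and \<open>\<lambda>\<^sub>p\<^sup>-\<^sup>s \<le> \<lambda>\<^sub>0\<^sup>-\<^sup>s\<close>.
\<close>
lemma summable_q_lam: "summable (\<lambda>p. q p / lam p)"
proof -
  interpret Q: bounded_linear Q by (rule Q_bl)
  obtain s where s: "0 < s" "s < 1" and tr: "op_trace e (frac_power e lam (- 1 + s) \<circ> Q) < \<infinity>"
    using trace unfolding s_bar_def less_Sup_iff by auto
  have diag: "inner ((frac_power e lam (- 1 + s) \<circ> Q) (e p)) (e p) = q p * lam p powr (- 1 + s)" for p
    unfolding frac_power_def comp_def Q_eigen by (subst suminf_delta[where p=p]) auto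
  have sm: "summable (\<lambda>p. q p * lam p powr (- 1 + s))"
    using tr q_nonneg unfolding op_trace_def diag by (intro summable_suminf_not_top) auto
  have "q p / lam p \<le> lam 0 powr (- s) * (q p * lam p powr (- 1 + s))" for p
  proof -
    have "lam p powr (- 1 + s) * lam p powr (- s) = 1 / lam p"
      using lam_pos[of p] powr_minus_divide[of "lam p" 1] by (simp flip: powr_add)
    then have "q p / lam p = q p * lam p powr (- 1 + s) * lam p powr (- s)"
      by (simp only: mult.assoc) simp
    also have "\<dots> \<le> q p * lam p powr (- 1 + s) * lam 0 powr (- s)"
      using q_nonneg[of p] lam_ge[of p] lam0 s by (intro mult_left_mono powr_mono2') auto
    finally show ?thesis by (simp add: ac_simps)
  qed
  then show ?thesis
    using q_nonneg lam_pos
    by (intro summable_comparison_test[OF _ summable_mult[OF sm, of "lam 0 powr (- s)"]])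
       (auto simp: less_imp_le abs_mult)
qed

lemma resolvent_trace_summable:
  assumes c: "0 < c"
  shows "summable (\<lambda>p. q p / (1 + c * lam p))"
proof (rule summable_comparison_test[OF _ summable_divide[OF summable_q_lam, of c]])
  have "q p / (1 + c * lam p) \<le> q p / lam p / c" for p
    using c lam_pos[of p] q_nonneg[of p]
    by (simp add: divide_divide_eq_left) (intro divide_left_mono, auto simp: ac_simps add_pos_pos)
  then show "\<exists>N. \<forall>p\<ge>N. norm (q p / (1 + c * lam p)) \<le> q p / lam p / c"
    using c lam_pos q_nonneg by (auto simp: abs_div_pos add_pos_pos less_imp_le)
qed

text \<open>
  The noise \<open>J \<xi>\<close> has finite second moment although \<open>J\<close> need not be diagonal: exchanging the order of
  the double sum of \<open>q\<^sub>p \<langle>J e\<^sub>p, e\<^sub>k\<rangle>\<^sup>2\<close> turns the Hilbert--Schmidt norm of \<open>J Q\<^sup>1\<^sup>/\<^sup>2\<close> into the trace of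
  \<open>J Q J\<^sup>T\<close>, which is known.
\<close>
lemma is_J3_summable:
  assumes J3: "is_J3 D A Q h J" and h: "0 < h"
  shows "summable (\<lambda>p. q p * (norm (J (e p)))\<^sup>2)"
proof -
  from J3 have J: "bounded_linear J" and JQ: "J \<circ> Q \<circ> adjoint J = resolvent D A (h / 2) \<circ> Q"
    by (auto simp: is_J3_def)
  interpret Q: bounded_linear Q by (rule Q_bl)
  have Qx: "(\<lambda>p. q p * (inner x (e p))\<^sup>2) sums inner (Q x) x" for x
  proof -
    have "(\<lambda>p. inner (Q (inner x (e p) *\<^sub>R e p)) x) sums inner (Q x) x"
      by (intro bounded_linear.sums[OF bounded_linear_inner_left] bounded_linear.sums[OF Q_bl] expansion_sums)
    then show ?thesis by (simp add: Q.scaleR Q_eigen inner_commute power2_eq_square ac_simps)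
  qed
  have diag: "inner (Q (adjoint J (e k))) (adjoint J (e k)) = q k / (1 + h / 2 * lam k)" for k
  proof -
    have "inner (Q (adjoint J (e k))) (adjoint J (e k)) = inner ((J \<circ> Q \<circ> adjoint J) (e k)) (e k)"
      by (simp add: adjoint_works_bounded[OF J])
    also have "\<dots> = q k / (1 + h / 2 * lam k)" using h by (simp add: JQ Q_eigen resolvent_coord)
    finally show ?thesis .
  qed
  have pos: "0 < 1 + h / 2 * lam k" for k using h lam_pos[of k] by (simp add: add_pos_pos)
  have "(\<Sum>p. ennreal (q p * (norm (J (e p)))\<^sup>2)) = (\<Sum>p. \<Sum>k. ennreal (q p * (inner (J (e p)) (e k))\<^sup>2))"
  proof (rule suminf_cong)
    fix p
    have "(\<lambda>k. q p * (inner (J (e p)) (e k))\<^sup>2) sums (q p * (norm (J (e p)))\<^sup>2)"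
      by (rule sums_mult[OF Parseval_norm])
    then show "ennreal (q p * (norm (J (e p)))\<^sup>2) = (\<Sum>k. ennreal (q p * (inner (J (e p)) (e k))\<^sup>2))"
      using q_nonneg by (subst suminf_ennreal2) (auto simp: sums_iff)
  qed
  also have "\<dots> = (\<Sum>k. \<Sum>p. ennreal (q p * (inner (J (e p)) (e k))\<^sup>2))"
    using nn_integral_suminf[of "\<lambda>k p. ennreal (q p * (inner (J (e p)) (e k))\<^sup>2)" "count_space UNIV"]
    by (simp add: nn_integral_count_space_nat)
  also have "\<dots> = (\<Sum>k. ennreal (q k / (1 + h / 2 * lam k)))"
  proof (rule suminf_cong)
    fix k
    have "inner (adjoint J (e k)) (e p) = inner (J (e p)) (e k)" for p
      using adjoint_works_bounded[OF J, of "e p" "e k"] by (simp add: inner_commute)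
    then have "(\<lambda>p. q p * (inner (J (e p)) (e k))\<^sup>2) sums (q k / (1 + h / 2 * lam k))"
      using Qx[of "adjoint J (e k)"] unfolding diag by simp
    then show "(\<Sum>p. ennreal (q p * (inner (J (e p)) (e k))\<^sup>2)) = ennreal (q k / (1 + h / 2 * lam k))"
      using q_nonneg by (subst suminf_ennreal2) (auto simp: sums_iff)
  qed
  also have "\<dots> < \<infinity>"
    using resolvent_trace_summable[of "h / 2"] h q_nonneg pos
    by (subst suminf_ennreal2) (auto simp: less_imp_le)
  finally show ?thesis using q_nonneg by (intro summable_suminf_not_top) auto
qed

end

section \<open>Orthogonal random series\<close>

definition orthonormal_rvs :: "'w measure \<Rightarrow> ('i \<Rightarrow> 'w \<Rightarrow> real) \<Rightarrow> bool" where
  "orthonormal_rvs M g \<longleftrightarrow> (\<forall>i. g i \<in> borel_measurable M) \<and>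
     (\<forall>i j. integrable M (\<lambda>\<omega>. g i \<omega> * g j \<omega>) \<and> (\<integral>\<omega>. g i \<omega> * g j \<omega> \<partial>M) = (if i = j then 1 else 0))"

lemma orthonormal_rvs_reindex:
  "orthonormal_rvs M g \<Longrightarrow> inj t \<Longrightarrow> orthonormal_rvs M (\<lambda>i. g (t i))"
  by (auto simp: orthonormal_rvs_def inj_eq)

lemma (in prob_space) indep_normal_orthonormal:
  assumes ind: "indep_vars (\<lambda>_. borel) g UNIV"
    and normal: "\<And>i. distributed M lborel (g i) std_normal_density"
  shows "orthonormal_rvs M g"
  unfolding orthonormal_rvs_def
proof (intro conjI allI)
  show m: "g i \<in> borel_measurable M" for i using ind unfolding indep_vars_def2 by blast
  have i1: "integrable M (g i)" for i
    using integrable_std_normal_moment[of 1] by (intro distributed_integrable_var[OF normal]) auto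
  have e1: "expectation (g i) = 0" for i by (rule standard_normal_distributed_expectation[OF normal])
  have i2: "integrable M (\<lambda>\<omega>. (g i \<omega>)\<^sup>2)" for i
    using integrable_std_normal_moment[of 2] by (subst distributed_integrable[OF normal, symmetric]) auto
  have e2: "expectation (\<lambda>\<omega>. (g i \<omega>)\<^sup>2) = 1" for i
    using integral_std_normal_moment_even[of 1]
    by (subst distributed_integral[OF normal, symmetric]) auto
  fix i j
  have "integrable M (\<lambda>\<omega>. g i \<omega> * g j \<omega>) \<and> expectation (\<lambda>\<omega>. g i \<omega> * g j \<omega>) = (if i = j then 1 else 0)"
  proof (cases "i = j")
    case True then show ?thesis using i2[of j] e2[of j] by (simp add: power2_eq_square)
  next
    case False
    have "indep_vars (\<lambda>_. borel) g {i, j}" by (rule indep_vars_subset[OF ind]) simp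
    from indep_vars_integrable[OF _ this] indep_vars_lebesgue_integral[OF _ this] False i1 e1
    show ?thesis by simp
  qed
  then show "integrable M (\<lambda>\<omega>. g i \<omega> * g j \<omega>)" "expectation (\<lambda>\<omega>. g i \<omega> * g j \<omega>) = (if i = j then 1 else 0)"
    by auto
qed

lemma orthonormal_rvs_Pythagoras:
  fixes v :: "'i \<Rightarrow> 'a::real_inner"
  assumes g: "orthonormal_rvs M g" and I: "finite I"
  shows "integrable M (\<lambda>\<omega>. (norm (\<Sum>p\<in>I. g p \<omega> *\<^sub>R v p))\<^sup>2)"
    and "(\<integral>\<omega>. (norm (\<Sum>p\<in>I. g p \<omega> *\<^sub>R v p))\<^sup>2 \<partial>M) = (\<Sum>p\<in>I. (norm (v p))\<^sup>2)"
proof -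
  have eq: "(norm (\<Sum>p\<in>I. g p \<omega> *\<^sub>R v p))\<^sup>2 = (\<Sum>p\<in>I. \<Sum>l\<in>I. (g p \<omega> * g l \<omega>) * inner (v l) (v p))" for \<omega>
    unfolding power2_norm_eq_inner by (simp add: inner_sum_left inner_sum_right sum_distrib_left mult.assoc)
  have i: "integrable M (\<lambda>\<omega>. (g p \<omega> * g l \<omega>) * inner (v l) (v p))" for p l
    using g by (intro integrable_mult_left) (auto simp: orthonormal_rvs_def)
  show "integrable M (\<lambda>\<omega>. (norm (\<Sum>p\<in>I. g p \<omega> *\<^sub>R v p))\<^sup>2)"
    unfolding eq by (intro Bochner_Integration.integrable_sum i)
  have "(\<integral>\<omega>. (norm (\<Sum>p\<in>I. g p \<omega> *\<^sub>R v p))\<^sup>2 \<partial>M) = (\<Sum>p\<in>I. \<Sum>l\<in>I. (if p = l then 1 else 0) * inner (v l) (v p))"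
    unfolding eq using g i
    by (simp add: Bochner_Integration.integral_sum Bochner_Integration.integrable_sum orthonormal_rvs_def)
  also have "\<dots> = (\<Sum>p\<in>I. (norm (v p))\<^sup>2)"
    using I by (simp add: power2_norm_eq_inner if_distrib[of "\<lambda>x. x * _"] sum.delta cong: if_cong)
  finally show "(\<integral>\<omega>. (norm (\<Sum>p\<in>I. g p \<omega> *\<^sub>R v p))\<^sup>2 \<partial>M) = (\<Sum>p\<in>I. (norm (v p))\<^sup>2)" .
qed

text \<open>
  The series is measurable as a limit on the measurable event where the partial sums are Cauchy, and
  constant outside of it.
\<close>
lemma borel_measurable_suminf_polish [measurable (raw)]:
  fixes f :: "nat \<Rightarrow> 'a \<Rightarrow> 'b::{real_normed_vector, polish_space}"
  assumes f[measurable]: "\<And>i. f i \<in> borel_measurable M"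
  shows "(\<lambda>x. \<Sum>i. f i x) \<in> borel_measurable M"
proof -
  define S where "S x = (\<lambda>n. \<Sum>i<n. f i x)" for x
  have [measurable]: "(\<lambda>x. S x n) \<in> borel_measurable M" for n unfolding S_def by measurable
  define u where "u x = lim (\<lambda>n. if Cauchy (S x) then S x n else 0)" for x
  have C: "Cauchy (S x) \<longleftrightarrow> summable (\<lambda>i. f i x)" for x
    by (simp add: S_def summable_iff_convergent Cauchy_convergent_iff)
  have "(\<Sum>i. f i x) = (if Cauchy (S x) then u x else (THE s. False))" for x
  proof (cases "Cauchy (S x)")
    case True
    then show ?thesis by (simp add: u_def S_def suminf_eq_lim)
  next
    case False
    then have "\<not> (\<lambda>i. f i x) sums s" for s using C by (auto simp: summable_def)
    then show ?thesis using False by (simp add: suminf_def)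
  qed
  moreover have "u \<in> borel_measurable M"
  proof (rule borel_measurable_LIMSEQ_metric)
    show "(\<lambda>x. if Cauchy (S x) then S x n else 0) \<in> borel_measurable M" for n by measurable
    show "(\<lambda>n. if Cauchy (S x) then S x n else 0) \<longlonglongrightarrow> u x" for x
      unfolding u_def by (cases "Cauchy (S x)") (auto simp: Cauchy_convergent_iff convergent_LIMSEQ_iff)
  qed
  ultimately show ?thesis by simp
qed

text \<open>
  Fatou's lemma applied to the partial sums, whose second moments are given by Pythagoras.
\<close>
lemma series_second_moment:
  fixes v :: "nat \<Rightarrow> 'a::{real_inner, polish_space}"
  assumes g: "orthonormal_rvs M g" and v: "summable (\<lambda>p. (norm (v p))\<^sup>2)"
  shows "(\<integral>\<^sup>+\<omega>. (if summable (\<lambda>p. g p \<omega> *\<^sub>R v p) then ennreal ((norm (\<Sum>p. g p \<omega> *\<^sub>R v p))\<^sup>2) else 0) \<partial>M)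
    \<le> ennreal (\<Sum>p. (norm (v p))\<^sup>2)"
proof -
  have [measurable]: "g i \<in> borel_measurable M" for i using g by (simp add: orthonormal_rvs_def)
  let ?S = "\<lambda>n \<omega>. \<Sum>p<n. g p \<omega> *\<^sub>R v p"
  have "(\<integral>\<^sup>+\<omega>. (if summable (\<lambda>p. g p \<omega> *\<^sub>R v p) then ennreal ((norm (\<Sum>p. g p \<omega> *\<^sub>R v p))\<^sup>2) else 0) \<partial>M)
      \<le> (\<integral>\<^sup>+\<omega>. liminf (\<lambda>n. ennreal ((norm (?S n \<omega>))\<^sup>2)) \<partial>M)"
  proof (rule nn_integral_mono)
    fix \<omega>
    show "(if summable (\<lambda>p. g p \<omega> *\<^sub>R v p) then ennreal ((norm (\<Sum>p. g p \<omega> *\<^sub>R v p))\<^sup>2) else 0)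
      \<le> liminf (\<lambda>n. ennreal ((norm (?S n \<omega>))\<^sup>2))"
    proof (cases "summable (\<lambda>p. g p \<omega> *\<^sub>R v p)")
      case True
      then have "(\<lambda>n. ?S n \<omega>) \<longlonglongrightarrow> (\<Sum>p. g p \<omega> *\<^sub>R v p)" by (rule summable_LIMSEQ)
      then have "(\<lambda>n. ennreal ((norm (?S n \<omega>))\<^sup>2)) \<longlonglongrightarrow> ennreal ((norm (\<Sum>p. g p \<omega> *\<^sub>R v p))\<^sup>2)"
        by (intro tendsto_intros)
      from lim_imp_Liminf[OF _ this] True show ?thesis by simp
    qed simp
  qed
  also have "\<dots> \<le> liminf (\<lambda>n. \<integral>\<^sup>+\<omega>. ennreal ((norm (?S n \<omega>))\<^sup>2) \<partial>M)"
    by (rule nn_integral_liminf) measurable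
  also have "\<dots> \<le> liminf (\<lambda>n. ennreal (\<Sum>p. (norm (v p))\<^sup>2))"
  proof (rule Liminf_mono, rule always_eventually, rule allI)
    fix n
    have "(\<integral>\<^sup>+\<omega>. ennreal ((norm (?S n \<omega>))\<^sup>2) \<partial>M) = ennreal (\<Sum>p<n. (norm (v p))\<^sup>2)"
      using orthonormal_rvs_Pythagoras[OF g, of "{..<n}" v] by (subst nn_integral_eq_integral) auto
    also have "\<dots> \<le> ennreal (\<Sum>p. (norm (v p))\<^sup>2)" using v by (intro ennreal_leI sum_le_suminf) auto
    finally show "(\<integral>\<^sup>+\<omega>. ennreal ((norm (?S n \<omega>))\<^sup>2) \<partial>M) \<le> ennreal (\<Sum>p. (norm (v p))\<^sup>2)" .
  qed
  also have "\<dots> = ennreal (\<Sum>p. (norm (v p))\<^sup>2)" by (simp add: Liminf_const)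
  finally show ?thesis .
qed

lemma le_one_plus_square: "(t::real) \<le> 1 + t\<^sup>2"
  using zero_le_power2[of "t - 1 / 2"] by (simp add: power2_diff power_divide)

text \<open>
  Where the series diverges, the infinite sum is the fixed default vector \<open>THE s. False\<close>; together with
  the bound on the event of convergence this makes the norm integrable.
\<close>
lemma (in prob_space) integrable_norm_series:
  fixes v :: "nat \<Rightarrow> 'b::{real_inner, polish_space}"
  assumes g: "orthonormal_rvs M g" and v: "summable (\<lambda>p. (norm (v p))\<^sup>2)"
  shows "integrable M (\<lambda>\<omega>. norm (\<Sum>p. g p \<omega> *\<^sub>R v p))"
proof (rule integrableI_bounded)
  have [measurable]: "g i \<in> borel_measurable M" for i using g by (simp add: orthonormal_rvs_def)
  show "(\<lambda>\<omega>. norm (\<Sum>p. g p \<omega> *\<^sub>R v p)) \<in> borel_measurable M" by measurable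
  let ?d = "THE s :: 'b. False"
  let ?h = "\<lambda>\<omega>. if summable (\<lambda>p. g p \<omega> *\<^sub>R v p) then ennreal ((norm (\<Sum>p. g p \<omega> *\<^sub>R v p))\<^sup>2) else 0"
  have "(\<integral>\<^sup>+\<omega>. norm (norm (\<Sum>p. g p \<omega> *\<^sub>R v p)) \<partial>M) \<le> (\<integral>\<^sup>+\<omega>. ennreal (1 + norm ?d) + ?h \<omega> \<partial>M)"
  proof (rule nn_integral_mono)
    fix \<omega>
    show "ennreal (norm (norm (\<Sum>p. g p \<omega> *\<^sub>R v p))) \<le> ennreal (1 + norm ?d) + ?h \<omega>"
    proof (cases "summable (\<lambda>p. g p \<omega> *\<^sub>R v p)")
      case True
      let ?x = "norm (\<Sum>p. g p \<omega> *\<^sub>R v p)"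
      have "?x \<le> 1 + norm ?d + ?x\<^sup>2"
        using le_one_plus_square[of ?x] norm_ge_zero[of ?d] by linarith
      then have "ennreal ?x \<le> ennreal (1 + norm ?d + ?x\<^sup>2)" by (rule ennreal_leI)
      then show ?thesis using True by (simp add: ennreal_plus)
    next
      case False
      then have "(\<Sum>p. g p \<omega> *\<^sub>R v p) = ?d" by (auto simp: suminf_def summable_def)
      then show ?thesis using False by (simp add: ennreal_leI)
    qed
  qed
  also have "\<dots> = ennreal (1 + norm ?d) + (\<integral>\<^sup>+\<omega>. ?h \<omega> \<partial>M)"
  proof (subst nn_integral_add)
    have "{\<omega> \<in> space M. summable (\<lambda>p. g p \<omega> *\<^sub>R v p)} = {\<omega> \<in> space M. Cauchy (\<lambda>n. \<Sum>p<n. g p \<omega> *\<^sub>R v p)}"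
      by (simp add: summable_iff_convergent Cauchy_convergent_iff)
    also have "\<dots> \<in> sets M" by measurable
    finally have [measurable]: "Measurable.pred M (\<lambda>\<omega>. summable (\<lambda>p. g p \<omega> *\<^sub>R v p))" by (simp add: pred_def)
    show "?h \<in> borel_measurable M" by measurable
  qed (auto simp: emeasure_space_1)
  also have "\<dots> \<le> ennreal (1 + norm ?d) + ennreal (\<Sum>p. (norm (v p))\<^sup>2)"
    by (intro add_left_mono series_second_moment[OF g v])
  also have "\<dots> < \<infinity>" by simp
  finally show "(\<integral>\<^sup>+\<omega>. norm (norm (\<Sum>p. g p \<omega> *\<^sub>R v p)) \<partial>M) < \<infinity>" .
qed

text \<open>
  For a series along an orthonormal basis, convergence only requires square summable coefficients,
  and the expectation of the sum of squares is finite.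
\<close>
lemma (in orthonormal_basis) AE_summable_orthogonal_series:
  assumes g: "orthonormal_rvs M g" and c: "summable (\<lambda>p. (c p)\<^sup>2)"
  shows "AE \<omega> in M. summable (\<lambda>p. (g p \<omega> * c p) *\<^sub>R e p)"
proof -
  have [measurable]: "g i \<in> borel_measurable M" for i using g by (simp add: orthonormal_rvs_def)
  have "(\<integral>\<^sup>+\<omega>. (\<Sum>p. ennreal ((g p \<omega> * c p)\<^sup>2)) \<partial>M) = (\<Sum>p. \<integral>\<^sup>+\<omega>. ennreal ((g p \<omega> * c p)\<^sup>2) \<partial>M)"
    by (rule nn_integral_suminf) measurable
  also have "\<dots> = (\<Sum>p. ennreal ((c p)\<^sup>2))"
  proof (rule suminf_cong)
    fix p
    show "(\<integral>\<^sup>+\<omega>. ennreal ((g p \<omega> * c p)\<^sup>2) \<partial>M) = ennreal ((c p)\<^sup>2)"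
      using orthonormal_rvs_Pythagoras[OF g, of "{p}" c] by (subst nn_integral_eq_integral) (auto simp: abs_mult power_mult_distrib)
  qed
  also have "\<dots> \<noteq> \<infinity>" using c by (subst suminf_ennreal2) auto
  finally have "AE \<omega> in M. (\<Sum>p. ennreal ((g p \<omega> * c p)\<^sup>2)) \<noteq> \<infinity>"
    by (intro nn_integral_PInf_AE) measurable
  then show ?thesis
    by eventually_elim (intro summable_e summable_suminf_not_top, auto)
qed

section \<open>Increments of the Wiener processes\<close>

definition white_noise :: "(nat \<Rightarrow> real \<Rightarrow> 'w \<Rightarrow> real) \<Rightarrow> real \<Rightarrow> nat \<Rightarrow> 'w \<Rightarrow> nat \<Rightarrow> real" where
  "white_noise \<beta> h n \<omega> p = (\<beta> p (real (Suc n) * h) \<omega> - \<beta> p (real n * h) \<omega>) / sqrt h"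

definition gauss_seq :: "(nat \<Rightarrow> real) measure" where
  "gauss_seq = (\<Pi>\<^sub>M p\<in>UNIV. density lborel std_normal_density)"

lemma sets_gauss_seq [measurable_cong, simp]: "sets gauss_seq = sets (\<Pi>\<^sub>M p\<in>UNIV. borel)"
  unfolding gauss_seq_def by (rule sets_PiM_cong) auto

lemma space_gauss_seq [simp]: "space gauss_seq = UNIV"
  using sets_eq_imp_space_eq[OF sets_gauss_seq] by (simp add: space_PiM)

lemma prob_space_gauss_seq: "prob_space gauss_seq"
  unfolding gauss_seq_def by (intro prob_space_PiM prob_space_normal_density) simp

locale wiener_sequence = prob_space \<Omega> for \<Omega> :: "'w measure" +
  fixes \<beta> :: "nat \<Rightarrow> real \<Rightarrow> 'w \<Rightarrow> real" and h :: real
  assumes wiener: "indep_wiener \<Omega> \<beta>" and h_pos: "0 < h"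
begin

abbreviation \<gamma> :: "nat \<Rightarrow> 'w \<Rightarrow> nat \<Rightarrow> real" where
  "\<gamma> \<equiv> white_noise \<beta> h"

lemma white_noise_normal: "distributed \<Omega> lborel (\<lambda>\<omega>. \<gamma> n \<omega> p) std_normal_density"
proof -
  have "std_wiener \<Omega> (\<beta> p)" using wiener by (simp add: indep_wiener_def)
  then have inc: "\<And>s t. 0 \<le> s \<Longrightarrow> s < t \<Longrightarrow>
      distributed \<Omega> lborel (\<lambda>\<omega>. \<beta> p t \<omega> - \<beta> p s \<omega>) (normal_density 0 (sqrt (t - s)))"
    by (simp add: std_wiener_def)
  have "real (Suc n) * h - real n * h = h" by (simp add: algebra_simps)
  then have "distributed \<Omega> lborel (\<lambda>\<omega>. \<beta> p (real (Suc n) * h) \<omega> - \<beta> p (real n * h) \<omega>) (normal_density 0 (sqrt h))"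
    using inc[of "real n * h" "real (Suc n) * h"] h_pos by simp
  from normal_density_affine[OF this, of "1 / sqrt h" 0] h_pos
  show ?thesis by (simp add: white_noise_def)
qed

lemma white_noise_measurable [measurable]: "(\<lambda>\<omega>. \<gamma> n \<omega> p) \<in> borel_measurable \<Omega>"
  using distributed_measurable[OF white_noise_normal] by simp

lemma white_noise_distr: "distr \<Omega> borel (\<lambda>\<omega>. \<gamma> n \<omega> p) = density lborel std_normal_density"
  using distributed_distr_eq_density[OF white_noise_normal[of n p]]
  by (simp cong: distr_cong)

text \<open>
  The normalised increment as a functional of the whole path, so that statements about path-valued
  random variables can be transported to increments.
\<close>
definition path_increment :: "nat \<Rightarrow> (real \<Rightarrow> real) \<Rightarrow> real" where
  "path_increment n x = (x (real (Suc n) * h) - x (real n * h)) / sqrt h"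

lemma path_increment_measurable [measurable]: "path_increment n \<in> borel_measurable (\<Pi>\<^sub>M t\<in>{0..}. borel)"
proof -
  have "0 \<le> real n * h" for n using h_pos by simp
  then have [measurable]: "(\<lambda>x. x (real n * h)) \<in> borel_measurable (\<Pi>\<^sub>M t\<in>{0..}. borel)" for n
    by (intro measurable_component_singleton) simp
  show ?thesis unfolding path_increment_def[abs_def] by measurable
qed

lemma path_increment_path: "path_increment n (\<lambda>t\<in>{0..}. \<beta> p t \<omega>) = \<gamma> n \<omega> p"
  using h_pos by (simp add: path_increment_def white_noise_def)

lemma indep_paths: "indep_vars (\<lambda>_. \<Pi>\<^sub>M t\<in>{0..}. borel) (\<lambda>p \<omega>. \<lambda>t\<in>{0..}. \<beta> p t \<omega>) UNIV"
  using wiener by (simp add: indep_wiener_def)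

lemma indep_white_noise_coords: "indep_vars (\<lambda>_. borel) (\<lambda>p \<omega>. \<gamma> n \<omega> p) UNIV"
  using indep_vars_compose2[OF indep_paths, of "\<lambda>_. path_increment n" "\<lambda>_. borel"]
  by (simp add: path_increment_path)

lemma indep_white_noise_times: "indep_vars (\<lambda>_. borel) (\<lambda>n \<omega>. \<gamma> n \<omega> p) {..<K}"
proof -
  have "std_wiener \<Omega> (\<beta> p)" using wiener by (simp add: indep_wiener_def)
  then have "\<And>(n::nat) (\<tau>::nat \<Rightarrow> real). 0 \<le> \<tau> 0 \<Longrightarrow> mono \<tau> \<Longrightarrow>
        indep_vars (\<lambda>_. borel) (\<lambda>i \<omega>. \<beta> p (\<tau> (Suc i)) \<omega> - \<beta> p (\<tau> i) \<omega>) {..<n}"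
    by (simp add: std_wiener_def)
  from this[of "\<lambda>n. real n * h" K] h_pos
  have "indep_vars (\<lambda>_. borel) (\<lambda>i \<omega>. \<beta> p (real (Suc i) * h) \<omega> - \<beta> p (real i * h) \<omega>) {..<K}"
    by (simp add: monoI mult_right_mono)
  from indep_vars_compose2[OF this, of "\<lambda>_ x. x / sqrt h" "\<lambda>_. borel"]
  show ?thesis by (simp add: white_noise_def)
qed

text \<open>
  A finite family of events on increments \<open>(n, p)\<close> is grouped by the process \<open>p\<close>. Each group is an
  event on one path, so independence of the processes factorises over \<open>p\<close>, and independence of
  increments factorises each group over \<open>n\<close>.
\<close>
lemma indep_white_noise: "indep_vars (\<lambda>_. borel) (\<lambda>(n, p) \<omega>. \<gamma> n \<omega> p) UNIV"
  unfolding indep_vars_def2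
proof (intro conjI ballI indep_setsI)
  let ?g = "\<lambda>(n, p) \<omega>. \<gamma> n \<omega> p"
  have m: "?g j \<in> borel_measurable \<Omega>" for j by (cases j) simp
  then show "?g j \<in> borel_measurable \<Omega>" for j .
  show "{?g j -` A \<inter> space \<Omega> |A. A \<in> sets borel} \<subseteq> events" for j
    using measurable_sets[OF m[of j]] by blast
  fix A :: "nat \<times> nat \<Rightarrow> 'w set" and J
  assume J: "J \<noteq> {}" "finite J" and A: "\<forall>j\<in>J. A j \<in> {?g j -` A \<inter> space \<Omega> |A. A \<in> sets borel}"
  then have "\<forall>j\<in>J. \<exists>B. B \<in> sets borel \<and> A j = ?g j -` B \<inter> space \<Omega>" by blast
  then obtain B0 where B0: "\<And>j. j \<in> J \<Longrightarrow> B0 j \<in> sets borel \<and> A j = ?g j -` B0 j \<inter> space \<Omega>" by metis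
  \<comment> \<open>Padding with trivial events makes the index set a rectangle, as independence in time concerns initial segments.\<close>
  define B where "B j = (if j \<in> J then B0 j else UNIV)" for j
  define A' where "A' j = ?g j -` B j \<inter> space \<Omega>" for j
  have B: "B j \<in> sets borel" for j using B0 by (auto simp: B_def)
  have A': "A' j = (if j \<in> J then A j else space \<Omega>)" for j using B0 by (auto simp: A'_def B_def)
  obtain K where K: "fst ` J \<subseteq> {..<K}" using finite_nat_bounded[of "fst ` J"] J by auto
  define P where "P = snd ` J"
  have P: "finite P" "P \<noteq> {}" and K0: "{..<K} \<noteq> {}" using J K by (auto simp: P_def)
  have sub: "J \<subseteq> {..<K} \<times> P" using K by (force simp: P_def)
  let ?X = "\<lambda>p \<omega>. \<lambda>t\<in>{0..}. \<beta> p t \<omega>"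
  define C where "C p = {x \<in> space (\<Pi>\<^sub>M t\<in>{0..}. borel). \<forall>n\<in>{..<K}. path_increment n x \<in> B (n, p)}" for p
  have C: "C p \<in> sets (\<Pi>\<^sub>M t\<in>{0..}. borel)" for p
    unfolding C_def using B by measurable
  have XC: "?X p -` C p \<inter> space \<Omega> = (\<Inter>n\<in>{..<K}. A' (n, p))" for p
    using K0 by (auto simp: C_def A'_def path_increment_path space_PiM)
  have "(\<Inter>j\<in>J. A j) = (\<Inter>p\<in>P. \<Inter>n\<in>{..<K}. A' (n, p))"
  proof
    have "A j \<subseteq> space \<Omega>" if "j \<in> J" for j using B0[OF that] by auto
    then show "(\<Inter>j\<in>J. A j) \<subseteq> (\<Inter>p\<in>P. \<Inter>n\<in>{..<K}. A' (n, p))"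
      using J(1) by (auto simp: A')
    show "(\<Inter>p\<in>P. \<Inter>n\<in>{..<K}. A' (n, p)) \<subseteq> (\<Inter>j\<in>J. A j)"
      using sub by (fastforce simp: A')
  qed
  then have "prob (\<Inter>j\<in>J. A j) = prob (\<Inter>p\<in>P. ?X p -` C p \<inter> space \<Omega>)" by (simp only: XC)
  also have "\<dots> = (\<Prod>p\<in>P. prob (?X p -` C p \<inter> space \<Omega>))"
    by (rule indep_varsD[OF indep_paths P(2,1)]) (use C in auto)
  also have "\<dots> = (\<Prod>p\<in>P. \<Prod>n\<in>{..<K}. prob (A' (n, p)))"
  proof (rule prod.cong[OF refl])
    fix p
    have "prob (\<Inter>n\<in>{..<K}. (\<lambda>\<omega>. \<gamma> n \<omega> p) -` B (n, p) \<inter> space \<Omega>)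
        = (\<Prod>n\<in>{..<K}. prob ((\<lambda>\<omega>. \<gamma> n \<omega> p) -` B (n, p) \<inter> space \<Omega>))"
      by (rule indep_varsD[OF indep_white_noise_times[of p K] K0]) (use B in auto)
    then show "prob (?X p -` C p \<inter> space \<Omega>) = (\<Prod>n\<in>{..<K}. prob (A' (n, p)))"
      unfolding XC by (simp add: A'_def)
  qed
  also have "\<dots> = (\<Prod>j\<in>{..<K} \<times> P. prob (A' j))"
    by (subst prod.swap) (simp add: prod.cartesian_product)
  also have "\<dots> = (\<Prod>j\<in>J. prob (A' j))"
    using sub P by (intro prod.mono_neutral_right) (auto simp: A' prob_space)
  also have "\<dots> = (\<Prod>j\<in>J. prob (A j))" by (simp add: A')
  finally show "prob (\<Inter>j\<in>J. A j) = (\<Prod>j\<in>J. prob (A j))" .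
qed

lemma white_noise_orthonormal: "orthonormal_rvs \<Omega> (\<lambda>(n, p) \<omega>. \<gamma> n \<omega> p)"
  using indep_white_noise by (rule indep_normal_orthonormal) (auto intro: white_noise_normal)

lemma white_noise_orthonormal_coords: "orthonormal_rvs \<Omega> (\<lambda>p \<omega>. \<gamma> n \<omega> p)"
  using orthonormal_rvs_reindex[OF white_noise_orthonormal, of "\<lambda>p. (n, p)"] by (simp add: inj_on_def)

lemma white_noise_orthonormal_times: "orthonormal_rvs \<Omega> (\<lambda>n \<omega>. \<gamma> n \<omega> p)"
  using orthonormal_rvs_reindex[OF white_noise_orthonormal, of "\<lambda>n. (n, p)"] by (simp add: inj_on_def)

lemma white_noise_seq_measurable [measurable]: "\<gamma> n \<in> \<Omega> \<rightarrow>\<^sub>M gauss_seq"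
proof -
  have "(\<lambda>\<omega> p. \<gamma> n \<omega> p) \<in> \<Omega> \<rightarrow>\<^sub>M (\<Pi>\<^sub>M p\<in>UNIV. borel)"
    by (rule measurable_PiM_single') (auto simp: space_PiM)
  then show ?thesis by (simp cong: measurable_cong_sets)
qed

lemma white_noise_law: "distr \<Omega> gauss_seq (\<gamma> n) = gauss_seq"
proof -
  have "distr \<Omega> gauss_seq (\<gamma> n) = distr \<Omega> (\<Pi>\<^sub>M p\<in>UNIV. borel) (\<lambda>\<omega>. \<lambda>p\<in>UNIV. \<gamma> n \<omega> p)"
    by (intro distr_cong) auto
  also have "\<dots> = (\<Pi>\<^sub>M p\<in>UNIV. distr \<Omega> borel (\<lambda>\<omega>. \<gamma> n \<omega> p))"
    using indep_white_noise_coords[of n] by (subst (asm) indep_vars_iff_distr_eq_PiM') auto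
  finally show ?thesis by (simp add: white_noise_distr gauss_seq_def)
qed

text \<open>
  Splitting the doubly indexed independent family into the blocks \<open>{n} \<times> UNIV\<close>.
\<close>
lemma indep_white_noise_seq: "indep_vars (\<lambda>_. gauss_seq) \<gamma> UNIV"
proof -
  let ?K = "\<lambda>n::nat. {n} \<times> (UNIV :: nat set)"
  have "indep_vars (\<lambda>n. PiM (?K n) (\<lambda>_. borel)) (\<lambda>n \<omega>. \<lambda>j\<in>?K n. (case j of (n, p) \<Rightarrow> \<lambda>\<omega>. \<gamma> n \<omega> p) \<omega>) UNIV"
    by (rule indep_vars_restrict[OF indep_white_noise]) (auto simp: disjoint_family_on_def)
  from indep_vars_compose2[OF this, of "\<lambda>n x p. x (n, p)" "\<lambda>_. gauss_seq"]
  show ?thesis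
  proof (rule back_subst[of "\<lambda>X. indep_vars (\<lambda>_. gauss_seq) X UNIV"])
    show "(\<lambda>x p. x (n, p)) \<in> PiM (?K n) (\<lambda>_. borel) \<rightarrow>\<^sub>M gauss_seq" for n
    proof -
      have "(\<lambda>x p. x (n, p)) \<in> PiM (?K n) (\<lambda>_. borel) \<rightarrow>\<^sub>M (\<Pi>\<^sub>M p\<in>UNIV. (borel :: real measure))"
        by (rule measurable_PiM_single') (auto simp: space_PiM intro!: measurable_component_singleton)
      then show ?thesis by (simp cong: measurable_cong_sets)
    qed
  qed (auto simp: fun_eq_iff)
qed

end

section \<open>The scheme as a random contraction\<close>

lemma one_plus_le_square:
  fixes k x :: real
  assumes "0 \<le> x" "1 \<le> 2 * k"
  shows "1 + x \<le> (1 + k * x)\<^sup>2"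
proof -
  have "1 * x \<le> (2 * k) * x" using assms by (intro mult_right_mono) auto
  then have "1 + x \<le> 1 + 2 * k * x + (k * x)\<^sup>2" using zero_le_power2[of "k * x"] by linarith
  then show ?thesis by (simp add: power2_sum)
qed

lemma lip_const_lipschitz:
  fixes F :: "'a::real_normed_vector \<Rightarrow> 'a"
  assumes K: "K-lipschitz_on UNIV F" and nz: "(x :: 'a) \<noteq> 0"
  shows "(lip_const F)-lipschitz_on UNIV F"
proof -
  let ?S = "{norm (F u - F v) / norm (u - v) |u v. u \<noteq> v}"
  have "norm (F u - F v) / norm (u - v) \<le> K" if "u \<noteq> v" for u v
    using lipschitz_onD[OF K, of u v] that by (simp add: dist_norm divide_le_eq)
  then have bdd: "bdd_above ?S" by (intro bdd_aboveI[of _ K]) auto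
  have upper: "norm (F u - F v) / norm (u - v) \<le> lip_const F" if "u \<noteq> v" for u v
    unfolding lip_const_def using that by (intro cSup_upper[OF _ bdd]) auto
  show ?thesis
  proof (rule lipschitz_onI)
    show "dist (F u) (F v) \<le> lip_const F * dist u v" for u v
      using upper[of u v] by (cases "u = v") (auto simp: dist_norm divide_le_eq)
    have "0 \<le> norm (F x - F 0) / norm (x - 0)" by simp
    also have "\<dots> \<le> lip_const F" using nz by (rule upper)
    finally show "0 \<le> lip_const F" .
  qed
qed

text \<open>
  The fixed point of the recursion \<open>(1 + h l) m' = (1 + h L) m + h K\<close>, independent of \<open>h\<close>, for the forcing
  \<open>K\<close> in the numerator. Here \<open>1 + t\<close> is a bound for the first moments of the stochastic convolution and
  of the scaled noise.
\<close>
definition drift_bound :: "('a::real_normed_vector \<Rightarrow> 'a) \<Rightarrow> real \<Rightarrow> real \<Rightarrow> real \<Rightarrow> real" where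
  "drift_bound F L l t = (norm (F 0) + L * (1 + t) + L / 2 * (1 + t)) / (l - L)"

locale dissipative_scheme = diagonal_covariance e D A lam Q q + wiener_sequence \<Omega> \<beta> h
  for e :: "nat \<Rightarrow> 'a::{real_inner, polish_space}" and D A lam Q q
    and \<Omega> :: "'w measure" and \<beta> h +
  fixes F :: "'a \<Rightarrow> 'a" and L :: real and J3 :: "'a \<Rightarrow> 'a"
  assumes F_lip: "L-lipschitz_on UNIV F" and L_less: "L < lam 0"
    and J3: "is_J3 D A Q h J3"
begin

abbreviation \<kappa> :: real where "\<kappa> \<equiv> (3 - sqrt 2) / 2"
abbreviation \<alpha> :: real where "\<alpha> \<equiv> (sqrt 2 - 1) / 2"

abbreviation R :: "'a \<Rightarrow> 'a" where "R \<equiv> J1 D A h"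

definition noise_series :: "('a \<Rightarrow> 'a) \<Rightarrow> (nat \<Rightarrow> real) \<Rightarrow> 'a" where
  "noise_series J g = (\<Sum>p. (sqrt (q p) * g p) *\<^sub>R J (e p))"

abbreviation W :: "(nat \<Rightarrow> real) \<Rightarrow> 'a" where "W \<equiv> noise_series (J2 D A h)"

text \<open>
  Written as functions of the Gaussian sequence \<open>g\<close> of one time step, the scheme and the postprocessor
  become random maps on the canonical noise space \<open>gauss_seq\<close>, the same for all time steps.
\<close>
definition step :: "(nat \<Rightarrow> real) \<Rightarrow> 'a \<Rightarrow> 'a" where
  "step g x = R (x + h *\<^sub>R F (x + (1 / 2 * sqrt h) *\<^sub>R W g) + (\<alpha> * sqrt h) *\<^sub>R W g) + (\<kappa> * sqrt h) *\<^sub>R W g"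

definition observe :: "(nat \<Rightarrow> real) \<Rightarrow> 'a \<Rightarrow> 'a" where
  "observe g x = x + (1 / 2 * sqrt h) *\<^sub>R noise_series J3 g"

definition \<rho> :: real where "\<rho> = (1 + h * L) / (1 + h * lam 0)"

lemma noise_eq: "noise e q \<beta> h J n \<omega> = noise_series J (\<gamma> n \<omega>)"
  by (simp add: noise_def noise_series_def white_noise_def)

lemma post_u_Suc: "post_u D A F e q \<beta> h u0 (Suc n) \<omega> = step (\<gamma> n \<omega>) (post_u D A F e q \<beta> h u0 n \<omega>)"
  by (simp add: Let_def step_def noise_eq)

lemma post_ubar_eq: "post_ubar D A F e q \<beta> h J3 u0 n \<omega> = observe (\<gamma> n \<omega>) (post_u D A F e q \<beta> h u0 n \<omega>)"
  by (simp add: post_ubar_def observe_def noise_eq)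

lemma L_nonneg: "0 \<le> L" using F_lip lipschitz_on_nonneg by blast

lemma kappa_bounds: "1 \<le> 2 * \<kappa>" "0 < \<kappa>" "0 < \<alpha>"
  using real_less_rsqrt[of 1 2] real_less_lsqrt[of 2 2] by auto

lemma R_bounded_linear: "bounded_linear R"
  unfolding J1_def using h_pos by (rule bounded_linear_resolvent)

lemma R_coord: "inner (R x) (e p) = inner x (e p) / (1 + h * lam p)"
  unfolding J1_def using h_pos by (rule resolvent_coord)

lemma norm_R_le: "norm (R x) \<le> norm x / (1 + h * lam 0)"
  unfolding J1_def using h_pos by (rule norm_resolvent_le)

lemma denom_gt_1: "1 < 1 + h * lam p" using h_pos lam_pos by simp

lemma norm_R_le': "norm (R x) \<le> norm x"
proof -
  have "norm x / (1 + h * lam 0) \<le> norm x / 1" using denom_gt_1[of 0] by (intro divide_left_mono) auto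
  with norm_R_le[of x] show ?thesis by simp
qed

lemma measurable_R [measurable]: "R \<in> borel_measurable borel"
  by (intro borel_measurable_continuous_onI linear_continuous_on R_bounded_linear)

lemma measurable_F [measurable]: "F \<in> borel_measurable borel"
  by (intro borel_measurable_continuous_onI lipschitz_on_continuous_on[OF F_lip])

lemma gauss_coord_measurable: "(\<lambda>g. g p) \<in> borel_measurable gauss_seq"
proof -
  have "(\<lambda>g. g p) \<in> (\<Pi>\<^sub>M p\<in>UNIV. borel) \<rightarrow>\<^sub>M (borel :: real measure)"
    by (rule measurable_component_singleton) simp
  then show ?thesis by (simp cong: measurable_cong_sets)
qed

lemma noise_series_measurable [measurable]: "noise_series J \<in> borel_measurable gauss_seq"
proof -
  note [measurable] = gauss_coord_measurable
  show ?thesis unfolding noise_series_def[abs_def] by measurable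
qed

lemma J2_e: "J2 D A h (e p) = (1 / (1 + \<kappa> * h * lam p)) *\<^sub>R e p"
  unfolding J2_def using h_pos kappa_bounds by (intro resolvent_e) simp

lemma kappa_denom_gt_1: "1 < 1 + \<kappa> * h * lam p"
  using mult_pos_pos[OF mult_pos_pos[OF kappa_bounds(2) h_pos] lam_pos[of p]] by simp

lemma J2_summable: "summable (\<lambda>p. q p * (norm (J2 D A h (e p)))\<^sup>2)"
proof (rule summable_comparison_test)
  show "summable (\<lambda>p. q p / (1 + (\<kappa> * h) * lam p))"
    using h_pos kappa_bounds by (intro resolvent_trace_summable) simp
  have "q p * (norm (J2 D A h (e p)))\<^sup>2 \<le> q p / (1 + (\<kappa> * h) * lam p)" for p
  proof -
    let ?d = "1 + \<kappa> * h * lam p"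
    have d: "1 < ?d" by (rule kappa_denom_gt_1)
    have "(norm (J2 D A h (e p)))\<^sup>2 = 1 / ?d / ?d"
      using d by (simp add: J2_e power2_eq_square)
    also have "\<dots> \<le> 1 / ?d / 1" using d by (intro divide_left_mono) auto
    finally show ?thesis using mult_left_mono[OF _ q_nonneg[of p]] by fastforce
  qed
  then show "\<exists>N. \<forall>p\<ge>N. norm (q p * (norm (J2 D A h (e p)))\<^sup>2) \<le> q p / (1 + (\<kappa> * h) * lam p)"
    using q_nonneg by (auto simp: abs_mult)
qed

lemma noise_series_integrable:
  assumes "summable (\<lambda>p. q p * (norm (J (e p)))\<^sup>2)"
  shows "integrable gauss_seq (\<lambda>g. norm (noise_series J g))"
proof -
  have "summable (\<lambda>p. (norm (sqrt (q p) *\<^sub>R J (e p)))\<^sup>2)"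
    using assms q_nonneg by (simp add: power_mult_distrib)
  from integrable_norm_series[OF white_noise_orthonormal_coords[of 0] this]
  have "integrable \<Omega> (\<lambda>\<omega>. norm (noise_series J (\<gamma> 0 \<omega>)))"
    by (simp add: noise_series_def mult.commute)
  then have "integrable (distr \<Omega> gauss_seq (\<gamma> 0)) (\<lambda>g. norm (noise_series J g))"
    by (subst integrable_distr_eq) auto
  then show ?thesis by (simp add: white_noise_law)
qed

lemma norm_F_le: "norm (F x) \<le> norm (F 0) + L * norm x"
  using lipschitz_onD[OF F_lip, of x 0] norm_triangle_sub[of "F x" "F 0"] by (simp add: dist_norm)

sublocale chain: observed_contraction gauss_seq step \<rho> 0 observe 0
proof -
  interpret R: bounded_linear R by (rule R_bounded_linear)
  interpret G: prob_space gauss_seq by (rule prob_space_gauss_seq)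
  show "observed_contraction gauss_seq step \<rho> 0 observe 0"
  proof unfold_locales
    show "(\<lambda>(s, x). step s x) \<in> borel_measurable (gauss_seq \<Otimes>\<^sub>M borel)"
      unfolding step_def by measurable
    show "(\<lambda>(s, x). observe s x) \<in> borel_measurable (gauss_seq \<Otimes>\<^sub>M borel)"
      unfolding observe_def by measurable
    show "0 \<le> \<rho>" using L_nonneg h_pos denom_gt_1[of 0] by (simp add: \<rho>_def)
    show "\<rho> < 1" using L_less h_pos denom_gt_1[of 0] by (simp add: \<rho>_def)
    show "dist (observe s x) (observe s y) \<le> dist x y" for s x y by (simp add: observe_def)
    show "dist (step s x) (step s y) \<le> \<rho> * dist x y" for s x y
    proof -
      let ?w = "(1 / 2 * sqrt h) *\<^sub>R W s"
      \<comment> \<open>The noise outside of F is the same for both states and cancels.\<close>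
      have "step s x - step s y = R ((x - y) + h *\<^sub>R (F (x + ?w) - F (y + ?w)))"
        by (simp add: step_def R.add R.diff R.scaleR scaleR_diff_right)
      then have "dist (step s x) (step s y) \<le> norm ((x - y) + h *\<^sub>R (F (x + ?w) - F (y + ?w))) / (1 + h * lam 0)"
        using norm_R_le by (simp add: dist_norm)
      also have "\<dots> \<le> (1 + h * L) * dist x y / (1 + h * lam 0)"
      proof (rule divide_right_mono)
        have "norm ((x - y) + h *\<^sub>R (F (x + ?w) - F (y + ?w))) \<le> norm (x - y) + h * norm (F (x + ?w) - F (y + ?w))"
          using norm_triangle_ineq[of "x - y" "h *\<^sub>R (F (x + ?w) - F (y + ?w))"] h_pos by simp
        also have "norm (F (x + ?w) - F (y + ?w)) \<le> L * norm (x - y)"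
          using lipschitz_onD[OF F_lip, of "x + ?w" "y + ?w"] by (simp add: dist_norm)
        finally show "norm ((x - y) + h *\<^sub>R (F (x + ?w) - F (y + ?w))) \<le> (1 + h * L) * dist x y"
          using h_pos by (simp add: dist_norm algebra_simps)
      qed (use denom_gt_1[of 0] in simp)
      finally show ?thesis by (simp add: \<rho>_def)
    qed
    show "integrable gauss_seq (\<lambda>s. dist (observe s 0) 0)"
      using noise_series_integrable[OF is_J3_summable[OF J3 h_pos]] h_pos by (simp add: observe_def)
    show "integrable gauss_seq (\<lambda>s. dist (step s 0) 0)"
    proof (rule Bochner_Integration.integrable_bound)
      let ?b = "\<lambda>s. h * norm (F 0) + (h * L * (1 / 2 * sqrt h) + \<alpha> * sqrt h + \<kappa> * sqrt h) * norm (W s)"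
      show "integrable gauss_seq ?b"
        using noise_series_integrable[OF J2_summable] by simp
      show "(\<lambda>s. dist (step s 0) 0) \<in> borel_measurable gauss_seq" unfolding step_def by measurable
      have "norm (step s 0) \<le> ?b s" for s
      proof -
        have nonneg: "0 \<le> \<alpha> * sqrt h" "0 \<le> \<kappa> * sqrt h" using h_pos kappa_bounds by simp_all
        have "norm (step s 0) \<le> norm (R (h *\<^sub>R F ((1 / 2 * sqrt h) *\<^sub>R W s) + (\<alpha> * sqrt h) *\<^sub>R W s)) + norm ((\<kappa> * sqrt h) *\<^sub>R W s)"
          unfolding step_def add_0_left by (rule norm_triangle_ineq)
        also have "\<dots> \<le> norm (h *\<^sub>R F ((1 / 2 * sqrt h) *\<^sub>R W s) + (\<alpha> * sqrt h) *\<^sub>R W s) + norm ((\<kappa> * sqrt h) *\<^sub>R W s)"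
          by (intro add_right_mono norm_R_le')
        also have "\<dots> \<le> norm (h *\<^sub>R F ((1 / 2 * sqrt h) *\<^sub>R W s)) + norm ((\<alpha> * sqrt h) *\<^sub>R W s) + norm ((\<kappa> * sqrt h) *\<^sub>R W s)"
          by (intro add_right_mono norm_triangle_ineq)
        also have "\<dots> = h * norm (F ((1 / 2 * sqrt h) *\<^sub>R W s)) + (\<alpha> * sqrt h) * norm (W s) + (\<kappa> * sqrt h) * norm (W s)"
          using h_pos nonneg by (simp only: norm_scaleR abs_of_nonneg abs_of_pos)
        also have "\<dots> \<le> h * (norm (F 0) + L * norm ((1 / 2 * sqrt h) *\<^sub>R W s)) + (\<alpha> * sqrt h) * norm (W s) + (\<kappa> * sqrt h) * norm (W s)"
          using h_pos by (intro add_right_mono mult_left_mono norm_F_le) simp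
        also have "\<dots> = ?b s" using h_pos by (simp add: algebra_simps)
        finally show ?thesis .
      qed
      then show "AE s in gauss_seq. norm (dist (step s 0) 0) \<le> norm (?b s)"
        by (intro always_eventually allI) (smt (verit) dist_norm diff_zero norm_ge_zero real_norm_def)
    qed
  qed
qed

lemma post_kernel_eq: "post_kernel \<Omega> D A F e q \<beta> h J3 = chain.pair_kernel"
proof
  fix z
  have "chain.pair_kernel z = distr (distr \<Omega> gauss_seq (\<gamma> 0)) borel (\<lambda>s. (step s (fst z), observe s (fst z)))"
    by (simp add: chain.pair_kernel_def white_noise_law)
  also have "\<dots> = distr \<Omega> borel (\<lambda>\<omega>. (step (\<gamma> 0 \<omega>) (fst z), observe (\<gamma> 0 \<omega>) (fst z)))"
    by (subst distr_distr) (auto simp: comp_def)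
  also have "\<dots> = post_kernel \<Omega> D A F e q \<beta> h J3 z"
  proof -
    have "post_chain D A F e q \<beta> h J3 z 1 = (\<lambda>\<omega>. (step (\<gamma> 0 \<omega>) (fst z), observe (\<gamma> 0 \<omega>) (fst z)))"
      by (rule ext) (simp add: post_chain_def post_ubar_eq post_u_Suc del: post_u.simps(2))
    then show ?thesis by (simp only: post_kernel_def)
  qed
  finally show "post_kernel \<Omega> D A F e q \<beta> h J3 z = chain.pair_kernel z" by simp
qed

lemmas driven = prob_space_axioms indep_white_noise_seq white_noise_law


section \<open>A moment bound uniform in the time step\<close>

abbreviation \<tau> :: real where "\<tau> \<equiv> (\<Sum>p. q p / lam p)"

text \<open>
  Parseval reduces the second moment of the norm to those of the coordinates.
\<close>
lemma norm_expectation_le: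
  assumes [measurable]: "X \<in> borel_measurable \<Omega>"
    and X: "\<And>p. (\<integral>\<^sup>+\<omega>. ennreal ((inner (X \<omega>) (e p))\<^sup>2) \<partial>\<Omega>) \<le> ennreal (q p / lam p)"
  shows "integrable \<Omega> (\<lambda>\<omega>. norm (X \<omega>))" "expectation (\<lambda>\<omega>. norm (X \<omega>)) \<le> 1 + \<tau>"
proof -
  have nn: "0 \<le> q p / lam p" for p using q_nonneg lam_pos by (simp add: less_imp_le)
  have \<tau>: "0 \<le> \<tau>" using summable_q_lam nn by (rule suminf_nonneg)
  have "(\<integral>\<^sup>+\<omega>. ennreal (norm (X \<omega>)) \<partial>\<Omega>) \<le> (\<integral>\<^sup>+\<omega>. 1 + (\<Sum>p. ennreal ((inner (X \<omega>) (e p))\<^sup>2)) \<partial>\<Omega>)"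
  proof (rule nn_integral_mono)
    fix \<omega>
    have "ennreal (norm (X \<omega>)) \<le> ennreal (1 + (norm (X \<omega>))\<^sup>2)"
      by (intro ennreal_leI le_one_plus_square)
    also have "\<dots> = 1 + ennreal ((norm (X \<omega>))\<^sup>2)" by simp
    also have "ennreal ((norm (X \<omega>))\<^sup>2) = (\<Sum>p. ennreal ((inner (X \<omega>) (e p))\<^sup>2))"
      using Parseval_norm[of "X \<omega>"] by (subst suminf_ennreal2) (auto simp: sums_iff)
    finally show "ennreal (norm (X \<omega>)) \<le> 1 + (\<Sum>p. ennreal ((inner (X \<omega>) (e p))\<^sup>2))" .
  qed
  also have "\<dots> = 1 + (\<Sum>p. \<integral>\<^sup>+\<omega>. ennreal ((inner (X \<omega>) (e p))\<^sup>2) \<partial>\<Omega>)"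
    by (simp add: nn_integral_add nn_integral_suminf emeasure_space_1)
  also have "\<dots> \<le> 1 + (\<Sum>p. ennreal (q p / lam p))"
    by (intro add_left_mono suminf_le X) auto
  also have "\<dots> = ennreal (1 + \<tau>)"
    using nn \<tau> summable_q_lam by (subst suminf_ennreal2) auto
  finally have le: "(\<integral>\<^sup>+\<omega>. ennreal (norm (X \<omega>)) \<partial>\<Omega>) \<le> ennreal (1 + \<tau>)" .
  show int: "integrable \<Omega> (\<lambda>\<omega>. norm (X \<omega>))"
    by (rule integrableI_bounded) (use le in \<open>auto simp: le_less_trans[OF le ennreal_less_top]\<close>)
  show "expectation (\<lambda>\<omega>. norm (X \<omega>)) \<le> 1 + \<tau>"
    using le \<tau> unfolding nn_integral_eq_integral[OF int AE_I2[OF norm_ge_zero]]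
    by (subst (asm) ennreal_le_iff) simp_all
qed

text \<open>
  Almost surely the noise series converges for all time steps, so its coordinates may be read off
  termwise. They are centred, which is essential for a bound uniform in \<open>h\<close>.
\<close>
lemma AE_W_coord: "AE \<omega> in \<Omega>. \<forall>n p. inner (W (\<gamma> n \<omega>)) (e p) = \<gamma> n \<omega> p * (sqrt (q p) / (1 + \<kappa> * h * lam p))"
proof -
  let ?c = "\<lambda>p. sqrt (q p) / (1 + \<kappa> * h * lam p)"
  have "(?c p)\<^sup>2 = q p * (norm (J2 D A h (e p)))\<^sup>2" for p
    using kappa_denom_gt_1[of p] q_nonneg[of p] by (simp add: J2_e power_divide)
  then have "summable (\<lambda>p. (?c p)\<^sup>2)" using J2_summable by simp
  then have "AE \<omega> in \<Omega>. summable (\<lambda>p. (\<gamma> n \<omega> p * ?c p) *\<^sub>R e p)" for n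
    by (rule AE_summable_orthogonal_series[OF white_noise_orthonormal_coords])
  then have "AE \<omega> in \<Omega>. \<forall>n. summable (\<lambda>p. (\<gamma> n \<omega> p * ?c p) *\<^sub>R e p)"
    unfolding AE_all_countable ..
  then show ?thesis
  proof eventually_elim
    case (elim \<omega>)
    have "W (\<gamma> n \<omega>) = (\<Sum>p. (\<gamma> n \<omega> p * ?c p) *\<^sub>R e p)" for n
      by (simp add: noise_series_def J2_e ac_simps)
    then show ?case using elim inner_suminf_e by simp
  qed
qed

lemma white_noise_combination:
  assumes "finite I"
  shows "(\<integral>\<^sup>+\<omega>. ennreal ((\<Sum>k\<in>I. \<gamma> k \<omega> p * a k)\<^sup>2) \<partial>\<Omega>) = ennreal (\<Sum>k\<in>I. (a k)\<^sup>2)"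
  using orthonormal_rvs_Pythagoras[OF white_noise_orthonormal_times assms, of p a]
  by (subst nn_integral_eq_integral) auto

lemma W_moment:
  shows "integrable \<Omega> (\<lambda>\<omega>. norm (sqrt h *\<^sub>R W (\<gamma> n \<omega>)))" "expectation (\<lambda>\<omega>. norm (sqrt h *\<^sub>R W (\<gamma> n \<omega>))) \<le> 1 + \<tau>"
proof -
  let ?X = "\<lambda>\<omega>. sqrt h *\<^sub>R W (\<gamma> n \<omega>)"
  have m: "?X \<in> borel_measurable \<Omega>" by measurable
  have "(\<integral>\<^sup>+\<omega>. ennreal ((inner (?X \<omega>) (e p))\<^sup>2) \<partial>\<Omega>) \<le> ennreal (q p / lam p)" for p
  proof -
    let ?c = "sqrt h * (sqrt (q p) / (1 + \<kappa> * h * lam p))"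
    have "(\<integral>\<^sup>+\<omega>. ennreal ((inner (?X \<omega>) (e p))\<^sup>2) \<partial>\<Omega>) = (\<integral>\<^sup>+\<omega>. ennreal ((\<Sum>k\<in>{n}. \<gamma> k \<omega> p * ?c)\<^sup>2) \<partial>\<Omega>)"
      using AE_W_coord by (intro nn_integral_cong_AE) (auto elim!: eventually_mono simp: ac_simps)
    also have "\<dots> = ennreal (?c\<^sup>2)" by (subst white_noise_combination) auto
    also have "\<dots> \<le> ennreal (q p / lam p)"
    proof (rule ennreal_leI)
      let ?x = "h * lam p"
      have x: "0 < ?x" using h_pos lam_pos by simp
      have "?x \<le> (1 + \<kappa> * h * lam p)\<^sup>2"
        using one_plus_le_square[OF less_imp_le[OF x] kappa_bounds(1)] unfolding mult.assoc by linarith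
      moreover have "0 < (1 + \<kappa> * h * lam p)\<^sup>2"
        using kappa_denom_gt_1[of p] by (intro zero_less_power) linarith
      ultimately have "h * q p / (1 + \<kappa> * h * lam p)\<^sup>2 \<le> h * q p / ?x"
        using x h_pos q_nonneg[of p] lam_pos[of p] by (intro divide_left_mono mult_pos_pos) auto
      then show "?c\<^sup>2 \<le> q p / lam p"
        using h_pos q_nonneg[of p] by (simp add: power_mult_distrib power_divide)
    qed
    finally show ?thesis .
  qed
  from norm_expectation_le[OF m this] show "integrable \<Omega> (\<lambda>\<omega>. norm (sqrt h *\<^sub>R W (\<gamma> n \<omega>)))"
    "expectation (\<lambda>\<omega>. norm (sqrt h *\<^sub>R W (\<gamma> n \<omega>))) \<le> 1 + \<tau>" by auto
qed

text \<open>
  The scheme with \<open>F = 0\<close> and initial value \<open>0\<close>.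
\<close>
primrec stoch_conv :: "nat \<Rightarrow> 'w \<Rightarrow> 'a" where
  "stoch_conv 0 \<omega> = 0"
| "stoch_conv (Suc n) \<omega> = R (stoch_conv n \<omega> + (\<alpha> * sqrt h) *\<^sub>R W (\<gamma> n \<omega>)) + (\<kappa> * sqrt h) *\<^sub>R W (\<gamma> n \<omega>)"

lemma stoch_conv_measurable [measurable]: "stoch_conv n \<in> borel_measurable \<Omega>"
  by (induction n) (simp_all, measurable)

text \<open>
  The coordinate \<open>p\<close> of the stochastic convolution is an autoregressive process with factor \<open>a\<close> and noise
  intensity \<open>b\<close>, whose variance is at most \<open>b\<^sup>2 / (1 - a)\<close>. With \<open>x = h \<lambda>\<^sub>p\<close> one has \<open>1 - a = x / (1 + x)\<close>
  and \<open>b\<^sup>2 \<le> h q\<^sub>p / (1 + \<kappa> x)\<^sup>2\<close> because \<open>\<alpha> + \<kappa> = 1\<close>. The factor \<open>(1 + x) / (1 + \<kappa> x)\<^sup>2\<close> is at most \<open>1\<close> because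
  \<open>2 \<kappa> \<ge> 1\<close>; what remains is \<open>h q\<^sub>p / x = q\<^sub>p / \<lambda>\<^sub>p\<close>.
\<close>
lemma stoch_conv_coord_bound:
  fixes p defines "a \<equiv> 1 / (1 + h * lam p)"
  defines "b \<equiv> sqrt h * (sqrt (q p) / (1 + \<kappa> * h * lam p)) * (\<alpha> * a + \<kappa>)"
  shows "(\<Sum>k<n. (a ^ (n - Suc k) * b)\<^sup>2) \<le> q p / lam p"
proof -
  let ?x = "h * lam p" and ?d = "1 + \<kappa> * h * lam p"
  have x: "0 < ?x" using h_pos lam_pos by simp
  have a: "0 < a" "a < 1" using denom_gt_1[of p] by (auto simp: a_def)
  have d: "1 < ?d" by (rule kappa_denom_gt_1)
  have a2: "a\<^sup>2 \<le> a" "a\<^sup>2 < 1" using a power_le_one[of a 1] by (auto simp: power2_eq_square mult_le_one intro: mult_left_le less_trans[of _ a])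
  have "(\<Sum>k<n. (a ^ (n - Suc k) * b)\<^sup>2) = b\<^sup>2 * (\<Sum>k<n. (a\<^sup>2) ^ (n - Suc k))"
    by (simp add: sum_distrib_left power_mult_distrib mult.commute flip: power_mult)
  also have "(\<Sum>k<n. (a\<^sup>2) ^ (n - Suc k)) = (\<Sum>k<n. (a\<^sup>2) ^ k)" by (rule sum.nat_diff_reindex)
  also have "b\<^sup>2 * (\<Sum>k<n. (a\<^sup>2) ^ k) \<le> b\<^sup>2 * (1 / (1 - a))"
  proof (rule mult_left_mono)
    have "(\<Sum>k<n. (a\<^sup>2) ^ k) \<le> (\<Sum>k. (a\<^sup>2) ^ k)"
      using a2 by (intro sum_le_suminf summable_geometric) auto
    also have "\<dots> = 1 / (1 - a\<^sup>2)" using a2 by (intro suminf_geometric) simp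
    also have "\<dots> \<le> 1 / (1 - a)" using a a2 by (intro divide_left_mono) auto
    finally show "(\<Sum>k<n. (a\<^sup>2) ^ k) \<le> 1 / (1 - a)" .
  qed simp
  also have "\<dots> \<le> (h * q p / ?d\<^sup>2) * (1 / (1 - a))"
  proof (rule mult_right_mono)
    have "\<alpha> * a \<le> \<alpha> * 1" using a kappa_bounds by (intro mult_left_mono) auto
    also have "\<alpha> * 1 = 1 - \<kappa>" by (simp add: field_simps)
    finally have 1: "\<alpha> * a + \<kappa> \<le> 1" by linarith
    have 0: "0 \<le> \<alpha> * a + \<kappa>" using a kappa_bounds by (intro add_nonneg_nonneg mult_nonneg_nonneg) auto
    have "(\<alpha> * a + \<kappa>)\<^sup>2 \<le> 1" using 0 1 by (rule power_le_one)
    moreover have "0 \<le> h * q p / ?d\<^sup>2" using h_pos q_nonneg by simp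
    ultimately have "h * q p / ?d\<^sup>2 * (\<alpha> * a + \<kappa>)\<^sup>2 \<le> h * q p / ?d\<^sup>2 * 1" by (intro mult_left_mono)
    then show "b\<^sup>2 \<le> h * q p / ?d\<^sup>2"
      using h_pos q_nonneg[of p] by (simp only: b_def power_mult_distrib power_divide real_sqrt_pow2 less_imp_le) simp
  qed (use a in simp)
  also have "1 / (1 - a) = (1 + ?x) / ?x" using x by (simp add: a_def field_simps)
  also have "(h * q p / ?d\<^sup>2) * ((1 + ?x) / ?x) = ((1 + ?x) / ?d\<^sup>2) * (q p / lam p)"
    using h_pos by simp
  also have "\<dots> \<le> 1 * (q p / lam p)"
  proof (rule mult_right_mono)
    have "1 + ?x \<le> ?d\<^sup>2"
      using one_plus_le_square[OF less_imp_le[OF x] kappa_bounds(1)] unfolding mult.assoc .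
    then show "(1 + ?x) / ?d\<^sup>2 \<le> 1" using d by (simp add: divide_le_eq)
  qed (use q_nonneg lam_pos in \<open>simp add: less_imp_le\<close>)
  finally show ?thesis by simp
qed

lemma stoch_conv_moment:
  shows "integrable \<Omega> (\<lambda>\<omega>. norm (stoch_conv n \<omega>))" "expectation (\<lambda>\<omega>. norm (stoch_conv n \<omega>)) \<le> 1 + \<tau>"
proof -
  interpret R: bounded_linear R by (rule R_bounded_linear)
  have "(\<integral>\<^sup>+\<omega>. ennreal ((inner (stoch_conv n \<omega>) (e p))\<^sup>2) \<partial>\<Omega>) \<le> ennreal (q p / lam p)" for p
  proof -
    define a where "a = 1 / (1 + h * lam p)"
    define c where "c = sqrt (q p) / (1 + \<kappa> * h * lam p)"
    define b where "b = sqrt h * c * (\<alpha> * a + \<kappa>)"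
    \<comment> \<open>Discrete variation of constants.\<close>
    have "AE \<omega> in \<Omega>. inner (stoch_conv n \<omega>) (e p) = (\<Sum>k<n. \<gamma> k \<omega> p * (a ^ (n - Suc k) * b))"
      using AE_W_coord
    proof eventually_elim
      case (elim \<omega>)
      then have W: "inner (W (\<gamma> n \<omega>)) (e p) = \<gamma> n \<omega> p * c" for n by (simp add: c_def)
      show ?case
      proof (induction n)
        case (Suc n)
        have "inner (stoch_conv (Suc n) \<omega>) (e p)
            = a * (inner (stoch_conv n \<omega>) (e p) + \<alpha> * sqrt h * (\<gamma> n \<omega> p * c)) + \<kappa> * sqrt h * (\<gamma> n \<omega> p * c)"
          by (simp add: inner_add_left R_coord W a_def)
        also have "\<dots> = a * (\<Sum>k<n. \<gamma> k \<omega> p * (a ^ (n - Suc k) * b)) + \<gamma> n \<omega> p * b"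
          unfolding Suc b_def by (simp add: algebra_simps)
        also have "a * (\<Sum>k<n. \<gamma> k \<omega> p * (a ^ (n - Suc k) * b)) = (\<Sum>k<n. \<gamma> k \<omega> p * (a ^ (Suc n - Suc k) * b))"
          unfolding sum_distrib_left
        proof (rule sum.cong[OF refl])
          fix k assume "k \<in> {..<n}"
          then have "a ^ (Suc n - Suc k) = a * a ^ (n - Suc k)" by (simp add: Suc_diff_Suc flip: power_Suc)
          then show "a * (\<gamma> k \<omega> p * (a ^ (n - Suc k) * b)) = \<gamma> k \<omega> p * (a ^ (Suc n - Suc k) * b)" by simp
        qed
        finally show ?case by simp
      qed simp
    qed
    then have "(\<integral>\<^sup>+\<omega>. ennreal ((inner (stoch_conv n \<omega>) (e p))\<^sup>2) \<partial>\<Omega>)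
        = (\<integral>\<^sup>+\<omega>. ennreal ((\<Sum>k<n. \<gamma> k \<omega> p * (a ^ (n - Suc k) * b))\<^sup>2) \<partial>\<Omega>)"
      by (intro nn_integral_cong_AE) (auto elim!: eventually_mono)
    also have "\<dots> = ennreal (\<Sum>k<n. (a ^ (n - Suc k) * b)\<^sup>2)" by (rule white_noise_combination) simp
    also have "\<dots> \<le> ennreal (q p / lam p)"
      unfolding a_def b_def c_def by (intro ennreal_leI stoch_conv_coord_bound)
    finally show ?thesis .
  qed
  from norm_expectation_le[OF stoch_conv_measurable this]
  show "integrable \<Omega> (\<lambda>\<omega>. norm (stoch_conv n \<omega>))" "expectation (\<lambda>\<omega>. norm (stoch_conv n \<omega>)) \<le> 1 + \<tau>" by auto
qed

abbreviation \<delta> :: real where "\<delta> \<equiv> drift_bound F L (lam 0) \<tau>"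

abbreviation U0 :: "nat \<Rightarrow> 'w \<Rightarrow> 'a" where "U0 \<equiv> post_u D A F e q \<beta> h 0"

lemma U0_measurable [measurable]: "U0 n \<in> borel_measurable \<Omega>"
  by (rule chain.driven_chain_independent(1)[where U=U0 and x=0, OF driven _ post_u_Suc]) simp

text \<open>
  In the difference of the scheme and the stochastic convolution the additive noise cancels. The
  noise survives inside \<open>F\<close> only, where it comes with the factor \<open>h\<close>.
\<close>
lemma remainder_step:
  "norm (U0 (Suc n) \<omega> - stoch_conv (Suc n) \<omega>) \<le> ((1 + h * L) * norm (U0 n \<omega> - stoch_conv n \<omega>)
     + h * (norm (F 0) + L * norm (stoch_conv n \<omega>) + L / 2 * norm (sqrt h *\<^sub>R W (\<gamma> n \<omega>)))) / (1 + h * lam 0)"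
proof -
  interpret R: bounded_linear R by (rule R_bounded_linear)
  let ?w = "W (\<gamma> n \<omega>)" and ?u = "U0 n \<omega>" and ?z = "stoch_conv n \<omega>"
  let ?F = "F (?u + (1 / 2 * sqrt h) *\<^sub>R ?w)"
  have "U0 (Suc n) \<omega> - stoch_conv (Suc n) \<omega> = R ((?u - ?z) + h *\<^sub>R ?F)"
    unfolding post_u_Suc step_def stoch_conv.simps by (simp add: R.add R.diff)
  then have "norm (U0 (Suc n) \<omega> - stoch_conv (Suc n) \<omega>) \<le> norm ((?u - ?z) + h *\<^sub>R ?F) / (1 + h * lam 0)"
    using norm_R_le by simp
  also have "\<dots> \<le> (norm (?u - ?z) + h * (norm (F 0) + L * (norm (?u - ?z) + norm ?z + 1 / 2 * norm (sqrt h *\<^sub>R ?w)))) / (1 + h * lam 0)"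
  proof (rule divide_right_mono)
    have "?u + (1 / 2 * sqrt h) *\<^sub>R ?w = (?u - ?z) + ?z + (1 / 2) *\<^sub>R (sqrt h *\<^sub>R ?w)" by simp
    then have "norm (?u + (1 / 2 * sqrt h) *\<^sub>R ?w) \<le> norm (?u - ?z) + norm ?z + norm ((1 / 2) *\<^sub>R (sqrt h *\<^sub>R ?w))"
      using norm_triangle_ineq[of "(?u - ?z) + ?z" "(1 / 2) *\<^sub>R (sqrt h *\<^sub>R ?w)"] norm_triangle_ineq[of "?u - ?z" ?z]
      by (simp only:)
    also have "norm ((1 / 2) *\<^sub>R (sqrt h *\<^sub>R ?w)) = 1 / 2 * norm (sqrt h *\<^sub>R ?w)" by (subst norm_scaleR) simp
    finally have "L * norm (?u + (1 / 2 * sqrt h) *\<^sub>R ?w) \<le> L * (norm (?u - ?z) + norm ?z + 1 / 2 * norm (sqrt h *\<^sub>R ?w))"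
      by (rule mult_left_mono[OF _ L_nonneg])
    with norm_F_le[of "?u + (1 / 2 * sqrt h) *\<^sub>R ?w"]
    have "norm ?F \<le> norm (F 0) + L * (norm (?u - ?z) + norm ?z + 1 / 2 * norm (sqrt h *\<^sub>R ?w))"
      by linarith
    then have "h * norm ?F \<le> h * (norm (F 0) + L * (norm (?u - ?z) + norm ?z + 1 / 2 * norm (sqrt h *\<^sub>R ?w)))"
      using h_pos by (intro mult_left_mono) simp_all
    moreover have "norm ((?u - ?z) + h *\<^sub>R ?F) \<le> norm (?u - ?z) + h * norm ?F"
      using norm_triangle_ineq[of "?u - ?z" "h *\<^sub>R ?F"] h_pos by simp
    ultimately show "norm ((?u - ?z) + h *\<^sub>R ?F) \<le> norm (?u - ?z) + h * (norm (F 0) + L * (norm (?u - ?z) + norm ?z + 1 / 2 * norm (sqrt h *\<^sub>R ?w)))"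
      by linarith
  qed (use denom_gt_1[of 0] in simp)
  also have "\<dots> = ((1 + h * L) * norm (?u - ?z) + h * (norm (F 0) + L * norm ?z + L / 2 * norm (sqrt h *\<^sub>R ?w))) / (1 + h * lam 0)"
    by (simp add: algebra_simps)
  finally show ?thesis .
qed

lemma tau_nonneg: "0 \<le> \<tau>"
  using q_nonneg lam_pos by (intro suminf_nonneg summable_q_lam) (simp add: less_imp_le)

text \<open>
  \<open>\<delta>\<close> is the fixed point of the recursion for the first moment and dominates the initial value \<open>0\<close>.
\<close>
lemma remainder_moment:
  "integrable \<Omega> (\<lambda>\<omega>. norm (U0 n \<omega> - stoch_conv n \<omega>)) \<and> expectation (\<lambda>\<omega>. norm (U0 n \<omega> - stoch_conv n \<omega>)) \<le> \<delta>"
proof (induction n)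
  case 0
  have "0 \<le> \<delta>" unfolding drift_bound_def using L_nonneg L_less tau_nonneg by simp
  then show ?case by simp
next
  case (Suc n)
  let ?y = "\<lambda>n \<omega>. norm (U0 n \<omega> - stoch_conv n \<omega>)"
  let ?r = "1 + h * lam 0"
  let ?b = "\<lambda>\<omega>. ((1 + h * L) * ?y n \<omega> + h * (norm (F 0) + L * norm (stoch_conv n \<omega>) + L / 2 * norm (sqrt h *\<^sub>R W (\<gamma> n \<omega>)))) / ?r"
  have ib: "integrable \<Omega> ?b"
    using Suc stoch_conv_moment(1) W_moment(1)
    by (intro integrable_divide Bochner_Integration.integrable_add integrable_mult_right integrable_const) blast+
  have i: "integrable \<Omega> (?y (Suc n))"
  proof (rule Bochner_Integration.integrable_bound[OF ib])
    show "AE \<omega> in \<Omega>. norm (?y (Suc n) \<omega>) \<le> norm (?b \<omega>)"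
      using remainder_step[of n] by (intro always_eventually allI) (smt (verit) norm_ge_zero real_norm_def)
  qed measurable
  have "expectation (?y (Suc n)) \<le> expectation ?b"
    by (rule integral_mono[OF i ib remainder_step])
  also have "\<dots> = ((1 + h * L) * expectation (?y n) + h * (norm (F 0) + L * expectation (\<lambda>\<omega>. norm (stoch_conv n \<omega>))
      + L / 2 * expectation (\<lambda>\<omega>. norm (sqrt h *\<^sub>R W (\<gamma> n \<omega>))))) / ?r"
    using Suc stoch_conv_moment(1) W_moment(1) by (simp add: prob_space del: norm_scaleR)
  also have "\<dots> \<le> ((1 + h * L) * \<delta> + h * (norm (F 0) + L * (1 + \<tau>) + L / 2 * (1 + \<tau>))) / ?r"
    using Suc stoch_conv_moment(2) W_moment(2) L_nonneg h_pos denom_gt_1[of 0]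
    by (intro divide_right_mono add_mono mult_left_mono) auto
  also have "norm (F 0) + L * (1 + \<tau>) + L / 2 * (1 + \<tau>) = \<delta> * (lam 0 - L)"
    using L_less by (simp add: drift_bound_def)
  also have "((1 + h * L) * \<delta> + h * (\<delta> * (lam 0 - L))) / ?r = \<delta>"
  proof -
    have "(1 + h * L) * \<delta> + h * (\<delta> * (lam 0 - L)) = \<delta> * ?r" by (simp add: algebra_simps)
    then show ?thesis using denom_gt_1[of 0] by simp
  qed
  finally show ?case using i by blast
qed

lemma U0_moment: "expectation (\<lambda>\<omega>. norm (U0 n \<omega>)) \<le> \<delta> + (1 + \<tau>)"
proof -
  have i: "integrable \<Omega> (\<lambda>\<omega>. norm (U0 n \<omega> - stoch_conv n \<omega>) + norm (stoch_conv n \<omega>))"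
    using remainder_moment stoch_conv_moment by simp
  have le: "norm (U0 n \<omega>) \<le> norm (U0 n \<omega> - stoch_conv n \<omega>) + norm (stoch_conv n \<omega>)" for \<omega>
    using norm_triangle_ineq[of "U0 n \<omega> - stoch_conv n \<omega>" "stoch_conv n \<omega>"] by simp
  have "expectation (\<lambda>\<omega>. norm (U0 n \<omega>)) \<le> expectation (\<lambda>\<omega>. norm (U0 n \<omega> - stoch_conv n \<omega>) + norm (stoch_conv n \<omega>))"
    by (rule integral_mono[OF Bochner_Integration.integrable_bound[OF i] i]) (use le in auto)
  also have "\<dots> \<le> \<delta> + (1 + \<tau>)"
    using remainder_moment[of n] stoch_conv_moment[of n] by simp
  finally show ?thesis .
qed


section \<open>Convergence to equilibrium\<close>

lemma post_u_expectation:
  assumes \<phi>: "C-lipschitz_on UNIV \<phi>"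
  shows "integrable \<Omega> (\<lambda>\<omega>. \<phi> (post_u D A F e q \<beta> h u0 n \<omega>))"
    and "expectation (\<lambda>\<omega>. \<phi> (post_u D A F e q \<beta> h u0 n \<omega>)) = (chain.markov_op ^^ n) \<phi> u0"
  using chain.driven_chain_markov_op[where U="post_u D A F e q \<beta> h u0" and x=u0, OF driven _ post_u_Suc \<phi>]
  by simp_all

lemma post_ubar_expectation:
  assumes \<phi>: "C-lipschitz_on UNIV \<phi>"
  shows "integrable \<Omega> (\<lambda>\<omega>. \<phi> (post_ubar D A F e q \<beta> h J3 u0 n \<omega>))"
    and "expectation (\<lambda>\<omega>. \<phi> (post_ubar D A F e q \<beta> h J3 u0 n \<omega>)) = (chain.markov_op ^^ n) (chain.obs_op \<phi>) u0"
  using chain.driven_chain_observed[where U="post_u D A F e q \<beta> h u0" and x=u0, OF driven _ post_u_Suc \<phi>]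
  by (simp_all add: post_ubar_eq)

text \<open>
  The norm is itself a Lipschitz test function, so its mean along the chain started at \<open>0\<close> converges to
  its mean under the invariant law.
\<close>
lemma stationary_moment: "(\<integral>x. norm x \<partial>chain.limit_law) \<le> \<delta> + (1 + \<tau>)"
proof -
  have norm_lip: "1-lipschitz_on UNIV (norm :: 'a \<Rightarrow> real)"
    by (rule lipschitz_onI) (auto simp: dist_norm norm_triangle_ineq3)
  let ?I = "\<integral>x. norm x \<partial>chain.limit_law"
  have gap: "\<forall>\<^sub>F n in sequentially. norm (expectation (\<lambda>\<omega>. norm (U0 n \<omega>)) - ?I) \<le> \<rho> ^ n * ?I"
    using chain.markov_op_power_converges[OF chain.limit_law_invariant chain.limit_law_moment norm_lip, of _ 0]
    by (intro always_eventually allI) (simp add: post_u_expectation(2)[OF norm_lip])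
  have "(\<lambda>n. \<rho> ^ n * ?I) \<longlonglongrightarrow> 0"
    using chain.rate by (intro tendsto_mult_left_zero LIMSEQ_realpow_zero)
  with gap have "(\<lambda>n. expectation (\<lambda>\<omega>. norm (U0 n \<omega>)) - ?I) \<longlonglongrightarrow> 0"
    by (rule Lim_null_comparison)
  then have "(\<lambda>n. expectation (\<lambda>\<omega>. norm (U0 n \<omega>))) \<longlonglongrightarrow> ?I" by (rule LIM_zero_cancel)
  then show ?thesis by (rule LIMSEQ_le_const2) (use U0_moment in blast)
qed

text \<open>
  \<open>\<rho> = 1 - (\<lambda>\<^sub>0 - L) h / (1 + \<lambda>\<^sub>0 h)\<close> and \<open>1 + x \<le> exp x\<close>.
\<close>
lemma rho_power_le: "\<rho> ^ n \<le> exp (- ((lam 0 - L) / (1 + lam 0 * h)) * (real n * h))"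
proof -
  have "\<rho> = 1 + - ((lam 0 - L) / (1 + lam 0 * h)) * h"
    using denom_gt_1[of 0] by (simp add: \<rho>_def field_simps)
  also have "\<dots> \<le> exp (- ((lam 0 - L) / (1 + lam 0 * h)) * h)" by (rule exp_ge_add_one_self)
  finally have "\<rho> ^ n \<le> exp (- ((lam 0 - L) / (1 + lam 0 * h)) * h) ^ n"
    using chain.rate(1) by (intro power_mono)
  then show ?thesis by (simp add: ac_simps flip: exp_of_nat_mult)
qed

lemma markov_op_gap:
  assumes \<phi>: "C-lipschitz_on UNIV \<phi>"
  shows "\<bar>(chain.markov_op ^^ n) \<phi> x - (\<integral>y. \<phi> y \<partial>chain.limit_law)\<bar>
    \<le> C * (norm x + (\<delta> + (1 + \<tau>))) * exp (- ((lam 0 - L) / (1 + lam 0 * h)) * (real n * h))"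
proof -
  have C: "0 \<le> C" using \<phi> lipschitz_on_nonneg by blast
  have "\<bar>(chain.markov_op ^^ n) \<phi> x - (\<integral>y. \<phi> y \<partial>chain.limit_law)\<bar>
      \<le> C * \<rho> ^ n * (norm x + (\<integral>y. norm y \<partial>chain.limit_law))"
    using chain.markov_op_power_converges[OF chain.limit_law_invariant chain.limit_law_moment \<phi>] by simp
  also have "\<dots> \<le> C * exp (- ((lam 0 - L) / (1 + lam 0 * h)) * (real n * h)) * (norm x + (\<delta> + (1 + \<tau>)))"
    using C stationary_moment rho_power_le[of n] chain.rate(1)
    by (intro mult_mono mult_left_mono add_left_mono mult_nonneg_nonneg add_nonneg_nonneg integral_nonneg) auto
  finally show ?thesis by (simp add: ac_simps)
qed

end

theorem proposition3p3:
  fixes D :: "'a::{real_inner, polish_space} set"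
    and A Q F :: "'a \<Rightarrow> 'a"
    and e :: "nat \<Rightarrow> 'a"
    and lam q :: "nat \<Rightarrow> real"
  assumes A_selfadjoint: "self_adjoint_on D (\<lambda>x. - A x)"
    and e_complete: "complete_orthonormal e"
    and A_eigen: "\<And>p. e p \<in> D" "\<And>p. A (e p) = - lam p *\<^sub>R e p"
    and lam: "0 < lam 0" "mono lam" "filterlim lam at_top sequentially"
    and Q_bounded: "bounded_linear Q"
    and Q_selfadjoint: "\<And>x y. inner (Q x) y = inner x (Q y)"
    and Q_nonneg: "\<And>x. 0 \<le> inner (Q x) x"
    and Q_eigen: "\<And>p. Q (e p) = q p *\<^sub>R e p"
    and q: "\<And>p. 0 \<le> q p" "bounded (range q)"
    and trace_cond: "0 < s_bar e lam Q"
    and F_Lipschitz: "\<exists>K. K-lipschitz_on UNIV F"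
    and F_const: "lip_const F < lam 0"
  shows "\<exists>C :: ('a \<Rightarrow> real) \<Rightarrow> real \<Rightarrow> real.
    \<forall>(\<Omega> :: 'w measure) \<beta> h J3.
      prob_space \<Omega> \<and> indep_wiener \<Omega> \<beta> \<and> 0 < h \<and> h < 1 \<and> is_J3 D A Q h J3 \<longrightarrow>
      (\<exists>!M. invariant_distribution (post_kernel \<Omega> D A F e q \<beta> h J3) M) \<and>
      (\<forall>M. invariant_distribution (post_kernel \<Omega> D A F e q \<beta> h J3) M \<longrightarrow>
        (\<forall>\<phi> :: 'a \<Rightarrow> real. (\<exists>K. K-lipschitz_on UNIV \<phi>) \<longrightarrow>
          integrable (distr M borel fst) \<phi> \<and>
          integrable (distr M borel snd) \<phi> \<and>
          (\<forall>u0 n.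
            integrable \<Omega> (\<lambda>\<omega>. \<phi> (post_u D A F e q \<beta> h u0 n \<omega>)) \<and>
            integrable \<Omega> (\<lambda>\<omega>. \<phi> (post_ubar D A F e q \<beta> h J3 u0 n \<omega>)) \<and>
            \<bar>(\<integral>\<omega>. \<phi> (post_u D A F e q \<beta> h u0 n \<omega>) \<partial>\<Omega>) - (\<integral>x. \<phi> x \<partial>(distr M borel fst))\<bar>
            + \<bar>(\<integral>\<omega>. \<phi> (post_ubar D A F e q \<beta> h J3 u0 n \<omega>) \<partial>\<Omega>) - (\<integral>x. \<phi> x \<partial>(distr M borel snd))\<bar>
            \<le> C \<phi> (norm u0) *
               exp (- ((lam 0 - lip_const F) / (1 + lam 0 * h)) * (real n * h)))))"
proof -
  define L where "L = lip_const F"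
  \<comment> \<open>B bounds the first moment of the invariant law for all h.\<close>
  define B where "B = drift_bound F L (lam 0) (\<Sum>p. q p / lam p) + (1 + (\<Sum>p. q p / lam p))"
  define C :: "('a \<Rightarrow> real) \<Rightarrow> real \<Rightarrow> real" where "C \<phi> r = 2 * ((SOME K. K-lipschitz_on UNIV \<phi>) * (r + B))" for \<phi> r
  have "e 0 \<noteq> 0"
  proof
    assume "e 0 = 0"
    moreover have "inner (e 0) (e 0) = 1" using e_complete by (simp add: complete_orthonormal_def)
    ultimately show False by simp
  qed
  then have F_lip: "L-lipschitz_on UNIV F"
    using F_Lipschitz lip_const_lipschitz unfolding L_def by blast
  have L_less: "L < lam 0" using F_const by (simp add: L_def)
  show ?thesis
  proof (intro exI[of _ C] allI impI, elim conjE)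
    fix \<Omega> :: "'w measure" and \<beta> h J3
    assume \<Omega>: "prob_space \<Omega>" "indep_wiener \<Omega> \<beta>" "0 < h" "h < 1" "is_J3 D A Q h J3"
    interpret prob_space \<Omega> by fact
    interpret dissipative_scheme e D A lam Q q \<Omega> \<beta> h F L J3
      by (intro dissipative_scheme.intro dissipative_scheme_axioms.intro diagonal_covariance.intro
            diagonal_covariance_axioms.intro diagonal_generator.intro diagonal_generator_axioms.intro
            orthonormal_basis.intro wiener_sequence.intro wiener_sequence_axioms.intro)
         (fact e_complete A_selfadjoint A_eigen lam(1,2) Q_bounded Q_eigen q(1) trace_cond \<Omega> F_lip L_less)+
    let ?K = "post_kernel \<Omega> D A F e q \<beta> h J3"
    let ?r = "\<lambda>n. exp (- ((lam 0 - lip_const F) / (1 + lam 0 * h)) * (real n * h))"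
    have inv: "invariant_distribution ?K M \<longleftrightarrow> M = chain.stationary_pair_law" for M
      unfolding post_kernel_eq by (rule chain.invariant_pair_iff)
    show "(\<exists>!M. invariant_distribution ?K M) \<and>
      (\<forall>M. invariant_distribution ?K M \<longrightarrow>
        (\<forall>\<phi> :: 'a \<Rightarrow> real. (\<exists>K. K-lipschitz_on UNIV \<phi>) \<longrightarrow>
          integrable (distr M borel fst) \<phi> \<and>
          integrable (distr M borel snd) \<phi> \<and>
          (\<forall>u0 n.
            integrable \<Omega> (\<lambda>\<omega>. \<phi> (post_u D A F e q \<beta> h u0 n \<omega>)) \<and>
            integrable \<Omega> (\<lambda>\<omega>. \<phi> (post_ubar D A F e q \<beta> h J3 u0 n \<omega>)) \<and>
            \<bar>(\<integral>\<omega>. \<phi> (post_u D A F e q \<beta> h u0 n \<omega>) \<partial>\<Omega>) - (\<integral>x. \<phi> x \<partial>(distr M borel fst))\<bar>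
            + \<bar>(\<integral>\<omega>. \<phi> (post_ubar D A F e q \<beta> h J3 u0 n \<omega>) \<partial>\<Omega>) - (\<integral>x. \<phi> x \<partial>(distr M borel snd))\<bar>
            \<le> C \<phi> (norm u0) * ?r n)))"
    proof (intro conjI allI impI)
      show "\<exists>!M. invariant_distribution ?K M" unfolding inv by simp
      fix M assume "invariant_distribution ?K M"
      then have M: "M = chain.stationary_pair_law" by (simp only: inv)
      fix \<phi> :: "'a \<Rightarrow> real" assume "\<exists>K. K-lipschitz_on UNIV \<phi>"
      define c where "c = (SOME K. K-lipschitz_on UNIV \<phi>)"
      have \<phi>: "c-lipschitz_on UNIV \<phi>" unfolding c_def by (rule someI_ex) fact
      show "integrable (distr M borel fst) \<phi>"
        unfolding M chain.stationary_pair_law_fst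
        by (rule chain.invariant_law_integrable_lipschitz[OF chain.limit_law_invariant chain.limit_law_moment \<phi>])
      show "integrable (distr M borel snd) \<phi>"
        unfolding M by (rule chain.stationary_pair_law_snd(1)[OF \<phi>])
      fix u0 n
      show "integrable \<Omega> (\<lambda>\<omega>. \<phi> (post_u D A F e q \<beta> h u0 n \<omega>))" by (rule post_u_expectation(1)[OF \<phi>])
      show "integrable \<Omega> (\<lambda>\<omega>. \<phi> (post_ubar D A F e q \<beta> h J3 u0 n \<omega>))" by (rule post_ubar_expectation(1)[OF \<phi>])
      have "\<bar>(\<integral>\<omega>. \<phi> (post_u D A F e q \<beta> h u0 n \<omega>) \<partial>\<Omega>) - (\<integral>x. \<phi> x \<partial>(distr M borel fst))\<bar> \<le> c * (norm u0 + B) * ?r n"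
        using markov_op_gap[OF \<phi>]
        by (simp only: M chain.stationary_pair_law_fst post_u_expectation(2)[OF \<phi>] B_def L_def)
      moreover have "\<bar>(\<integral>\<omega>. \<phi> (post_ubar D A F e q \<beta> h J3 u0 n \<omega>) \<partial>\<Omega>) - (\<integral>x. \<phi> x \<partial>(distr M borel snd))\<bar> \<le> c * (norm u0 + B) * ?r n"
        using markov_op_gap[OF chain.obs_op_lipschitz[OF \<phi>]]
        by (simp only: M chain.stationary_pair_law_snd(2)[OF \<phi>] post_ubar_expectation(2)[OF \<phi>] B_def L_def)
      ultimately show "\<bar>(\<integral>\<omega>. \<phi> (post_u D A F e q \<beta> h u0 n \<omega>) \<partial>\<Omega>) - (\<integral>x. \<phi> x \<partial>(distr M borel fst))\<bar>
            + \<bar>(\<integral>\<omega>. \<phi> (post_ubar D A F e q \<beta> h J3 u0 n \<omega>) \<partial>\<Omega>) - (\<integral>x. \<phi> x \<partial>(distr M borel snd))\<bar>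
            \<le> C \<phi> (norm u0) * ?r n"
        unfolding C_def c_def[symmetric] by (simp only: mult_2 distrib_right)
    qed
  qed
qed

end
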